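(* Let $-1<q\le1$, $\rho_{13},\rho_{23}\in(-1,1)$ and $x_1,x_2\in S(q)$. Then for $x_3\in S(q)$ $$f_{AW}(x_3|x_1,\rho_{13},x_2,\rho_{23},q)=f_{CN}(x_3|x_2,\rho_{23},q)\sum_{s\ge0}\frac{\rho_{13}^s}{[s]_q!\,(\rho_{13}^2\rho_{23}^2)_s}P_s(x_1|x_2,\rho_{13}\rho_{23},q)P_s(x_3|x_2,\rho_{23},q).$$ Moreover, for every $n\ge1$, $$\int_{S(q)}\Big(P_n(x_3|x_2,\rho_{23},q)-\frac{\rho_{13}^n(\rho_{23}^2)_n}{(\rho_{13}^2\rho_{23}^2)_n}P_n(x_1|x_2,\rho_{13}\rho_{23},q)\Big)f_{AW}(x_3|x_1,\rho_{13},x_2,\rho_{23},q)\,dx_3=0,$$ and consequently there exist functions $F_{j,n}(x_1,x_2|\rho_{13},\rho_{23},q)$, $0\le n\le j$, not depending on $x_3$, such that for every $j\ge1$ $$A_j(x_3|x_1,\rho_{13},x_2,\rho_{23},q)=\sum_{n=0}^jF_{j,n}(x_1,x_2|\rho_{13},\rho_{23},q)\Big(P_n(x_3|x_2,\rho_{23},q)-\frac{\rho_{13}^n(\rho_{23}^2)_n}{(\rho_{13}^2\rho_{23}^2)_n}P_n(x_1|x_2,\rho_{13}\rho_{23},q)\Big).$$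
   Context: Notation: $[0]_q=0$, $[n]_q=1+q+\dots+q^{n-1}$, $[n]_q!=\prod_{i=1}^n[i]_q$, $[0]_q!=1$; $(a)_n=\prod_{i=0}^{n-1}(1-aq^i)$, $(a)_0=1$, $(a)_\infty=\prod_{i\ge0}(1-aq^i)$; $S(q)=[-2/\sqrt{1-q},2/\sqrt{1-q}]$ for $|q|<1$, $S(1)=\mathbb R$. Al-Salam–Chihara polynomials: $P_{-1}=0$, $P_0=1$, $P_{n+1}(x|y,\rho,q)=(x-\rho yq^n)P_n(x|y,\rho,q)-(1-\rho^2q^{n-1})[n]_qP_{n-1}(x|y,\rho,q)$, $n\ge0$. Densities, for $|q|<1$, $x,y\in S(q)$, $|\rho|<1$: $$f_N(x|q)=\frac{(q)_\infty\sqrt{1-q}}{2\pi}\sqrt{4-(1-q)x^2}\prod_{k=1}^\infty\big((1+q^k)^2-(1-q)x^2q^k\big),\qquad f_{CN}(x|y,\rho,q)=f_N(x|q)\,(\rho^2)_\infty\prod_{k=0}^\infty\frac1{v_0(x,y|\rho q^k,q)},$$ where $v_0(x,y|\rho,q)=(1-\rho^2)^2-(1-q)\rho(1+\rho^2)xy+(1-q)\rho^2(x^2+y^2)$. For $q=1$: $f_{CN}(x|y,\rho,1)=\frac1{\sqrt{2\pi(1-\rho^2)}}\exp\left(-\frac{(x-\rho y)^2}{2(1-\rho^2)}\right)$. The Askey–Wilson density is $$f_{AW}(x|y,\rho_1,z,\rho_2,q)=\frac{f_{CN}(y|x,\rho_1,q)\,f_{CN}(x|z,\rho_2,q)}{f_{CN}(y|z,\rho_1\rho_2,q)},$$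 where in the ratio $f_{CN}(y|x,\rho_1,q)/f_{CN}(y|z,\rho_1\rho_2,q)$ the common factor $f_N(y|q)$ is cancelled. $\{A_j(x_3|x_1,\rho_{13},x_2,\rho_{23},q)\}_{j\ge0}$ denotes the (re-scaled) Askey–Wilson polynomials with the corresponding complex parameters, i.e. the sequence of polynomials in $x_3$, $\deg A_j=j$, orthogonal on $S(q)$ with respect to the density $f_{AW}(x_3|x_1,\rho_{13},x_2,\rho_{23},q)$ (determined up to normalization). *)

theory Defs
  imports "HOL-Analysis.Analysis" "HOL-Computational_Algebra.Polynomial"
begin

definition qnum :: "real \<Rightarrow> nat \<Rightarrow> real" where
  "qnum q n = (\<Sum>i<n. q ^ i)"

definition qfact :: "real \<Rightarrow> nat \<Rightarrow> real" where
  "qfact q n = (\<Prod>i=1..n. qnum q i)"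

definition qpoch :: "real \<Rightarrow> real \<Rightarrow> nat \<Rightarrow> real" where
  "qpoch a q n = (\<Prod>i<n. 1 - a * q ^ i)"

definition qpoch_inf :: "real \<Rightarrow> real \<Rightarrow> real" where
  "qpoch_inf a q = (\<Prod>i. 1 - a * q ^ i)"

definition S :: "real \<Rightarrow> real set" where
  "S q = (if q = 1 then UNIV else {- 2 / sqrt (1 - q) .. 2 / sqrt (1 - q)})"

text \<open>Al-Salam--Chihara polynomials \<open>P\<^sub>n(x|y,\<rho>,q)\<close>; since \<open>[0]\<^sub>q = 0\<close> and
  \<open>P\<^sub>-\<^sub>1 = 0\<close>, the step \<open>n = 0\<close> of the three-term recurrence reads
  \<open>P\<^sub>1 = x - \<rho> y\<close>.\<close>

fun P :: "nat \<Rightarrow> real \<Rightarrow> real \<Rightarrow> real \<Rightarrow> real \<Rightarrow> real" where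
  "P 0 x y \<rho> q = 1"
| "P (Suc 0) x y \<rho> q = x - \<rho> * y"
| "P (Suc (Suc n)) x y \<rho> q =
     (x - \<rho> * y * q ^ Suc n) * P (Suc n) x y \<rho> q
     - (1 - \<rho>\<^sup>2 * q ^ n) * qnum q (Suc n) * P n x y \<rho> q"

text \<open>The functions \<open>f_N\<close> and \<open>cn_factor\<close> are only meant for \<open>\<bar>q\<bar> < 1\<close>. There
  \<open>(a)\<^sub>\<infinity>\<close> is the infinite product with base \<open>q\<close>.\<close>

definition f_N :: "real \<Rightarrow> real \<Rightarrow> real" where
  "f_N x q = qpoch_inf q q * sqrt (1 - q) / (2 * pi) * sqrt (4 - (1 - q) * x\<^sup>2)
     * (\<Prod>k. (1 + q ^ Suc k)\<^sup>2 - (1 - q) * x\<^sup>2 * q ^ Suc k)"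

definition v0 :: "real \<Rightarrow> real \<Rightarrow> real \<Rightarrow> real \<Rightarrow> real" where
  "v0 x y \<rho> q = (1 - \<rho>\<^sup>2)\<^sup>2 - (1 - q) * \<rho> * (1 + \<rho>\<^sup>2) * x * y
     + (1 - q) * \<rho>\<^sup>2 * (x\<^sup>2 + y\<^sup>2)"

text \<open>\<open>cn_factor\<close> is what remains of \<open>f_CN\<close> once the factor \<open>f_N\<close> is removed.\<close>

definition cn_factor :: "real \<Rightarrow> real \<Rightarrow> real \<Rightarrow> real \<Rightarrow> real" where
  "cn_factor x y \<rho> q = qpoch_inf (\<rho>\<^sup>2) q * (\<Prod>k. 1 / v0 x y (\<rho> * q ^ k) q)"

definition f_CN :: "real \<Rightarrow> real \<Rightarrow> real \<Rightarrow> real \<Rightarrow> real" where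
  "f_CN x y \<rho> q =
     (if q = 1 then 1 / sqrt (2 * pi * (1 - \<rho>\<^sup>2)) * exp (- (x - \<rho> * y)\<^sup>2 / (2 * (1 - \<rho>\<^sup>2)))
      else f_N x q * cn_factor x y \<rho> q)"

text \<open>For \<open>q \<noteq> 1\<close> the common factor \<open>f_N y q\<close> of
  \<open>f_CN y x \<rho>1 q / f_CN y z (\<rho>1 * \<rho>2) q\<close> is cancelled, so that the quotient also
  makes sense at the end points of \<open>S q\<close>, where \<open>f_N y q = 0\<close>.\<close>

definition f_AW :: "real \<Rightarrow> real \<Rightarrow> real \<Rightarrow> real \<Rightarrow> real \<Rightarrow> real \<Rightarrow> real" where
  "f_AW x y \<rho>1 z \<rho>2 q =
     (if q = 1 then f_CN y x \<rho>1 q * f_CN x z \<rho>2 q / f_CN y z (\<rho>1 * \<rho>2) q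
      else cn_factor y x \<rho>1 q * f_CN x z \<rho>2 q / cn_factor y z (\<rho>1 * \<rho>2) q)"

definition orthogonal_poly_seq :: "real set \<Rightarrow> (real \<Rightarrow> real) \<Rightarrow> (nat \<Rightarrow> real poly) \<Rightarrow> bool" where
  "orthogonal_poly_seq X w p \<longleftrightarrow>
     (\<forall>j. p j \<noteq> 0 \<and> degree (p j) = j) \<and>
     (\<forall>i j. i \<noteq> j \<longrightarrow>
        set_integrable lborel X (\<lambda>x. poly (p i) x * poly (p j) x * w x) \<and>
        (LINT x:X|lborel. poly (p i) x * poly (p j) x * w x) = 0)"

text \<open>The Askey--Wilson polynomials are determined only up to the normalization of each
  member, so they are a predicate on sequences rather than one fixed sequence.\<close>

definition Askey_Wilson_polys ::
    "real \<Rightarrow> real \<Rightarrow> real \<Rightarrow> real \<Rightarrow> real \<Rightarrow> (nat \<Rightarrow> real poly) \<Rightarrow> bool" where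
  "Askey_Wilson_polys x1 \<rho>13 x2 \<rho>23 q p \<longleftrightarrow>
     orthogonal_poly_seq (S q) (\<lambda>x3. f_AW x3 x1 \<rho>13 x2 \<rho>23 q) p"

end

theory Submission
  imports Defs "HOL-Probability.Distributions"
begin

text \<open>Write \<open>H\<^sub>n(x) = P\<^sub>n(x|y,0,q)\<close> for the continuous q-Hermite polynomials (a case of \<open>P\<close>
that does not depend on \<open>y\<close>; below it is always written with \<open>y = 0\<close>), and
\<open>G\<^sub>s\<^sub>,\<^sub>r(t) = \<Sum>\<^sub>m t\<^sup>m/[m]\<^sub>q! H\<^sub>m\<^sub>+\<^sub>s(x) H\<^sub>m\<^sub>+\<^sub>r(z)\<close>. Everything rests on two observations.

(1) The three-term recurrence of \<open>H\<close>, split with \<open>[m+s] = [s] + q\<^sup>s [m]\<close>, gives a three-term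
recurrence in \<open>s\<close> for \<open>G\<^sub>s\<^sub>,\<^sub>0\<close>, and it is exactly the Al-Salam--Chihara recurrence, so that
\<open>(t\<^sup>2)\<^sub>s G\<^sub>s\<^sub>,\<^sub>0(t) = P\<^sub>s(x|z,t,q) G\<^sub>0\<^sub>,\<^sub>0(t)\<close> (\<open>mehler_sum_eq_P\<close>). The sum \<open>G\<^sub>0\<^sub>,\<^sub>0\<close> itself is the
quotient \<open>f\<^sub>C\<^sub>N/f\<^sub>N\<close> (\<open>mehler_sum_eq_mehler\<close>): for \<open>q < 1\<close> the case \<open>s \<le> 2\<close> of (1) yields a first-order
q-difference equation in \<open>t\<close>, which is iterated to an infinite product, and for \<open>q = 1\<close> it
yields a first-order differential equation, whose solution is the classical Mehler kernel.

(2) The connection formula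
\<open>H\<^sub>n(y)/[n]! = \<Sum>\<^sub>i b\<^sup>n\<^sup>-\<^sup>i H\<^sub>n\<^sub>-\<^sub>i(z)/[n-i]! P\<^sub>i(y|z,b,q)/[i]!\<close> (\<open>P_connection\<close>).

Insert (2) into \<open>G\<^sub>0\<^sub>,\<^sub>0\<close> taken at \<open>(x,y)\<close> with parameter \<open>a = \<rho>\<^sub>1\<^sub>3\<close>, and sum the resulting double series along the
other axis: the inner sums are the \<open>G\<^sub>s\<^sub>,\<^sub>0\<close> at \<open>(x,z)\<close> with parameter \<open>a b\<close>, \<open>b = \<rho>\<^sub>2\<^sub>3\<close>, and (1) turns the outer sum into the
series of the theorem (\<open>kernel_expansion\<close>). Absolute convergence of the double series comes from
the growth bound \<open>|P\<^sub>n| \<le> C R\<^sup>n ([n]! (b\<^sup>2)\<^sub>n)\<^sup>1\<^sup>/\<^sup>2\<close> for every \<open>R > 1\<close> (\<open>P_growth\<close>): the coefficients left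
over are bounded by 1, because their squares are terms of a sum of nonnegative numbers equal to
1 (\<open>qpoch_power_convolution\<close>).

For the integral and \<open>q < 1\<close>, up to the constant \<open>f\<^sub>C\<^sub>N/f\<^sub>N\<close> at \<open>(x,z)\<close> the product
\<open>P\<^sub>n(y|z,b,q) f\<^sub>A\<^sub>W\<close> is \<open>(b\<^sup>2)\<^sub>n G\<^sub>n\<^sub>,\<^sub>0(y,z;b) G\<^sub>0\<^sub>,\<^sub>0(y,x;a) f\<^sub>N(y)\<close>, a product of two q-Hermite series. Integrating term by term with
the orthogonality of the \<open>H\<^sub>n\<close> leaves \<open>a\<^sup>n (b\<^sup>2)\<^sub>n G\<^sub>n\<^sub>,\<^sub>0(x,z;ab)\<close>, that is, by (1),
\<open>a\<^sup>n (b\<^sup>2)\<^sub>n/(a\<^sup>2b\<^sup>2)\<^sub>n P\<^sub>n(x|z,ab,q)\<close> times the total mass (\<open>AW_moments_less_1\<close>). The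
total mass is positive (\<open>integral_f_N_pos\<close>) and drops out of the theorem. The orthogonality of the \<open>H\<^sub>n\<close> is obtained
from that of the Chebyshev polynomials of the second kind by truncating the product in \<open>f\<^sub>N\<close>
and multiplying in one factor at a time (\<open>cheb_fin_weight_even\<close>); this is a finite form of
Jacobi's triple product. For \<open>q = 1\<close> the density is a normal density in \<open>x\<^sub>3\<close>, and Stein's identity gives the
moments of the \<open>P\<^sub>n\<close> a three-term recurrence (\<open>AW_moments_1\<close>).

Finally \<open>A\<^sub>j\<close> is a combination \<open>\<Sum> c\<^sub>n P\<^sub>n\<close>; orthogonality to the constant \<open>A\<^sub>0\<close> says that the same
combination of the means of the \<open>P\<^sub>n\<close> vanishes, so it can be subtracted (\<open>AW_poly_expansion\<close>).\<close>

section \<open>q-numbers, q-factorials and q-shifted factorials\<close>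

lemma qnum_0 [simp]: "qnum q 0 = 0"
  by (simp add: qnum_def)

lemma qnum_Suc: "qnum q (Suc n) = qnum q n + q ^ n"
  by (simp add: qnum_def)

lemma qnum_Suc_0 [simp]: "qnum q (Suc 0) = 1"
  by (simp add: qnum_def)

lemma qnum_add: "qnum q (s + m) = qnum q s + q ^ s * qnum q m"
  by (induction m) (simp_all add: qnum_Suc algebra_simps power_add)

lemma one_minus_q_times_qnum: "(1 - q) * qnum q n = 1 - q ^ n"
proof (induction n)
  case (Suc n)
  have "(1 - q) * qnum q (Suc n) = (1 - q) * qnum q n + (1 - q) * q ^ n"
    by (simp add: qnum_Suc distrib_left)
  also have "\<dots> = 1 - q ^ Suc n"
    unfolding Suc.IH by (simp add: left_diff_distrib)
  finally show ?case .
qed simp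

lemma qnum_1 [simp]: "qnum 1 n = real n"
  by (simp add: qnum_def)

lemma qnum_eq: "q \<noteq> 1 \<Longrightarrow> qnum q n = (1 - q ^ n) / (1 - q)"
  using one_minus_q_times_qnum[of q n] by (simp add: field_simps)

lemma qnum_pos:
  assumes "-1 < q" "q \<le> 1" "n > 0"
  shows "qnum q n > 0"
proof (cases "q = 1")
  case False
  then have "\<bar>q\<bar> < 1"
    using assms by auto
  then have "\<bar>q ^ n\<bar> < 1"
    using assms by (simp add: power_abs power_less_one_iff)
  then show ?thesis
    using False assms by (simp add: qnum_eq)
qed (use assms in auto)

lemma qfact_0 [simp]: "qfact q 0 = 1"
  by (simp add: qfact_def)

lemma qfact_Suc: "qfact q (Suc n) = qnum q (Suc n) * qfact q n"
  by (simp add: qfact_def prod.nat_ivl_Suc' mult.commute)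

lemma qfact_pos: "-1 < q \<Longrightarrow> q \<le> 1 \<Longrightarrow> qfact q n > 0"
  unfolding qfact_def by (intro prod_pos) (auto intro: qnum_pos)

lemma qpoch_0 [simp]: "qpoch a q 0 = 1"
  by (simp add: qpoch_def)

lemma qpoch_zero [simp]: "qpoch 0 q n = 1"
  by (simp add: qpoch_def)

lemma qpoch_Suc: "qpoch a q (Suc n) = qpoch a q n * (1 - a * q ^ n)"
  by (simp add: qpoch_def)

lemma abs_mult_power_less_1:
  fixes t q :: real
  assumes "\<bar>t\<bar> < 1" "\<bar>q\<bar> \<le> 1"
  shows "\<bar>t * q ^ k\<bar> < 1"
proof -
  have "\<bar>t * q ^ k\<bar> = \<bar>t\<bar> * \<bar>q\<bar> ^ k" by (simp add: abs_mult power_abs)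
  also have "\<dots> \<le> \<bar>t\<bar> * 1" using assms by (intro mult_left_mono power_le_one) auto
  finally show ?thesis using assms by simp
qed

lemma sq_mult_sq_less_1:
  fixes a b :: real
  assumes "\<bar>a\<bar> < 1" "\<bar>b\<bar> < 1"
  shows "a\<^sup>2 * b\<^sup>2 < 1"
proof -
  have "\<bar>a * b\<bar> < 1" using abs_mult_power_less_1[of a b 1] assms by simp
  then have "(a * b)\<^sup>2 < 1" by (simp only: abs_square_less_1)
  then show ?thesis by (simp add: power_mult_distrib)
qed

lemma one_minus_mult_power_pos:
  fixes a q :: real
  assumes "-1 < q" "q \<le> 1" "\<bar>a\<bar> < 1"
  shows "1 - a * q ^ n > 0"
proof -
  have "\<bar>q ^ n\<bar> \<le> 1"
    using assms by (auto simp: power_abs intro!: power_le_one)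
  then have "\<bar>a * q ^ n\<bar> \<le> \<bar>a\<bar> * 1"
    unfolding abs_mult by (intro mult_left_mono) auto
  then show ?thesis
    using assms by linarith
qed

lemma qpoch_pos: "-1 < q \<Longrightarrow> q \<le> 1 \<Longrightarrow> \<bar>a\<bar> < 1 \<Longrightarrow> qpoch a q n > 0"
  unfolding qpoch_def by (intro prod_pos one_minus_mult_power_pos) auto

lemma qnum_tendsto: "\<bar>q\<bar> < 1 \<Longrightarrow> (\<lambda>n. qnum q n) \<longlonglongrightarrow> 1 / (1 - q)"
proof -
  assume q: "\<bar>q\<bar> < 1"
  then have "(\<lambda>n. (1 - q ^ n) / (1 - q)) \<longlonglongrightarrow> (1 - 0) / (1 - q)"
    by (intro tendsto_intros LIMSEQ_power_zero) auto
  with q show ?thesis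
    by (subst qnum_eq) auto
qed

section \<open>Growth of the Al-Salam--Chihara polynomials\<close>

text \<open>Solutions of a recurrence whose characteristic roots tend to \<open>l\<close> and \<open>m\<close> in the closed unit disc grow
slower than every \<open>R\<^sup>n\<close> with \<open>R > 1\<close>. The roots may coincide on the unit circle, so there is no bounded
energy; instead the bounds \<open>|u\<^sub>n| \<le> C R\<^sup>n\<close> and \<open>|u\<^sub>n\<^sub>+\<^sub>1 - l u\<^sub>n| \<le> C (R - 1) R\<^sup>n\<close> propagate together as
soon as the perturbation is small compared with \<open>(R - 1)\<^sup>2\<close>. The constant \<open>C\<close> depends only on \<open>\<delta>\<close>, \<open>B\<close> and
\<open>R\<close>, which is what makes the later bounds uniform on \<open>S q\<close>.\<close>

lemma perturbed_recurrence_growth: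
  fixes \<delta> :: "nat \<Rightarrow> real" and B R :: real
  assumes \<delta>: "\<delta> \<longlonglongrightarrow> 0" and R: "R > 1" and B: "B \<ge> 0"
  shows "\<exists>C. C > 0 \<and> (\<forall>(u :: nat \<Rightarrow> complex) l m.
           norm l \<le> 1 \<longrightarrow> norm m \<le> 1 \<longrightarrow> norm (u 0) \<le> B \<longrightarrow> norm (u 1) \<le> B \<longrightarrow>
           (\<forall>n. norm (u (n+2) - (l + m) * u (n+1) + l * m * u n) \<le> \<delta> n * (norm (u (n+1)) + norm (u n)))
           \<longrightarrow> (\<forall>n. norm (u n) \<le> C * R ^ n))"
proof -
  define e where "e = R - 1"
  have e: "e > 0" using R by (simp add: e_def)
  have "Bseq \<delta>" using \<delta> by (intro convergent_imp_Bseq convergentI)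
  then obtain D where D: "D > 0" "\<And>n. norm (\<delta> n) \<le> D"
    unfolding Bseq_def by auto
  \<comment> \<open>Crude exponential growth, used only for the finitely many indices up to \<open>N + 1\<close>.\<close>
  define K where "K = 3 + 2 * D"
  have K: "K > 1" using D by (simp add: K_def)
  have "eventually (\<lambda>n. \<delta> n < e\<^sup>2 / (R + 1)) sequentially"
    using \<delta> R e by (intro order_tendstoD) auto
  then obtain N where N: "\<And>n. n \<ge> N \<Longrightarrow> \<delta> n < e\<^sup>2 / (R + 1)"
    unfolding eventually_sequentially by blast
  define C where "C = 2 * (B + 1) * K ^ (N + 1) / min 1 e"
  have m: "min 1 e > 0" using e by simp
  have C: "C > 0" unfolding C_def using m B K by simp
  have "norm (u n) \<le> C * R ^ n"
    if l: "norm l \<le> 1" and m1: "norm m \<le> 1" and u0: "norm (u 0) \<le> B" and u1: "norm (u 1) \<le> B"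
      and rec: "\<And>n. norm (u (n+2) - (l + m) * u (n+1) + l * m * u n)
                  \<le> \<delta> n * (norm (u (n+1)) + norm (u n))"
    for u :: "nat \<Rightarrow> complex" and l m n
  proof -
    have crude: "norm (u n) \<le> B * K ^ n \<and> norm (u (n+1)) \<le> B * K ^ (n+1)" for n
    proof (induction n)
      case 0
      then show ?case using u0 u1 K B
        by (auto intro: order_trans[OF u1] simp: mult_le_cancel_left1 simp flip: One_nat_def)
    next
      case (Suc n)
      have "norm (u (n+2)) = norm ((u (n+2) - (l + m) * u (n+1) + l * m * u n)
              + (l + m) * u (n+1) - l * m * u n)" by simp
      also have "\<dots> \<le> norm (u (n+2) - (l + m) * u (n+1) + l * m * u n)
              + norm ((l + m) * u (n+1)) + norm (l * m * u n)"
        by (meson norm_triangle_ineq norm_triangle_ineq4 order_trans add_right_mono)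
      also have "\<dots> \<le> D * (norm (u (n+1)) + norm (u n)) + 2 * norm (u (n+1)) + norm (u n)"
      proof (intro add_mono)
        show "norm (u (n+2) - (l + m) * u (n+1) + l * m * u n) \<le> D * (norm (u (n+1)) + norm (u n))"
          using D(2)[of n] by (intro order_trans[OF rec] mult_right_mono) auto
        have "norm (l + m) \<le> 2" using l m1 norm_triangle_ineq[of l m] by linarith
        then show "norm ((l + m) * u (n+1)) \<le> 2 * norm (u (n+1))"
          by (simp add: norm_mult mult_right_mono)
        have "norm (l * m) \<le> 1" using l m1 by (simp add: norm_mult mult_le_one)
        then show "norm (l * m * u n) \<le> norm (u n)"
          by (simp add: norm_mult mult_left_le_one_le)
      qed
      also have "\<dots> = (D + 2) * norm (u (n+1)) + (D + 1) * norm (u n)" by (simp add: algebra_simps)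
      also have "\<dots> \<le> (D + 2) * (B * K ^ (n+1)) + (D + 1) * (B * K ^ (n+1))"
      proof (intro add_mono mult_left_mono)
        have "B * K ^ n \<le> B * K ^ (n+1)" using K B by (intro mult_left_mono power_increasing) auto
        then show "norm (u n) \<le> B * K ^ (n+1)" using Suc.IH by linarith
      qed (use D Suc.IH in auto)
      also have "\<dots> = B * K ^ (n+2)" by (simp add: K_def algebra_simps)
      finally show ?case using Suc.IH by simp
    qed
    have KN: "B * K ^ n \<le> (B + 1) * K ^ (N + 1)" if "n \<le> N + 1" for n
      using that K B by (intro mult_mono power_increasing) auto
    have C1: "2 * (B + 1) * K ^ (N + 1) \<le> C" and C2: "2 * (B + 1) * K ^ (N + 1) \<le> C * e"
    proof -
      have "2 * (B + 1) * K ^ (N + 1) = C * min 1 e" using m by (simp add: C_def)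
      also have "\<dots> \<le> C * 1" using C by (intro mult_left_mono) auto
      finally show "2 * (B + 1) * K ^ (N + 1) \<le> C" by simp
      have "2 * (B + 1) * K ^ (N + 1) = C * min 1 e" using m by (simp add: C_def)
      also have "\<dots> \<le> C * e" using C by (intro mult_left_mono) auto
      finally show "2 * (B + 1) * K ^ (N + 1) \<le> C * e" .
    qed
    have pos: "(B + 1) * K ^ (N + 1) > 0" using B K by simp
    have Rn: "1 \<le> R ^ n" for n using R by simp
    have tail: "norm (u n) \<le> C * R ^ n \<and> norm (u (n+1) - l * u n) \<le> C * e * R ^ n" if "n \<ge> N" for n
      using that
    proof (induction n rule: dec_induct)
      case base
      have "norm (u N) \<le> C" using crude[of N] KN[of N] C1 pos by linarith
      also have "C \<le> C * R ^ N" using C Rn[of N] by (simp add: mult_le_cancel_left1)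
      finally have a: "norm (u N) \<le> C * R ^ N" .
      have "norm (u (N+1) - l * u N) \<le> norm (u (N+1)) + norm (l * u N)" by (rule norm_triangle_ineq4)
      also have "norm (l * u N) \<le> norm (u N)" using l by (simp add: norm_mult mult_left_le_one_le)
      finally have "norm (u (N+1) - l * u N) \<le> C * e"
        using crude[of N] KN[of N] KN[of "N+1"] C2 by linarith
      also have "\<dots> \<le> C * e * R ^ N"
        using mult_left_mono[OF Rn[of N], of "C * e"] C e by simp
      finally show ?case using a by simp
    next
      case (step n)
      have "norm (u (n+1)) = norm ((u (n+1) - l * u n) + l * u n)" by simp
      also have "\<dots> \<le> norm (u (n+1) - l * u n) + norm (l * u n)" by (rule norm_triangle_ineq)
      also have "norm (l * u n) \<le> norm (u n)" using l by (simp add: norm_mult mult_left_le_one_le)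
      also have "norm (u (n+1) - l * u n) + norm (u n) \<le> C * e * R ^ n + C * R ^ n"
        using step.IH by simp
      also have "\<dots> = C * R ^ (n+1)" by (simp add: e_def algebra_simps)
      finally have a: "norm (u (n+1)) \<le> C * R ^ (n+1)" by simp
      have "norm (u (n+2) - l * u (n+1)) = norm (m * (u (n+1) - l * u n)
               + (u (n+2) - (l + m) * u (n+1) + l * m * u n))" by (simp add: algebra_simps)
      also have "\<dots> \<le> norm (m * (u (n+1) - l * u n)) + norm (u (n+2) - (l + m) * u (n+1) + l * m * u n)"
        by (rule norm_triangle_ineq)
      also have "norm (m * (u (n+1) - l * u n)) \<le> norm (u (n+1) - l * u n)"
        using m1 by (simp add: norm_mult mult_left_le_one_le)
      also have "\<dots> \<le> C * e * R ^ n" using step.IH by simp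
      also have "norm (u (n+2) - (l + m) * u (n+1) + l * m * u n) \<le> e\<^sup>2 / (R + 1) * (C * R ^ (n+1) + C * R ^ n)"
      proof (rule order_trans[OF rec], rule mult_mono)
        show "\<delta> n \<le> e\<^sup>2 / (R + 1)" using N[of n] step.hyps by simp
        show "norm (u (n + 1)) + norm (u n) \<le> C * R ^ (n + 1) + C * R ^ n"
          using a step.IH by simp
      qed (use R in auto)
      also have "e\<^sup>2 / (R + 1) * (C * R ^ (n+1) + C * R ^ n) = e\<^sup>2 / (R + 1) * (R + 1) * C * R ^ n"
      proof -
        have eq: "C * R ^ (n+1) + C * R ^ n = (R + 1) * (C * R ^ n)" by (simp add: algebra_simps)
        show ?thesis unfolding eq by (simp only: mult.assoc)
      qed
      also have "\<dots> = e\<^sup>2 * C * R ^ n" using R by simp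
      also have "C * e * R ^ n + e\<^sup>2 * C * R ^ n = C * e * R ^ (n+1)"
        by (simp add: e_def power2_eq_square algebra_simps)
      finally show ?case using a by simp
    qed
    show ?thesis
    proof (cases "n \<ge> N")
      case False
      then have "norm (u n) \<le> C" using crude[of n] KN[of n] C1 pos by linarith
      also have "C \<le> C * R ^ n" using C Rn[of n] by (simp add: mult_le_cancel_left1)
      finally show ?thesis .
    qed (use tail in auto)
  qed
  then show ?thesis using C by (intro exI[of _ C]) blast
qed

lemma abs_le_of_mem_S:
  assumes "q \<le> 1" "x \<in> S q"
  shows "\<bar>sqrt (1 - q) * x\<bar> \<le> 2"
proof (cases "q = 1")
  case False
  then have "sqrt (1 - q) > 0" using assms by simp
  moreover have "\<bar>x\<bar> \<le> 2 / sqrt (1 - q)"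
    using assms False by (simp add: S_def abs_le_iff)
  ultimately show ?thesis
    by (simp add: abs_mult field_simps)
qed simp

text \<open>The square of this is the norm \<open>\<integral> P\<^sub>n\<^sup>2 f\<^sub>C\<^sub>N\<close>. Dividing \<open>P\<^sub>n\<close> by it makes the recurrence tend to
\<open>u\<^sub>n\<^sub>+\<^sub>2 = (1 - q)\<^sup>1\<^sup>/\<^sup>2 x u\<^sub>n\<^sub>+\<^sub>1 - u\<^sub>n\<close>, for \<open>q = 1\<close> as well as for \<open>q < 1\<close>.\<close>

definition P_norm :: "real \<Rightarrow> real \<Rightarrow> nat \<Rightarrow> real" where
  "P_norm b q n = sqrt (qfact q n * qpoch (b\<^sup>2) q n)"

lemma P_norm_pos: "-1 < q \<Longrightarrow> q \<le> 1 \<Longrightarrow> \<bar>b\<bar> < 1 \<Longrightarrow> P_norm b q n > 0"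
  unfolding P_norm_def
  by (intro real_sqrt_gt_zero mult_pos_pos qfact_pos qpoch_pos) (auto simp: abs_square_less_1)

lemma P_norm_ratio_limits:
  fixes q b :: real
  assumes q: "-1 < q" "q \<le> 1" and b: "\<bar>b\<bar> < 1"
  defines "g \<equiv> \<lambda>n. sqrt (qnum q (Suc n) * (1 - b\<^sup>2 * q ^ n))"
  shows "(\<lambda>n. 1 / g n) \<longlonglongrightarrow> sqrt (1 - q)"
    and "(\<lambda>n. q ^ n / g n) \<longlonglongrightarrow> 0"
    and "(\<lambda>n. g n / g (Suc n)) \<longlonglongrightarrow> 1"
proof -
  have b2: "b\<^sup>2 < 1" using b by (simp add: abs_square_less_1)
  have "(\<lambda>n. 1 / g n) \<longlonglongrightarrow> sqrt (1 - q) \<and> (\<lambda>n. q ^ n / g n) \<longlonglongrightarrow> 0 \<and>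
    (\<lambda>n. g n / g (Suc n)) \<longlonglongrightarrow> 1"
  proof (cases "q = 1")
    case False
    with q have q1: "\<bar>q\<bar> < 1" by auto
    then have pw: "(\<lambda>n. q ^ n) \<longlonglongrightarrow> 0" by (intro LIMSEQ_power_zero) auto
    have g: "g \<longlonglongrightarrow> sqrt (1 / (1 - q) * (1 - b\<^sup>2 * 0))"
      unfolding g_def by (intro tendsto_intros pw LIMSEQ_Suc[OF qnum_tendsto] q1)
    have n0: "sqrt (1 / (1 - q) * (1 - b\<^sup>2 * 0)) \<noteq> 0" using q1 by auto
    have "(\<lambda>n. 1 / g n) \<longlonglongrightarrow> 1 / sqrt (1 / (1 - q) * (1 - b\<^sup>2 * 0))"
      using n0 by (intro tendsto_intros g)
    moreover have "(\<lambda>n. q ^ n / g n) \<longlonglongrightarrow> 0 / sqrt (1 / (1 - q) * (1 - b\<^sup>2 * 0))"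
      using n0 by (intro tendsto_divide g pw)
    moreover have "(\<lambda>n. g n / g (Suc n)) \<longlonglongrightarrow> sqrt (1 / (1 - q) * (1 - b\<^sup>2 * 0)) / sqrt (1 / (1 - q) * (1 - b\<^sup>2 * 0))"
      using n0 by (intro tendsto_divide g LIMSEQ_Suc[OF g])
    ultimately show ?thesis using n0 by (simp add: real_sqrt_divide)
  next
    case True
    have inv: "(\<lambda>n. inverse (real (Suc n))) \<longlonglongrightarrow> 0" by (rule LIMSEQ_inverse_real_of_nat)
    have "(\<lambda>n. sqrt (inverse (real (Suc n)) / (1 - b\<^sup>2))) \<longlonglongrightarrow> sqrt (0 / (1 - b\<^sup>2))"
      using b2 by (intro tendsto_intros inv) auto
    also have "(\<lambda>n. sqrt (inverse (real (Suc n)) / (1 - b\<^sup>2))) = (\<lambda>n. 1 / g n)"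
      using True by (auto simp: g_def fun_eq_iff real_sqrt_divide real_sqrt_mult real_sqrt_inverse field_simps)
    finally have 1: "(\<lambda>n. 1 / g n) \<longlonglongrightarrow> 0" by simp
    have "(\<lambda>n. sqrt (1 - inverse (real (Suc (Suc n))))) \<longlonglongrightarrow> sqrt (1 - 0)"
      by (intro tendsto_intros LIMSEQ_Suc[OF inv])
    also have "(\<lambda>n. sqrt (1 - inverse (real (Suc (Suc n))))) = (\<lambda>n. g n / g (Suc n))"
    proof
      fix n
      have "g n / g (Suc n) = sqrt (real (Suc n) / real (Suc (Suc n)))"
        using True b2 unfolding g_def real_sqrt_divide[symmetric] by simp
      also have "real (Suc n) / real (Suc (Suc n)) = 1 - inverse (real (Suc (Suc n)))"
        by (simp add: field_simps)
      finally show "sqrt (1 - inverse (real (Suc (Suc n)))) = g n / g (Suc n)" by simp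
    qed
    finally show ?thesis using 1 True by simp
  qed
  then show "(\<lambda>n. 1 / g n) \<longlonglongrightarrow> sqrt (1 - q)" "(\<lambda>n. q ^ n / g n) \<longlonglongrightarrow> 0"
    "(\<lambda>n. g n / g (Suc n)) \<longlonglongrightarrow> 1" by blast+
qed

text \<open>On \<open>S q\<close> the limiting recurrence has the roots \<open>e\<^sup>\<plusminus>\<^sup>i\<^sup>\<theta>\<close> with \<open>2 cos \<theta> = (1 - q)\<^sup>1\<^sup>/\<^sup>2 x\<close>. For \<open>q = 1\<close>, where
\<open>S q\<close> is the whole line, the constant can be uniform on bounded sets at best; hence \<open>M\<close>.\<close>

lemma P_growth:
  fixes q b y R M :: real
  assumes q: "-1 < q" "q \<le> 1" and b: "\<bar>b\<bar> < 1" and R: "R > 1" and M: "M \<ge> 0"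
  obtains C where "C > 0"
    and "\<And>x n. x \<in> S q \<Longrightarrow> \<bar>x\<bar> \<le> M \<Longrightarrow> \<bar>P n x y b q\<bar> \<le> C * R ^ n * P_norm b q n"
proof -
  have b2: "\<bar>b\<^sup>2\<bar> < 1" using b by (simp add: abs_square_less_1)
  define g where "g = (\<lambda>n. sqrt (qnum q (Suc n) * (1 - b\<^sup>2 * q ^ n)))"
  have g_pos: "g n > 0" for n
    unfolding g_def
    by (intro real_sqrt_gt_zero mult_pos_pos qnum_pos one_minus_mult_power_pos q b2) auto
  have g_sq: "g n * g n = qnum q (Suc n) * (1 - b\<^sup>2 * q ^ n)" for n
    using g_pos[of n] unfolding g_def by auto
  have N: "P_norm b q (Suc n) = P_norm b q n * g n" for n
    by (simp add: P_norm_def g_def qfact_Suc qpoch_Suc mult_ac flip: real_sqrt_mult)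
  have N0: "P_norm b q 0 = 1" by (simp add: P_norm_def)
  define \<delta> where "\<delta> = (\<lambda>n. M * \<bar>1 / g (Suc n) - sqrt (1 - q)\<bar> + \<bar>b * y\<bar> * \<bar>q ^ Suc n / g (Suc n)\<bar>
      + \<bar>g n / g (Suc n) - 1\<bar>)"
  have lim: "(\<lambda>n. 1 / g n) \<longlonglongrightarrow> sqrt (1 - q)" "(\<lambda>n. q ^ n / g n) \<longlonglongrightarrow> 0"
    "(\<lambda>n. g n / g (Suc n)) \<longlonglongrightarrow> 1"
    unfolding g_def by (rule P_norm_ratio_limits[OF q b])+
  have "\<delta> \<longlonglongrightarrow> M * \<bar>sqrt (1 - q) - sqrt (1 - q)\<bar> + \<bar>b * y\<bar> * \<bar>0\<bar> + \<bar>1 - 1\<bar>"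
    unfolding \<delta>_def by (intro tendsto_intros LIMSEQ_Suc[OF lim(1)] LIMSEQ_Suc[OF lim(2)] lim(3))
  then have \<delta>: "\<delta> \<longlonglongrightarrow> 0" by simp
  define B where "B = 1 + (M + \<bar>b * y\<bar>) / g 0"
  have B: "B \<ge> 1" using M g_pos[of 0] by (simp add: B_def)
  from B have B0: "B \<ge> 0" by simp
  obtain C where C: "C > 0" "\<And>(u :: nat \<Rightarrow> complex) l m n.
           norm l \<le> 1 \<Longrightarrow> norm m \<le> 1 \<Longrightarrow> norm (u 0) \<le> B \<Longrightarrow> norm (u 1) \<le> B \<Longrightarrow>
           (\<And>n. norm (u (n+2) - (l + m) * u (n+1) + l * m * u n) \<le> \<delta> n * (norm (u (n+1)) + norm (u n)))
           \<Longrightarrow> norm (u n) \<le> C * R ^ n"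
    using perturbed_recurrence_growth[OF \<delta> R B0] by blast
  have "\<bar>P n x y b q\<bar> \<le> C * R ^ n * P_norm b q n" if x: "x \<in> S q" "\<bar>x\<bar> \<le> M" for x n
  proof -
    define u where "u = (\<lambda>n. P n x y b q / P_norm b q n)"
    define c where "c = sqrt (1 - q) * x / 2"
    have c: "\<bar>c\<bar> \<le> 1" using abs_le_of_mem_S[OF q(2) x(1)] by (simp add: c_def)
    then have c2: "c\<^sup>2 \<le> 1" by (simp add: abs_square_le_1)
    define l where "l = Complex c (sqrt (1 - c\<^sup>2))"
    have nl: "norm l = 1" using c2 by (simp add: l_def complex_norm)
    have ll: "l * cnj l = 1" using nl by (simp add: complex_norm_square[symmetric])
    have lpl: "l + cnj l = of_real (sqrt (1 - q) * x)"
      by (simp add: l_def complex_eq_iff c_def)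
    have Nn: "P_norm b q n \<noteq> 0" for n using P_norm_pos[OF q b, of n] by simp
    have u_rec: "u (n+2) = (x - b * y * q ^ Suc n) / g (Suc n) * u (n+1) - g n / g (Suc n) * u n" for n
    proof -
      have "u (n+2) = ((x - b * y * q ^ Suc n) * P (Suc n) x y b q - g n * g n * P n x y b q)
              / (P_norm b q n * g n * g (Suc n))"
        by (simp add: u_def N g_sq mult_ac)
      also have "\<dots> = (x - b * y * q ^ Suc n) / g (Suc n) * (P (Suc n) x y b q / (P_norm b q n * g n))
            - g n / g (Suc n) * (P n x y b q / P_norm b q n)"
        using Nn[of n] g_pos[of n] g_pos[of "Suc n"] by (simp add: field_simps)
      finally show ?thesis by (simp add: u_def N)
    qed
    have err: "\<bar>u (n+2) - sqrt (1 - q) * x * u (n+1) + u n\<bar> \<le> \<delta> n * (\<bar>u (n+1)\<bar> + \<bar>u n\<bar>)" for n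
    proof -
      define d1 d2 d3 where "d1 = 1 / g (Suc n) - sqrt (1 - q)" and "d2 = q ^ Suc n / g (Suc n)"
        and "d3 = g n / g (Suc n) - 1"
      have "u (n+2) - sqrt (1 - q) * x * u (n+1) + u n
          = (x * d1 - (b * y) * d2) * u (n+1) - d3 * u n"
        unfolding u_rec d1_def d2_def d3_def by (simp add: algebra_simps diff_divide_distrib)
      also have "\<bar>\<dots>\<bar> \<le> \<bar>x * d1 - (b * y) * d2\<bar> * \<bar>u (n+1)\<bar> + \<bar>d3\<bar> * \<bar>u n\<bar>"
        unfolding abs_mult[symmetric] by (rule abs_triangle_ineq4)
      also have "\<dots> \<le> \<delta> n * \<bar>u (n+1)\<bar> + \<delta> n * \<bar>u n\<bar>"
      proof (intro add_mono mult_right_mono)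
        have 1: "\<bar>x * d1 - (b * y) * d2\<bar> \<le> \<bar>x\<bar> * \<bar>d1\<bar> + \<bar>b * y\<bar> * \<bar>d2\<bar>"
          unfolding abs_mult[symmetric] by (rule abs_triangle_ineq4)
        have 2: "\<bar>x\<bar> * \<bar>d1\<bar> \<le> M * \<bar>d1\<bar>" using x by (intro mult_right_mono) auto
        have 3: "0 \<le> M * \<bar>d1\<bar>" "0 \<le> \<bar>b * y\<bar> * \<bar>d2\<bar>" "0 \<le> \<bar>d3\<bar>" using M by auto
        show "\<bar>x * d1 - (b * y) * d2\<bar> \<le> \<delta> n" "\<bar>d3\<bar> \<le> \<delta> n"
          unfolding \<delta>_def d1_def[symmetric] d2_def[symmetric] d3_def[symmetric]
          using 1 2 3 by linarith+
      qed auto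
      finally show ?thesis by (simp add: distrib_left)
    qed
    have "norm (complex_of_real (u n)) \<le> C * R ^ n"
    proof (rule C(2)[of l "cnj l"])
      show "norm (complex_of_real (u 0)) \<le> B" using B by (simp add: u_def N0)
      have "\<bar>x - b * y\<bar> \<le> M + \<bar>b * y\<bar>" using x by linarith
      then have "\<bar>u 1\<bar> \<le> (M + \<bar>b * y\<bar>) / g 0"
        using g_pos[of 0] by (simp add: u_def N N0 abs_divide divide_right_mono)
      then show "norm (complex_of_real (u 1)) \<le> B" by (simp add: B_def)
      fix n
      have "norm (complex_of_real (u (n+2)) - (l + cnj l) * complex_of_real (u (n+1))
              + l * cnj l * complex_of_real (u n))
          = norm (complex_of_real (u (n+2) - sqrt (1 - q) * x * u (n+1) + u n))"
        unfolding lpl ll by simp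
      also have "\<dots> = \<bar>u (n+2) - sqrt (1 - q) * x * u (n+1) + u n\<bar>" by (rule norm_of_real)
      finally show "norm (complex_of_real (u (n+2)) - (l + cnj l) * complex_of_real (u (n+1))
              + l * cnj l * complex_of_real (u n))
          \<le> \<delta> n * (norm (complex_of_real (u (n+1))) + norm (complex_of_real (u n)))"
        using err[of n] by simp
    qed (use nl in auto)
    then have "\<bar>u n\<bar> \<le> C * R ^ n" by (simp only: norm_of_real)
    then show ?thesis
      using P_norm_pos[OF q b, of n] by (simp add: u_def abs_divide pos_divide_le_eq)
  qed
  then show ?thesis using C(1) that by blast
qed

section \<open>Convolution identities\<close>

text \<open>The q-analogue of the Leibniz rule for the product of the generating functions of \<open>p\<close> and \<open>c\<close>.\<close>

lemma qnum_convolution: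
  "qnum q (Suc n) * (\<Sum>i\<le>Suc n. p i * c (Suc n - i)) =
     (\<Sum>i\<le>n. qnum q (Suc i) * p (Suc i) * c (n - i)) +
     (\<Sum>i\<le>n. q ^ i * p i * (qnum q (Suc (n - i)) * c (Suc (n - i))))"
proof -
  have "qnum q (Suc n) * (\<Sum>i\<le>Suc n. p i * c (Suc n - i)) =
      (\<Sum>i\<le>Suc n. qnum q i * p i * c (Suc n - i) + q ^ i * p i * (qnum q (Suc n - i) * c (Suc n - i)))"
    unfolding sum_distrib_left
  proof (intro sum.cong refl)
    fix i assume "i \<in> {..Suc n}"
    then have "qnum q (Suc n) = qnum q i + q ^ i * qnum q (Suc n - i)"
      using qnum_add[of q i "Suc n - i"] by simp
    then show "qnum q (Suc n) * (p i * c (Suc n - i)) =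
        qnum q i * p i * c (Suc n - i) + q ^ i * p i * (qnum q (Suc n - i) * c (Suc n - i))"
      by (simp add: algebra_simps)
  qed
  also have "\<dots> = (\<Sum>i\<le>Suc n. qnum q i * p i * c (Suc n - i)) +
      (\<Sum>i\<le>Suc n. q ^ i * p i * (qnum q (Suc n - i) * c (Suc n - i)))"
    by (rule sum.distrib)
  also have "(\<Sum>i\<le>Suc n. qnum q i * p i * c (Suc n - i)) = (\<Sum>i\<le>n. qnum q (Suc i) * p (Suc i) * c (n - i))"
    by (subst sum.atMost_Suc_shift) simp
  also have "(\<Sum>i\<le>Suc n. q ^ i * p i * (qnum q (Suc n - i) * c (Suc n - i))) =
      (\<Sum>i\<le>n. q ^ i * p i * (qnum q (Suc (n - i)) * c (Suc (n - i))))"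
    by (simp add: Suc_diff_le)
  finally show ?thesis .
qed

text \<open>The q-binomial theorem in the form \<open>(ct)\<^sub>\<infinity>/(t)\<^sub>\<infinity> \<cdot> 1/(ct)\<^sub>\<infinity> = 1/(t)\<^sub>\<infinity>\<close>, read off coefficientwise so that
it also covers \<open>q = 1\<close>.\<close>

lemma qpoch_power_convolution:
  assumes q: "-1 < q" "q \<le> 1"
  shows "(\<Sum>i\<le>n. qpoch c q i / qfact q i * (c ^ (n - i) / qfact q (n - i))) = 1 / qfact q n"
proof (induction n)
  case (Suc n)
  have nz: "qnum q (Suc i) \<noteq> 0" for i using qnum_pos[OF q, of "Suc i"] by simp
  define p where "p = (\<lambda>i. qpoch c q i / qfact q i)"
  define d where "d = (\<lambda>m. c ^ m / qfact q m)"
  have p: "qnum q (Suc i) * p (Suc i) = (1 - c * q ^ i) * p i" for i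
    using nz[of i] by (simp add: p_def qfact_Suc qpoch_Suc)
  have d: "qnum q (Suc i) * d (Suc i) = c * d i" for i
    using nz[of i] by (simp add: d_def qfact_Suc)
  have "qnum q (Suc n) * (\<Sum>i\<le>Suc n. p i * d (Suc n - i)) =
     (\<Sum>i\<le>n. (1 - c * q ^ i) * p i * d (n - i)) + (\<Sum>i\<le>n. q ^ i * p i * (c * d (n - i)))"
    unfolding qnum_convolution p d ..
  also have "\<dots> = (\<Sum>i\<le>n. p i * d (n - i))"
    unfolding sum.distrib[symmetric] by (intro sum.cong) (auto simp: algebra_simps)
  also have "\<dots> = 1 / qfact q n" unfolding p_def d_def by (rule Suc.IH)
  finally have eq: "qnum q (Suc n) * (\<Sum>i\<le>Suc n. p i * d (Suc n - i)) = 1 / qfact q n" .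
  have "1 / qfact q (Suc n) = (1 / qfact q n) / qnum q (Suc n)" by (simp add: qfact_Suc)
  also have "\<dots> = (\<Sum>i\<le>Suc n. p i * d (Suc n - i))"
    unfolding eq[symmetric] using nz[of n] by (rule nonzero_mult_div_cancel_left)
  finally show ?case unfolding p_def d_def by (rule sym)
qed simp

text \<open>Multiplied by \<open>[m+s]!\<close>, the terms of the sum in \<open>qpoch_power_convolution\<close> are nonnegative and add up to 1.\<close>

lemma qbinomial_weight_le_1:
  assumes q: "-1 < q" "q \<le> 1" and c: "0 \<le> c" "c < 1"
  shows "qfact q (m + s) * qpoch c q s * c ^ m \<le> qfact q m * qfact q s"
proof -
  have pos: "qfact q i > 0" "qpoch c q i > 0" for i
    using qfact_pos[OF q] qpoch_pos[OF q, of c] c by auto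
  have "qpoch c q s / qfact q s * (c ^ m / qfact q m)
      \<le> (\<Sum>i\<le>m+s. qpoch c q i / qfact q i * (c ^ (m + s - i) / qfact q (m + s - i)))"
    using pos c
      member_le_sum[of s "{..m+s}" "\<lambda>i. qpoch c q i / qfact q i * (c ^ (m + s - i) / qfact q (m + s - i))"]
    by (auto simp: less_imp_le)
  also have "\<dots> = 1 / qfact q (m + s)" by (rule qpoch_power_convolution[OF q])
  finally show ?thesis
    using pos(1)[of m] pos(1)[of s] pos(1)[of "m+s"] by (simp add: field_simps)
qed

text \<open>Both sides satisfy the recurrence \<open>[n+2] D\<^sub>n\<^sub>+\<^sub>2 = y D\<^sub>n\<^sub>+\<^sub>1 - D\<^sub>n\<close>: in \<open>qnum_convolution\<close> the terms with \<open>z\<close> and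
those with \<open>b\<^sup>2 q\<^sup>i\<close> cancel between the two sums.\<close>

lemma P_connection:
  assumes q: "-1 < q" "q \<le> 1"
  shows "(\<Sum>i\<le>n. P i y z b q / qfact q i * (b ^ (n - i) * P (n - i) z 0 0 q / qfact q (n - i)))
    = P n y 0 0 q / qfact q n"
proof (induction n rule: less_induct)
  case (less n)
  have nz: "qnum q (Suc i) \<noteq> 0" "qnum q 1 = 1" for i using qnum_pos[OF q, of "Suc i"] by auto
  have fz: "qfact q i \<noteq> 0" for i using qfact_pos[OF q, of i] by simp
  define p where "p = (\<lambda>i. P i y z b q / qfact q i)"
  define c where "c = (\<lambda>m. b ^ m * P m z 0 0 q / qfact q m)"
  \<comment> \<open>The last terms of the two recurrences, set to 0 where the preceding coefficient does not exist.\<close>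
  define p' where "p' = (\<lambda>i. if i = 0 then 0 else (1 - b\<^sup>2 * q ^ (i - 1)) * p (i - 1))"
  define c' where "c' = (\<lambda>i. if i = 0 then 0 else b\<^sup>2 * c (i - 1))"
  have p: "qnum q (Suc i) * p (Suc i) = (y - b * z * q ^ i) * p i - p' i" for i
    using nz(1)[of i] nz(1)[of "i - 1"] fz[of i] fz[of "i - 1"]
    by (cases i) (auto simp: p_def p'_def qfact_Suc field_simps)
  have c: "qnum q (Suc i) * c (Suc i) = b * z * c i - c' i" for i
    using nz(1)[of i] nz(1)[of "i - 1"] fz[of i] fz[of "i - 1"]
    by (cases i) (auto simp: c_def c'_def qfact_Suc field_simps power2_eq_square)
  define D where "D = (\<lambda>n. \<Sum>i\<le>n. p i * c (n - i))"
  have conv: "qnum q (Suc n) * D (Suc n) =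
      y * D n - (\<Sum>i\<le>n. p' i * c (n - i)) - (\<Sum>i\<le>n. q ^ i * p i * c' (n - i))" for n
  proof -
    have "qnum q (Suc n) * D (Suc n) = (\<Sum>i\<le>n. ((y - b * z * q ^ i) * p i - p' i) * c (n - i))
       + (\<Sum>i\<le>n. q ^ i * p i * (b * z * c (n - i) - c' (n - i)))"
      unfolding D_def qnum_convolution p c ..
    also have "\<dots> = (\<Sum>i\<le>n. y * (p i * c (n - i)) - p' i * c (n - i) - q ^ i * p i * c' (n - i))"
      unfolding sum.distrib[symmetric] by (intro sum.cong) (auto simp: algebra_simps)
    finally show ?thesis by (simp add: D_def sum_subtractf sum_distrib_left)
  qed
  have rec: "qnum q (Suc (Suc n)) * D (Suc (Suc n)) = y * D (Suc n) - D n" for n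
  proof -
    have 1: "(\<Sum>i\<le>Suc n. p' i * c (Suc n - i)) = (\<Sum>i\<le>n. (1 - b\<^sup>2 * q ^ i) * p i * c (n - i))"
      by (subst sum.atMost_Suc_shift) (simp add: p'_def)
    have 2: "(\<Sum>i\<le>Suc n. q ^ i * p i * c' (Suc n - i)) = (\<Sum>i\<le>n. q ^ i * p i * (b\<^sup>2 * c (n - i)))"
      by (simp add: c'_def Suc_diff_le)
    have "(\<Sum>i\<le>n. (1 - b\<^sup>2 * q ^ i) * p i * c (n - i)) + (\<Sum>i\<le>n. q ^ i * p i * (b\<^sup>2 * c (n - i))) = D n"
      unfolding D_def sum.distrib[symmetric] by (intro sum.cong) (auto simp: algebra_simps)
    then show ?thesis unfolding conv 1 2 by linarith
  qed
  have "D n = P n y 0 0 q / qfact q n"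
  proof (cases "n < 2")
    case True
    then consider "n = 0" | "n = 1" by linarith
    then show ?thesis
      by cases (auto simp: D_def p_def c_def qfact_Suc)
  next
    case False
    then obtain k where n: "n = Suc (Suc k)" using less_2_cases not_less_eq
      by (metis One_nat_def not_less numeral_2_eq_2 old.nat.exhaust less_Suc_eq_0_disj)
    have Dk: "D k = P k y 0 0 q / qfact q k" "D (Suc k) = P (Suc k) y 0 0 q / qfact q (Suc k)"
      using less[of k] less[of "Suc k"] unfolding n D_def p_def c_def by auto
    have "qnum q (Suc (Suc k)) * D n = qnum q (Suc (Suc k)) * (P n y 0 0 q / qfact q n)"
      unfolding n rec Dk using nz(1)[of k] nz(1)[of "Suc k"] fz[of k] by (simp add: qfact_Suc field_simps)
    then show ?thesis using nz(1)[of "Suc k"] by (metis mult_left_cancel)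
  qed
  then show ?case by (simp add: D_def p_def c_def)
qed

section \<open>Shifted Poisson--Mehler sums\<close>

definition mehler_term :: "real \<Rightarrow> real \<Rightarrow> real \<Rightarrow> real \<Rightarrow> nat \<Rightarrow> nat \<Rightarrow> nat \<Rightarrow> real" where
  "mehler_term q x z t s r m = t ^ m / qfact q m * P (m + s) x 0 0 q * P (m + r) z 0 0 q"

text \<open>These are the \<open>G\<^sub>s\<^sub>,\<^sub>r\<close> of the introduction.\<close>

definition mehler_sum :: "real \<Rightarrow> real \<Rightarrow> real \<Rightarrow> real \<Rightarrow> nat \<Rightarrow> nat \<Rightarrow> real" where
  "mehler_sum q x z t s r = (\<Sum>m. mehler_term q x z t s r m)"

text \<open>The two rates are those of \<open>P_growth\<close> (\<open>R\<close>) and of \<open>qbinomial_weight_le_1\<close> (\<open>c\<close>).\<close>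

lemma exists_growth_rate:
  fixes t :: real
  assumes "\<bar>t\<bar> < 1"
  obtains R c :: real where "R > 1" "0 < c" "c < 1" "R * R * \<bar>t\<bar> < c"
proof -
  \<comment> \<open>The maximum keeps \<open>v\<close> positive; the choice is \<open>R = v\<^sup>-\<^sup>1\<^sup>/\<^sup>2\<close>, \<open>c = v\<^sup>2\<close>, which leaves \<open>R\<^sup>2 |t| \<le> v\<^sup>3 < c\<close>.\<close>
  define v where "v = root 4 (max \<bar>t\<bar> (1/2))"
  have v4: "v ^ 4 = max \<bar>t\<bar> (1/2)" unfolding v_def by (intro real_root_pow_pos2) auto
  have v: "0 < v" "v < 1" using assms unfolding v_def by auto
  have "\<bar>t\<bar> \<le> v ^ 4" using v4 by simp
  also have "v ^ 4 = v * v ^ 3" by (simp add: eval_nat_numeral)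
  also have "\<dots> < v * v\<^sup>2" using v by (intro mult_strict_left_mono power_strict_decreasing) auto
  finally have "\<bar>t\<bar> / v < v\<^sup>2" using v by (simp add: pos_divide_less_eq mult.commute)
  moreover have "(1 / sqrt v) * (1 / sqrt v) * \<bar>t\<bar> = \<bar>t\<bar> / v" using v by simp
  ultimately have "(1 / sqrt v) * (1 / sqrt v) * \<bar>t\<bar> < v\<^sup>2" by (simp only:)
  moreover have "1 / sqrt v > 1" using v by simp
  moreover have "0 < v\<^sup>2" using v by simp
  moreover have "v\<^sup>2 < 1" using v by (simp add: power_less_one_iff)
  ultimately show ?thesis using that by blast
qed

lemma P_norm_zero: "P_norm 0 q n = sqrt (qfact q n)"
  by (simp add: P_norm_def)

text \<open>The shift by \<open>s\<close> costs \<open>([m+s]!/[m]!)\<^sup>1\<^sup>/\<^sup>2\<close>, which \<open>qbinomial_weight_le_1\<close> bounds by a multiple of \<open>c\<^sup>-\<^sup>m\<^sup>/\<^sup>2\<close> for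
any \<open>c < 1\<close>.\<close>

lemma mehler_term_bound:
  fixes q t M :: real
  assumes q: "-1 < q" "q \<le> 1" and t: "\<bar>t\<bar> < 1" and M: "M \<ge> 0"
  shows "\<exists>\<theta> K. 0 \<le> \<theta> \<and> \<theta> < 1 \<and> (\<forall>x z m. x \<in> S q \<longrightarrow> z \<in> S q \<longrightarrow> \<bar>x\<bar> \<le> M \<longrightarrow> \<bar>z\<bar> \<le> M \<longrightarrow>
           \<bar>mehler_term q x z t s r m\<bar> \<le> K * \<theta> ^ m)"
proof -
  obtain R c :: real where Rc: "R > 1" "0 < c" "c < 1" "R * R * \<bar>t\<bar> < c"
    using exists_growth_rate[OF t] .
  obtain C where C: "C > 0" "\<And>x n. x \<in> S q \<Longrightarrow> \<bar>x\<bar> \<le> M \<Longrightarrow> \<bar>P n x 0 0 q\<bar> \<le> C * R ^ n * P_norm 0 q n"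
    using P_growth[OF q _ Rc(1) M, of 0 0] by auto
  define k where "k = (\<lambda>s. sqrt (qfact q s / qpoch c q s))"
  have fp: "qfact q i > 0" "qpoch c q i > 0" for i
    using qfact_pos[OF q] qpoch_pos[OF q, of c] Rc by auto
  have kp: "k i > 0" for i using fp by (simp add: k_def)
  have shift: "P_norm 0 q (m + s) \<le> k s * sqrt (qfact q m) / sqrt c ^ m" for m s
  proof -
    have "qfact q (m + s) \<le> qfact q s / qpoch c q s * qfact q m / c ^ m"
      using qbinomial_weight_le_1[OF q _ Rc(3), of m s] fp[of s] Rc by (simp add: field_simps)
    then have "sqrt (qfact q (m + s)) \<le> sqrt (qfact q s / qpoch c q s * qfact q m / c ^ m)"
      by (rule real_sqrt_le_mono)
    then show ?thesis
      by (simp add: P_norm_zero k_def real_sqrt_mult real_sqrt_divide real_sqrt_power)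
  qed
  define K \<theta> where "K = C * C * R ^ s * R ^ r * k s * k r" and "\<theta> = R * R * \<bar>t\<bar> / c"
  have th: "0 \<le> \<theta>" "\<theta> < 1" using Rc by (auto simp: \<theta>_def)
  have "\<bar>mehler_term q x z t s r m\<bar> \<le> K * \<theta> ^ m"
    if x: "x \<in> S q" "\<bar>x\<bar> \<le> M" and z: "z \<in> S q" "\<bar>z\<bar> \<le> M" for x z m
  proof -
    have b: "\<bar>P (m + s) x 0 0 q\<bar> \<le> C * R ^ (m + s) * (k s * sqrt (qfact q m) / sqrt c ^ m)"
      if "x \<in> S q" "\<bar>x\<bar> \<le> M" for x s
      using C(1) Rc by (intro order_trans[OF C(2)[OF that]] mult_left_mono shift) auto
    have "\<bar>mehler_term q x z t s r m\<bar> = \<bar>t\<bar> ^ m / qfact q m * (\<bar>P (m + s) x 0 0 q\<bar> * \<bar>P (m + r) z 0 0 q\<bar>)"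
      using fp[of m] by (simp add: mehler_term_def abs_mult power_abs abs_divide)
    also have "\<dots> \<le> \<bar>t\<bar> ^ m / qfact q m * (C * R ^ (m + s) * (k s * sqrt (qfact q m) / sqrt c ^ m)
         * (C * R ^ (m + r) * (k r * sqrt (qfact q m) / sqrt c ^ m)))"
      using fp[of m] C(1) kp[of s] Rc by (intro mult_left_mono mult_mono b x z) auto
    also have "\<dots> = K * \<bar>t\<bar> ^ m * (R ^ m * R ^ m) / (sqrt c ^ m * sqrt c ^ m)
         * (sqrt (qfact q m) * sqrt (qfact q m) / qfact q m)"
      by (simp add: K_def power_add mult_ac)
    also have "sqrt (qfact q m) * sqrt (qfact q m) / qfact q m = 1" using fp[of m] by simp
    also have "sqrt c ^ m * sqrt c ^ m = c ^ m" using Rc by (simp flip: power_mult_distrib)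
    also have "K * \<bar>t\<bar> ^ m * (R ^ m * R ^ m) / c ^ m * 1 = K * \<theta> ^ m"
      by (simp add: \<theta>_def power_mult_distrib power_divide mult_ac)
    finally show ?thesis .
  qed
  then show ?thesis using th by (intro exI[of _ \<theta>] exI[of _ K]) auto
qed

lemma summable_mehler_term:
  assumes q: "-1 < q" "q \<le> 1" and t: "\<bar>t\<bar> < 1" and x: "x \<in> S q" and z: "z \<in> S q"
  shows "summable (\<lambda>m. \<bar>mehler_term q x z t s r m\<bar>)" and "summable (mehler_term q x z t s r)"
proof -
  have M: "max \<bar>x\<bar> \<bar>z\<bar> \<ge> 0" by simp
  obtain \<theta> K where K: "0 \<le> \<theta>" "\<theta> < 1"
    and bd: "\<forall>x' z' m. x' \<in> S q \<longrightarrow> z' \<in> S q \<longrightarrow> \<bar>x'\<bar> \<le> max \<bar>x\<bar> \<bar>z\<bar> \<longrightarrow> \<bar>z'\<bar> \<le> max \<bar>x\<bar> \<bar>z\<bar> \<longrightarrow>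
        \<bar>mehler_term q x' z' t s r m\<bar> \<le> K * \<theta> ^ m"
    using mehler_term_bound[OF q t M, of s r] by blast
  have "\<bar>mehler_term q x z t s r m\<bar> \<le> K * \<theta> ^ m" for m
    using bd x z by simp
  note K = K this
  show 1: "summable (\<lambda>m. \<bar>mehler_term q x z t s r m\<bar>)"
  proof (rule summable_comparison_test'[where g = "\<lambda>m. K * \<theta> ^ m" and N = 0])
    show "summable (\<lambda>m. K * \<theta> ^ m)"
      using K by (intro summable_mult summable_geometric) simp
  qed (use K in simp)
  then show "summable (mehler_term q x z t s r)" by (rule summable_rabs_cancel)
qed

lemma herm_step: "P (Suc n) x 0 0 q = x * P n x 0 0 q - qnum q n * P (n - 1) x 0 0 q"
  by (cases n) auto

lemma mehler_sum_commute: "mehler_sum q x z t s r = mehler_sum q z x t r s"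
  unfolding mehler_sum_def mehler_term_def by (simp add: mult_ac)

text \<open>Apply the recurrence of \<open>H\<^sub>m\<^sub>+\<^sub>s\<^sub>+\<^sub>1(x)\<close> and \<open>[m+s] = [s] + q\<^sup>s [m]\<close>; the factor \<open>[m]\<close> cancels against \<open>[m]!\<close> and
shifts the summation index, which raises \<open>r\<close>.\<close>

lemma mehler_sum_step:
  assumes q: "-1 < q" "q \<le> 1" and t: "\<bar>t\<bar> < 1" and x: "x \<in> S q" and z: "z \<in> S q"
  shows "mehler_sum q x z t (Suc s) r = x * mehler_sum q x z t s r - qnum q s * mehler_sum q x z t (s - 1) r
           - q ^ s * t * mehler_sum q x z t s (Suc r)"
proof -
  note sm = summable_mehler_term(2)[OF q t x z]
  \<comment> \<open>For \<open>m = s = 0\<close> the index \<open>m + s - 1\<close> is truncated, but then the factor \<open>[0]\<close> vanishes.\<close>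
  define f where "f = (\<lambda>m. t ^ m / qfact q m * (qnum q m * P (m + s - 1) x 0 0 q) * P (m + r) z 0 0 q)"
  have f0: "f 0 = 0" by (simp add: f_def)
  have fS: "f (Suc m) = t * mehler_term q x z t s (Suc r) m" for m
    using qnum_pos[OF q, of "Suc m"] by (simp add: f_def mehler_term_def qfact_Suc)
  have fs: "f sums (t * mehler_sum q x z t s (Suc r))"
  proof -
    have "(\<lambda>m. f (Suc m)) sums (t * mehler_sum q x z t s (Suc r))"
      unfolding fS mehler_sum_def by (intro sums_mult summable_sums sm)
    then show ?thesis using sums_Suc[of f] f0 by simp
  qed
  have "mehler_term q x z t (Suc s) r m =
      x * mehler_term q x z t s r m - qnum q s * mehler_term q x z t (s - 1) r m - q ^ s * f m" for m
  proof -
    have e1: "P (m + Suc s) x 0 0 q = x * P (m + s) x 0 0 q - qnum q (m + s) * P (m + s - 1) x 0 0 q"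
      using herm_step[of "m + s" x q] by simp
    have e2: "qnum q (m + s) = qnum q s + q ^ s * qnum q m"
      using qnum_add[of q s m] by (simp add: add.commute)
    have e3: "qnum q s * P (m + s - 1) x 0 0 q = qnum q s * P (m + (s - 1)) x 0 0 q"
      by (cases s) auto
    have "P (m + Suc s) x 0 0 q = x * P (m + s) x 0 0 q
        - qnum q s * P (m + s - 1) x 0 0 q - q ^ s * (qnum q m * P (m + s - 1) x 0 0 q)"
      unfolding e1 e2 by (simp add: algebra_simps)
    also note e3
    finally have eP: "P (m + Suc s) x 0 0 q = x * P (m + s) x 0 0 q
        - qnum q s * P (m + (s - 1)) x 0 0 q - q ^ s * (qnum q m * P (m + s - 1) x 0 0 q)" .
    show ?thesis
      unfolding mehler_term_def f_def eP by (simp add: algebra_simps)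
  qed
  then have "(\<lambda>m. mehler_term q x z t (Suc s) r m) sums
      (x * mehler_sum q x z t s r - qnum q s * mehler_sum q x z t (s - 1) r - q ^ s * (t * mehler_sum q x z t s (Suc r)))"
    unfolding mehler_sum_def using fs[unfolded mehler_sum_def] by (auto intro!: sums_diff sums_mult summable_sums sm)
  then show ?thesis by (simp add: mehler_sum_def sums_iff mult.assoc)
qed

text \<open>This is \<open>mehler_sum_step\<close> with the two arguments exchanged, at index 0, where the term with \<open>[0]\<close> drops out.\<close>

lemma mehler_sum_shift:
  assumes q: "-1 < q" "q \<le> 1" and t: "\<bar>t\<bar> < 1" and x: "x \<in> S q" and z: "z \<in> S q"
  shows "mehler_sum q x z t s (Suc 0) = z * mehler_sum q x z t s 0 - t * mehler_sum q x z t (Suc s) 0"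
  using mehler_sum_step[OF q t z x, of 0 s] by (simp add: mehler_sum_commute[of q z x])

lemma mehler_sum_three_term:
  assumes q: "-1 < q" "q \<le> 1" and t: "\<bar>t\<bar> < 1" and x: "x \<in> S q" and z: "z \<in> S q"
  shows "(1 - t\<^sup>2 * q ^ s) * mehler_sum q x z t (Suc s) 0 =
     (x - t * z * q ^ s) * mehler_sum q x z t s 0 - qnum q s * mehler_sum q x z t (s - 1) 0"
  using mehler_sum_step[OF assms, of s 0] mehler_sum_shift[OF assms, of s]
  by (simp add: algebra_simps power2_eq_square)

text \<open>Multiplied by \<open>(t\<^sup>2)\<^sub>s\<close>, the recurrence of \<open>mehler_sum_three_term\<close> becomes the one that defines \<open>P\<close>.\<close>

lemma mehler_sum_eq_P:
  assumes q: "-1 < q" "q \<le> 1" and t: "\<bar>t\<bar> < 1" and x: "x \<in> S q" and z: "z \<in> S q"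
  shows "qpoch (t\<^sup>2) q s * mehler_sum q x z t s 0 = P s x z t q * mehler_sum q x z t 0 0"
proof (induction s rule: less_induct)
  case (less s)
  consider "s = 0" | "s = Suc 0" | k where "s = Suc (Suc k)"
    by (cases s; cases "s - 1") auto
  then show ?case
  proof cases
    case 2
    then show ?thesis using mehler_sum_three_term[OF assms, of 0] by (simp add: qpoch_Suc)
  next
    case (3 k)
    define p where "p = qpoch (t\<^sup>2) q k"
    have "qpoch (t\<^sup>2) q s * mehler_sum q x z t s 0 =
        p * (1 - t\<^sup>2 * q ^ k) * ((1 - t\<^sup>2 * q ^ Suc k) * mehler_sum q x z t (Suc (Suc k)) 0)"
      by (simp add: 3 qpoch_Suc p_def)
    also have "\<dots> = (x - t * z * q ^ Suc k) * (qpoch (t\<^sup>2) q (Suc k) * mehler_sum q x z t (Suc k) 0)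
         - (1 - t\<^sup>2 * q ^ k) * qnum q (Suc k) * (qpoch (t\<^sup>2) q k * mehler_sum q x z t k 0)"
      unfolding mehler_sum_three_term[OF assms] by (simp add: qpoch_Suc p_def algebra_simps)
    also have "\<dots> = P s x z t q * mehler_sum q x z t 0 0"
      using less[of k] less[of "Suc k"] by (simp add: 3 algebra_simps)
    finally show ?thesis .
  qed simp
qed

section \<open>The Poisson--Mehler kernel in closed form\<close>

text \<open>The quotient \<open>f\<^sub>C\<^sub>N(x|y,t,q)/f\<^sub>N(x|q)\<close>, where for \<open>q = 1\<close> the function \<open>f\<^sub>N\<close> is the standard normal density.\<close>

definition mehler :: "real \<Rightarrow> real \<Rightarrow> real \<Rightarrow> real \<Rightarrow> real" where
  "mehler x y t q = (if q = 1 then exp ((2 * t * x * y - t\<^sup>2 * (x\<^sup>2 + y\<^sup>2)) / (2 * (1 - t\<^sup>2))) / sqrt (1 - t\<^sup>2)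
     else cn_factor x y t q)"

lemma mehler_sum_power_series: "mehler_sum q x z t 0 0 = (\<Sum>m. (P m x 0 0 q * P m z 0 0 q / qfact q m) * t ^ m)"
  unfolding mehler_sum_def mehler_term_def by (simp add: mult_ac)

lemma mehler_sum_at_0: "mehler_sum q x z 0 0 0 = 1"
  unfolding mehler_sum_power_series by (subst powser_zero) simp

text \<open>The sum \<open>G\<^sub>1\<^sub>,\<^sub>1\<close> is what both the derivative in \<open>t\<close> (for \<open>q = 1\<close>) and the difference between \<open>t\<close> and
\<open>q t\<close> (for \<open>q < 1\<close>) produce; expressing it through \<open>G\<^sub>0\<^sub>,\<^sub>0\<close> closes the equation.\<close>

lemma mehler_sum_11_eq:
  assumes q: "-1 < q" "q \<le> 1" and t: "\<bar>t\<bar> < 1" and x: "x \<in> S q" and z: "z \<in> S q"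
  shows "(1 - t\<^sup>2) * (1 - t\<^sup>2 * q) * mehler_sum q x z t (Suc 0) (Suc 0) =
    (z * (x - t * z) * (1 - t\<^sup>2 * q) - t * ((x - t * z * q) * (x - t * z) - (1 - t\<^sup>2))) * mehler_sum q x z t 0 0"
proof -
  define g0 g1 g2 where "g0 = mehler_sum q x z t 0 0" and "g1 = mehler_sum q x z t (Suc 0) 0"
    and "g2 = mehler_sum q x z t (Suc (Suc 0)) 0"
  have 1: "(1 - t\<^sup>2) * g1 = (x - t * z) * g0"
    using mehler_sum_eq_P[OF assms, of "Suc 0"] unfolding g0_def g1_def qpoch_Suc by simp
  have P2: "P (Suc (Suc 0)) x z t q = (x - t * z * q) * (x - t * z) - (1 - t\<^sup>2)"
    by simp
  have Q2: "qpoch (t\<^sup>2) q (Suc (Suc 0)) = (1 - t\<^sup>2) * (1 - t\<^sup>2 * q)"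
    by (simp add: qpoch_Suc)
  have 2: "(1 - t\<^sup>2) * (1 - t\<^sup>2 * q) * g2 = ((x - t * z * q) * (x - t * z) - (1 - t\<^sup>2)) * g0"
    using mehler_sum_eq_P[OF assms, of "Suc (Suc 0)"] unfolding g0_def g2_def P2 Q2 .
  have "(1 - t\<^sup>2) * (1 - t\<^sup>2 * q) * mehler_sum q x z t (Suc 0) (Suc 0) =
      (1 - t\<^sup>2) * (1 - t\<^sup>2 * q) * (z * g1 - t * g2)"
    unfolding mehler_sum_shift[OF assms] g1_def g2_def ..
  also have "\<dots> = z * (1 - t\<^sup>2 * q) * ((1 - t\<^sup>2) * g1) - t * ((1 - t\<^sup>2) * (1 - t\<^sup>2 * q) * g2)"
    by algebra
  also have "\<dots> = (z * (x - t * z) * (1 - t\<^sup>2 * q) - t * ((x - t * z * q) * (x - t * z) - (1 - t\<^sup>2))) * g0"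
    unfolding 1 2 by algebra
  finally show ?thesis by (simp only: g0_def)
qed

lemma mehler_sum_derivative:
  assumes t: "\<bar>t\<bar> < 1"
  shows "((\<lambda>t. mehler_sum 1 x z t 0 0) has_real_derivative mehler_sum 1 x z t (Suc 0) (Suc 0)) (at t)"
proof -
  define c where "c = (\<lambda>m. P m x 0 0 1 * P m z 0 0 1 / qfact 1 m)"
  have "\<exists>K. \<bar>t\<bar> < K \<and> K < 1" using t by (intro dense)
  then obtain K where K: "\<bar>t\<bar> < K" "K < 1" by blast
  have "summable (mehler_term 1 x z K 0 0)"
    using K by (intro summable_mehler_term) (auto simp: S_def)
  also have "mehler_term 1 x z K 0 0 = (\<lambda>m. c m * K ^ m)"
    by (auto simp: mehler_term_def c_def fun_eq_iff)
  finally have "((\<lambda>t. \<Sum>m. c m * t ^ m) has_real_derivative (\<Sum>m. diffs c m * t ^ m)) (at t)"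
    using K by (intro termdiffs_strong) auto
  moreover have "diffs c m * t ^ m = mehler_term 1 x z t (Suc 0) (Suc 0) m" for m
  proof -
    have "qfact 1 (Suc m) = real (Suc m) * qfact 1 m" by (simp add: qfact_Suc)
    then show ?thesis by (simp add: diffs_def c_def mehler_term_def del: of_nat_Suc)
  qed
  moreover have "mehler_sum 1 x z t 0 0 = (\<Sum>m. c m * t ^ m)" for t
    by (simp add: mehler_sum_power_series c_def)
  ultimately show ?thesis by (simp add: mehler_sum_def[of 1 x z t "Suc 0"])
qed

text \<open>The logarithmic derivative supplied by \<open>mehler_sum_11_eq\<close> is that of the Gaussian kernel.\<close>

lemma mehler_sum_eq_mehler_1:
  assumes t: "\<bar>t\<bar> < 1"
  shows "mehler_sum 1 x z t 0 0 = mehler x z t 1"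
proof -
  define A where "A = (\<lambda>t. (2 * t * x * z - t\<^sup>2 * (x\<^sup>2 + z\<^sup>2)) / (2 * (1 - t\<^sup>2)))"
  define f where "f = (\<lambda>t. mehler_sum 1 x z t 0 0 * exp (- A t) * sqrt (1 - t\<^sup>2))"
  have der: "(f has_field_derivative 0) (at t within {-1<..<1})" if t: "t \<in> {-1<..<1}" for t
  proof -
    have t1: "\<bar>t\<bar> < 1" using t by auto
    then have t2: "1 - t\<^sup>2 > 0" by (simp add: abs_square_less_1)
    define B where "B = (x * z * (1 + t\<^sup>2) - t * (x\<^sup>2 + z\<^sup>2)) / (1 - t\<^sup>2)\<^sup>2"
    have dA: "(A has_field_derivative B) (at t)"
      unfolding A_def B_def using t2
      by (auto intro!: derivative_eq_intros simp: divide_simps) (simp add: algebra_simps power2_eq_square)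
    have dS: "((\<lambda>t. sqrt (1 - t\<^sup>2)) has_field_derivative - t / sqrt (1 - t\<^sup>2)) (at t)"
      using t2 by (auto intro!: derivative_eq_intros simp: field_simps)
    have G11: "mehler_sum 1 x z t (Suc 0) (Suc 0) = (B + t / (1 - t\<^sup>2)) * mehler_sum 1 x z t 0 0"
    proof -
      have "(1 - t\<^sup>2) * (1 - t\<^sup>2) * mehler_sum 1 x z t (Suc 0) (Suc 0) =
        (z * (x - t * z) * (1 - t\<^sup>2) - t * ((x - t * z) * (x - t * z) - (1 - t\<^sup>2))) * mehler_sum 1 x z t 0 0"
        using mehler_sum_11_eq[of 1 t x z] t1 by (simp add: S_def)
      also have "(z * (x - t * z) * (1 - t\<^sup>2) - t * ((x - t * z) * (x - t * z) - (1 - t\<^sup>2)))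
         = (1 - t\<^sup>2) * (1 - t\<^sup>2) * (B + t / (1 - t\<^sup>2))"
        using t2 by (simp add: B_def power2_eq_square[of "1 - t\<^sup>2"] distrib_left)
          (simp add: algebra_simps power2_eq_square)
      finally have "(1 - t\<^sup>2) * (1 - t\<^sup>2) * mehler_sum 1 x z t (Suc 0) (Suc 0) =
         (1 - t\<^sup>2) * (1 - t\<^sup>2) * ((B + t / (1 - t\<^sup>2)) * mehler_sum 1 x z t 0 0)" by (simp only: mult.assoc)
      then show ?thesis using t2 by simp
    qed
    have "(f has_field_derivative
        (mehler_sum 1 x z t (Suc 0) (Suc 0) * exp (- A t) + (exp (- A t) * - B) * mehler_sum 1 x z t 0 0) * sqrt (1 - t\<^sup>2)
        + (- t / sqrt (1 - t\<^sup>2)) * (mehler_sum 1 x z t 0 0 * exp (- A t))) (at t)"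
      unfolding f_def
      by (intro DERIV_mult mehler_sum_derivative t1 dS DERIV_fun_exp DERIV_minus dA)
    also have "- t / sqrt (1 - t\<^sup>2) = - t / (1 - t\<^sup>2) * sqrt (1 - t\<^sup>2)"
      using t2 by (simp add: real_div_sqrt field_simps)
    also have "(mehler_sum 1 x z t (Suc 0) (Suc 0) * exp (- A t) + (exp (- A t) * - B) * mehler_sum 1 x z t 0 0) * sqrt (1 - t\<^sup>2)
        + (- t / (1 - t\<^sup>2) * sqrt (1 - t\<^sup>2)) * (mehler_sum 1 x z t 0 0 * exp (- A t)) = 0"
      unfolding G11 by (simp add: algebra_simps)
    finally show ?thesis by (rule has_field_derivative_at_within)
  qed
  have "\<exists>c. \<forall>t\<in>{-1<..<1}. f t = c"
    by (rule has_field_derivative_zero_constant[OF _ der]) auto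
  then obtain c where c: "\<And>t. t \<in> {-1<..<1} \<Longrightarrow> f t = c" by blast
  have "f t = f 0" using c[of t] c[of 0] t by (simp add: abs_less_iff)
  also have "f 0 = 1" by (simp add: f_def A_def mehler_sum_at_0)
  finally have "mehler_sum 1 x z t 0 0 * exp (- A t) * sqrt (1 - t\<^sup>2) = 1" by (simp add: f_def)
  moreover have "sqrt (1 - t\<^sup>2) > 0" using t by (simp add: abs_square_less_1)
  ultimately have "mehler_sum 1 x z t 0 0 = exp (A t) / sqrt (1 - t\<^sup>2)"
    by (simp add: exp_minus field_simps)
  then show ?thesis by (simp add: mehler_def A_def)
qed

text \<open>With \<open>(1-q)\<^sup>1\<^sup>/\<^sup>2 x = 2 cos \<theta>\<close> and \<open>(1-q)\<^sup>1\<^sup>/\<^sup>2 y = 2 cos \<phi>\<close> one has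
\<open>v\<^sub>0 = |1 - t e\<^sup>i\<^sup>(\<^sup>\<theta>\<^sup>+\<^sup>\<phi>\<^sup>)|\<^sup>2 |1 - t e\<^sup>i\<^sup>(\<^sup>\<theta>\<^sup>-\<^sup>\<phi>\<^sup>)|\<^sup>2\<close>; the proof uses the real form of this factorization.\<close>

lemma v0_pos:
  assumes q: "-1 < q" "q < 1" and t: "\<bar>t\<bar> < 1" and x: "x \<in> S q" and y: "y \<in> S q"
  shows "v0 x y t q > 0"
proof -
  define c d where "c = sqrt (1 - q) * x / 2" and "d = sqrt (1 - q) * y / 2"
  have c: "c\<^sup>2 \<le> 1" and d: "d\<^sup>2 \<le> 1"
    using abs_le_of_mem_S[OF _ x] abs_le_of_mem_S[OF _ y] q
    by (auto simp: c_def d_def abs_square_le_1)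
  define e f where "e = sqrt (1 - c\<^sup>2)" and "f = sqrt (1 - d\<^sup>2)"
  have ef: "e\<^sup>2 = 1 - c\<^sup>2" "f\<^sup>2 = 1 - d\<^sup>2" "e \<ge> 0" "f \<ge> 0" using c d by (auto simp: e_def f_def)
  have sq: "(1 - q) * x * y = 4 * c * d" "(1 - q) * x\<^sup>2 = 4 * c\<^sup>2" "(1 - q) * y\<^sup>2 = 4 * d\<^sup>2"
    using q by (auto simp: c_def d_def power_mult_distrib power_divide)
  define A where "A = 1 + t\<^sup>2 - 2 * t * c * d"
  have "v0 x y t q = (1 - t\<^sup>2)\<^sup>2 - t * (1 + t\<^sup>2) * ((1 - q) * x * y) + t\<^sup>2 * ((1 - q) * x\<^sup>2 + (1 - q) * y\<^sup>2)"
    by (simp add: v0_def algebra_simps)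
  also have "\<dots> = A\<^sup>2 - 4 * t\<^sup>2 * (e\<^sup>2 * f\<^sup>2)"
    unfolding sq ef A_def by (simp add: algebra_simps power2_eq_square)
  also have "\<dots> = (A - 2 * t * (e * f)) * (A + 2 * t * (e * f))"
    by (simp add: algebra_simps power2_eq_square)
  also have "\<dots> > 0"
  proof -
    have "2 * (\<bar>c\<bar> * \<bar>d\<bar>) \<le> c\<^sup>2 + d\<^sup>2" "2 * (e * f) \<le> e\<^sup>2 + f\<^sup>2"
      using sum_squares_bound[of "\<bar>c\<bar>" "\<bar>d\<bar>"] sum_squares_bound[of e f] by (auto simp: mult_ac)
    then have s: "\<bar>c * d\<bar> + e * f \<le> 1" using ef by (simp add: abs_mult)
    have "\<bar>2 * t * c * d\<bar> + \<bar>2 * t * (e * f)\<bar> = 2 * \<bar>t\<bar> * (\<bar>c * d\<bar> + e * f)"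
      using ef by (simp add: abs_mult algebra_simps)
    also have "\<dots> \<le> 2 * \<bar>t\<bar>" using s by (simp add: mult_left_le)
    also have "\<dots> < 1 + t\<^sup>2"
    proof -
      have "0 < (1 - \<bar>t\<bar>)\<^sup>2" using t by simp
      then show ?thesis by (simp add: power2_eq_square algebra_simps)
    qed
    finally have "\<bar>2 * t * c * d\<bar> + \<bar>2 * t * (e * f)\<bar> < 1 + t\<^sup>2" .
    then have "A - 2 * t * (e * f) > 0" "A + 2 * t * (e * f) > 0"
      unfolding A_def by linarith+
    then show ?thesis by simp
  qed
  finally show ?thesis .
qed

lemma convergent_prod_of_geometric:
  fixes f :: "nat \<Rightarrow> real"
  assumes "\<bar>q\<bar> < 1" "\<And>k. \<bar>f k - 1\<bar> \<le> C * \<bar>q\<bar> ^ k" "\<And>k. f k \<noteq> 0"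
  shows "convergent_prod f"
proof -
  have "summable (\<lambda>k. \<bar>f k - 1\<bar>)"
  proof (rule summable_comparison_test'[where g = "\<lambda>k. C * \<bar>q\<bar> ^ k" and N = 0])
    show "summable (\<lambda>k. C * \<bar>q\<bar> ^ k)"
      using assms(1) by (intro summable_mult summable_geometric) simp
  qed (use assms(2) in simp)
  moreover have "f k - 1 \<noteq> -1" for k using assms(3)[of k] by simp
  ultimately have "convergent_prod (\<lambda>k. 1 + (f k - 1))"
    by (rule summable_imp_convergent_prod_real)
  then show ?thesis by simp
qed

lemma convergent_prod_tendsto_lessThan:
  fixes f :: "nat \<Rightarrow> real"
  assumes "convergent_prod f"
  shows "(\<lambda>n. \<Prod>i<n. f i) \<longlonglongrightarrow> prodinf f"
proof (rule LIMSEQ_imp_Suc)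
  show "(\<lambda>n. \<Prod>i<Suc n. f i) \<longlonglongrightarrow> prodinf f"
    using convergent_prod_LIMSEQ[OF assms] by (simp add: lessThan_Suc_atMost)
qed

lemma abs_mult_le_right:
  assumes "\<bar>t\<bar> \<le> 1"
  shows "\<bar>(t::real) * w\<bar> \<le> \<bar>w\<bar>"
  using assms by (simp add: abs_mult mult_left_le_one_le)

lemma convergent_prod_v0:
  assumes q: "-1 < q" "q < 1" and t: "\<bar>t\<bar> < 1" and x: "x \<in> S q" and y: "y \<in> S q"
  shows "convergent_prod (\<lambda>k. 1 / v0 x y (t * q ^ k) q)"
proof -
  have q1: "\<bar>q\<bar> < 1" using q by auto
  have qk: "\<bar>q ^ k\<bar> \<le> 1" for k using q1 by (auto simp: power_abs intro!: power_le_one)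
  have tq: "\<bar>t * q ^ k\<bar> < 1" for k
    using t q by (intro abs_mult_power_less_1) auto
  have nz: "v0 x y (t * q ^ k) q > 0" for k by (rule v0_pos[OF q tq x y])
  define C where "C = 3 + 2 * \<bar>(1 - q) * x * y\<bar> + \<bar>(1 - q) * (x\<^sup>2 + y\<^sup>2)\<bar>"
  have bd: "\<bar>v0 x y u q - 1\<bar> \<le> C * \<bar>u\<bar>" if u: "\<bar>u\<bar> < 1" for u
  proof -
    have "v0 x y u q - 1 = u * ((u\<^sup>2 - 2) * u - (1 + u\<^sup>2) * ((1 - q) * x * y) + u * ((1 - q) * (x\<^sup>2 + y\<^sup>2)))"
      by (simp add: v0_def algebra_simps power2_eq_square)
    also have "\<bar>\<dots>\<bar> \<le> \<bar>u\<bar> * C"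
      unfolding abs_mult[of u]
    proof (intro mult_left_mono)
      have u2: "0 \<le> u\<^sup>2" "u\<^sup>2 \<le> 1" using u by (auto simp: abs_square_le_1)
      have a: "\<bar>(u\<^sup>2 - 2) * u\<bar> \<le> 2 * 1"
        unfolding abs_mult using u u2 by (intro mult_mono) auto
      have b: "\<bar>(1 + u\<^sup>2) * ((1 - q) * x * y)\<bar> \<le> 2 * \<bar>(1 - q) * x * y\<bar>"
        unfolding abs_mult[of "1 + u\<^sup>2"] using u2 by (intro mult_right_mono) auto
      have c: "\<bar>u * ((1 - q) * (x\<^sup>2 + y\<^sup>2))\<bar> \<le> \<bar>(1 - q) * (x\<^sup>2 + y\<^sup>2)\<bar>"
        using u by (intro abs_mult_le_right) auto
      show "\<bar>(u\<^sup>2 - 2) * u - (1 + u\<^sup>2) * ((1 - q) * x * y) + u * ((1 - q) * (x\<^sup>2 + y\<^sup>2))\<bar> \<le> C"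
        using a b c unfolding C_def by linarith
    qed auto
    finally show ?thesis by (simp add: mult.commute)
  qed
  have "convergent_prod (\<lambda>k. v0 x y (t * q ^ k) q)"
  proof (rule convergent_prod_of_geometric[OF q1])
    fix k
    have C: "C \<ge> 0" by (simp add: C_def)
    have "\<bar>v0 x y (t * q ^ k) q - 1\<bar> \<le> C * \<bar>t * q ^ k\<bar>" by (rule bd[OF tq])
    also have "\<dots> \<le> C * \<bar>q ^ k\<bar>" using t C by (intro mult_left_mono abs_mult_le_right) auto
    finally show "\<bar>v0 x y (t * q ^ k) q - 1\<bar> \<le> C * \<bar>q\<bar> ^ k" by (simp add: power_abs)
    show "v0 x y (t * q ^ k) q \<noteq> 0" using nz[of k] by simp
  qed
  from convergent_prod_inverse[OF this] show ?thesis
    by (simp only: inverse_eq_divide)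
qed

lemma qpoch_tendsto:
  assumes q: "-1 < q" "q < 1" and a: "\<bar>a\<bar> < 1"
  shows "(\<lambda>n. qpoch a q n) \<longlonglongrightarrow> qpoch_inf a q"
  unfolding qpoch_def qpoch_inf_def
proof (rule convergent_prod_tendsto_lessThan, rule convergent_prod_of_geometric)
  fix k
  show "\<bar>1 - a * q ^ k - 1\<bar> \<le> 1 * \<bar>q\<bar> ^ k"
    using abs_mult_le_right[of a "q ^ k"] a by (simp add: power_abs)
  show "1 - a * q ^ k \<noteq> 0" using one_minus_mult_power_pos[of q a k] assms by auto
qed (use q in auto)

text \<open>Since \<open>1 - q\<^sup>m = (1 - q) [m]\<close>, the difference \<open>G\<^sub>0\<^sub>,\<^sub>0(t) - G\<^sub>0\<^sub>,\<^sub>0(q t)\<close> equals \<open>(1 - q) t G\<^sub>1\<^sub>,\<^sub>1(t)\<close>; the polynomial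
that appears in front of \<open>G\<^sub>0\<^sub>,\<^sub>0(t)\<close> is \<open>v\<^sub>0\<close>.\<close>

lemma mehler_sum_dilation:
  assumes q: "-1 < q" "q < 1" and t: "\<bar>t\<bar> < 1" and x: "x \<in> S q" and z: "z \<in> S q"
  shows "v0 x z t q * mehler_sum q x z t 0 0 = (1 - t\<^sup>2) * (1 - t\<^sup>2 * q) * mehler_sum q x z (t * q) 0 0"
proof -
  have q': "q \<le> 1" using q by simp
  note sm = summable_mehler_term(2)[OF q(1) q' t x z]
  have tq: "\<bar>t * q\<bar> < 1"
    using abs_mult_power_less_1[of t q 1] t q by auto
  define f where "f = (\<lambda>m. (1 - q ^ m) * mehler_term q x z t 0 0 m)"
  have f0: "f 0 = 0" by (simp add: f_def)
  have fS: "f (Suc m) = (1 - q) * t * mehler_term q x z t (Suc 0) (Suc 0) m" for m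
  proof -
    have "qfact q (Suc m) \<noteq> 0" "qnum q (Suc m) \<noteq> 0"
      using qfact_pos[OF q(1) q', of "Suc m"] qnum_pos[OF q(1) q', of "Suc m"] by auto
    moreover have "f (Suc m) = (1 - q) * qnum q (Suc m) * (t ^ Suc m / qfact q (Suc m)
        * P (Suc m) x 0 0 q * P (Suc m) z 0 0 q)"
      unfolding f_def mehler_term_def one_minus_q_times_qnum by simp
    ultimately show ?thesis
      by (simp add: mehler_term_def qfact_Suc)
  qed
  have "(\<lambda>m. f (Suc m)) sums ((1 - q) * t * mehler_sum q x z t (Suc 0) (Suc 0))"
    unfolding fS mehler_sum_def by (intro sums_mult summable_sums sm)
  then have 1: "f sums ((1 - q) * t * mehler_sum q x z t (Suc 0) (Suc 0))"
    using sums_Suc[of f] f0 by simp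
  have fe: "f = (\<lambda>m. mehler_term q x z t 0 0 m - mehler_term q x z (t * q) 0 0 m)"
  proof -
    have "mehler_term q x z (t * q) 0 0 m = q ^ m * mehler_term q x z t 0 0 m" for m
      by (simp add: mehler_term_def power_mult_distrib mult_ac)
    then show ?thesis by (simp add: fun_eq_iff f_def left_diff_distrib)
  qed
  have "f sums (mehler_sum q x z t 0 0 - mehler_sum q x z (t * q) 0 0)"
    unfolding fe mehler_sum_def using summable_mehler_term(2)[OF q(1) q' tq x z]
    by (intro sums_diff summable_sums sm) auto
  with 1 have eq: "mehler_sum q x z (t * q) 0 0 = mehler_sum q x z t 0 0 - (1 - q) * t * mehler_sum q x z t (Suc 0) (Suc 0)"
    using sums_unique2 by fastforce
  have "(1 - t\<^sup>2) * (1 - t\<^sup>2 * q) * mehler_sum q x z (t * q) 0 0 =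
      (1 - t\<^sup>2) * (1 - t\<^sup>2 * q) * mehler_sum q x z t 0 0
      - (1 - q) * t * ((1 - t\<^sup>2) * (1 - t\<^sup>2 * q) * mehler_sum q x z t (Suc 0) (Suc 0))"
    unfolding eq by (simp add: algebra_simps)
  also have "\<dots> = v0 x z t q * mehler_sum q x z t 0 0"
    unfolding mehler_sum_11_eq[OF q(1) q' t x z] v0_def by (simp add: algebra_simps power2_eq_square)
  finally show ?thesis by simp
qed

text \<open>Each use of \<open>mehler_sum_dilation\<close> splits off one factor \<open>1/v\<^sub>0\<close> and two factors of \<open>(t\<^sup>2)\<^sub>\<infinity>\<close>; the remainder
\<open>G\<^sub>0\<^sub>,\<^sub>0(t q\<^sup>n)\<close> tends to \<open>G\<^sub>0\<^sub>,\<^sub>0(0) = 1\<close>.\<close>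

lemma mehler_sum_eq_mehler_less_1:
  assumes q: "-1 < q" "q < 1" and t: "\<bar>t\<bar> < 1" and x: "x \<in> S q" and z: "z \<in> S q"
  shows "mehler_sum q x z t 0 0 = mehler x z t q"
proof -
  have q1: "\<bar>q\<bar> < 1" using q by auto
  have t2: "\<bar>t\<^sup>2\<bar> < 1" using t by (simp add: abs_square_less_1)
  have qk: "\<bar>q ^ k\<bar> \<le> 1" for k using q1 by (auto simp: power_abs intro!: power_le_one)
  have tq: "\<bar>t * q ^ k\<bar> < 1" for k
    using t q by (intro abs_mult_power_less_1) auto
  have finite: "mehler_sum q x z t 0 0 = qpoch (t\<^sup>2) q (2 * n) * (\<Prod>k<n. 1 / v0 x z (t * q ^ k) q) * mehler_sum q x z (t * q ^ n) 0 0" for n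
  proof (induction n)
    case (Suc n)
    have v: "v0 x z (t * q ^ n) q \<noteq> 0" using v0_pos[OF q tq x z, of n] by simp
    have "mehler_sum q x z (t * q ^ n) 0 0 = (1 - (t * q ^ n)\<^sup>2) * (1 - (t * q ^ n)\<^sup>2 * q) / v0 x z (t * q ^ n) q
       * mehler_sum q x z (t * q ^ Suc n) 0 0"
      using mehler_sum_dilation[OF q tq x z, of n] v by (simp add: field_simps)
    moreover have "qpoch (t\<^sup>2) q (2 * Suc n) = qpoch (t\<^sup>2) q (2 * n) * ((1 - (t * q ^ n)\<^sup>2) * (1 - (t * q ^ n)\<^sup>2 * q))"
      by (simp add: qpoch_Suc power_mult_distrib power_mult power_even_eq mult_ac)
    ultimately show ?case using Suc.IH by simp
  qed simp
  have l1: "(\<lambda>n. qpoch (t\<^sup>2) q (2 * n)) \<longlonglongrightarrow> qpoch_inf (t\<^sup>2) q"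
    using LIMSEQ_subseq_LIMSEQ[OF qpoch_tendsto[OF q t2], of "\<lambda>n. 2 * n"]
    by (simp add: strict_mono_def o_def)
  have l2: "(\<lambda>n. \<Prod>k<n. 1 / v0 x z (t * q ^ k) q) \<longlonglongrightarrow> (\<Prod>k. 1 / v0 x z (t * q ^ k) q)"
    by (intro convergent_prod_tendsto_lessThan convergent_prod_v0 q t x z)
  have l3: "(\<lambda>n. mehler_sum q x z (t * q ^ n) 0 0) \<longlonglongrightarrow> 1"
  proof -
    define c where "c = (\<lambda>m. P m x 0 0 q * P m z 0 0 q / qfact q m)"
    have "summable (mehler_term q x z (1/2) 0 0)"
      using q by (intro summable_mehler_term x z) auto
    also have "mehler_term q x z (1/2) 0 0 = (\<lambda>m. c m * (1/2) ^ m)"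
      by (auto simp: mehler_term_def c_def fun_eq_iff)
    finally have "isCont (\<lambda>t. \<Sum>m. c m * t ^ m) 0"
      by (intro isCont_powser) auto
    then have "isCont (\<lambda>t. mehler_sum q x z t 0 0) 0"
      by (simp add: mehler_sum_power_series c_def)
    moreover have "(\<lambda>n. t * q ^ n) \<longlonglongrightarrow> 0"
      using q1 by (intro tendsto_mult_right_zero LIMSEQ_power_zero) auto
    ultimately have "(\<lambda>n. mehler_sum q x z (t * q ^ n) 0 0) \<longlonglongrightarrow> mehler_sum q x z 0 0 0"
      by (rule isCont_tendsto_compose)
    then show ?thesis by (simp add: mehler_sum_at_0)
  qed
  have "(\<lambda>n. qpoch (t\<^sup>2) q (2 * n) * (\<Prod>k<n. 1 / v0 x z (t * q ^ k) q) * mehler_sum q x z (t * q ^ n) 0 0)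
     \<longlonglongrightarrow> qpoch_inf (t\<^sup>2) q * (\<Prod>k. 1 / v0 x z (t * q ^ k) q) * 1"
    by (intro tendsto_mult l1 l2 l3)
  then have "mehler_sum q x z t 0 0 = qpoch_inf (t\<^sup>2) q * (\<Prod>k. 1 / v0 x z (t * q ^ k) q) * 1"
    unfolding finite[symmetric] by (simp add: LIMSEQ_const_iff)
  then show ?thesis using q by (simp add: mehler_def cn_factor_def)
qed

lemma mehler_sum_eq_mehler:
  assumes "-1 < q" "q \<le> 1" "\<bar>t\<bar> < 1" "x \<in> S q" "z \<in> S q"
  shows "mehler_sum q x z t 0 0 = mehler x z t q"
  using assms mehler_sum_eq_mehler_1[of t x z] mehler_sum_eq_mehler_less_1[of q t x z] by (cases "q = 1") auto

section \<open>The Askey--Wilson kernel as a series\<close>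

lemma mehler_commute: "mehler x y t q = mehler y x t q"
  by (simp add: mehler_def cn_factor_def v0_def mult_ac add_ac)

lemma prodinf_pos:
  fixes f :: "nat \<Rightarrow> real"
  assumes conv: "convergent_prod f" and pos: "\<And>k. f k > 0"
  shows "prodinf f > 0"
proof -
  have "prodinf f \<noteq> 0"
    by (rule prodinf_nonzero[OF conv]) (use pos in \<open>simp add: less_imp_neq[symmetric]\<close>)
  moreover have "prodinf f \<ge> 0"
  proof (rule LIMSEQ_le_const[OF convergent_prod_tendsto_lessThan[OF conv]])
    show "\<exists>N. \<forall>n\<ge>N. 0 \<le> (\<Prod>k<n. f k)"
      using pos by (intro exI[of _ 0] allI impI prod_nonneg) (blast intro: less_imp_le)
  qed
  ultimately show ?thesis by simp
qed

lemma qpoch_inf_pos: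
  assumes q: "-1 < q" "q < 1" and a: "\<bar>a\<bar> < 1"
  shows "qpoch_inf a q > 0"
  unfolding qpoch_inf_def
proof (rule prodinf_pos, rule convergent_prod_of_geometric)
  show p: "1 - a * q ^ k > 0" for k using q a by (intro one_minus_mult_power_pos) auto
  show "\<bar>1 - a * q ^ k - 1\<bar> \<le> 1 * \<bar>q\<bar> ^ k" for k
    using abs_mult_le_right[of a "q ^ k"] a by (simp add: power_abs)
  show "1 - a * q ^ k \<noteq> 0" for k using p[of k] by simp
qed (use q in auto)

lemma mehler_pos:
  assumes q: "-1 < q" "q \<le> 1" and t: "\<bar>t\<bar> < 1" and x: "x \<in> S q" and y: "y \<in> S q"
  shows "mehler x y t q > 0"
proof (cases "q = 1")
  case True
  then show ?thesis using t by (simp add: mehler_def abs_square_less_1)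
next
  case False
  with q have q1: "-1 < q" "q < 1" by auto
  have pos: "1 / v0 x y (t * q ^ k) q > 0" for k
    using v0_pos[OF q1 _ x y, of "t * q ^ k"] abs_mult_power_less_1[OF t, of q k] q by auto
  have "(\<Prod>k. 1 / v0 x y (t * q ^ k) q) > 0"
    by (rule prodinf_pos[OF convergent_prod_v0[OF q1 t x y] pos])
  moreover have "qpoch_inf (t\<^sup>2) q > 0"
    using t by (intro qpoch_inf_pos q1) (simp add: abs_square_less_1)
  ultimately show ?thesis using False by (simp add: mehler_def cn_factor_def)
qed

text \<open>Fubini's theorem for a double series with a geometric majorant.\<close>

lemma sums_antidiagonals:
  fixes F :: "nat \<Rightarrow> nat \<Rightarrow> real"
  assumes th: "0 \<le> \<theta>" "\<theta> < 1" and bound: "\<And>s m. \<bar>F s m\<bar> \<le> K * (\<theta> ^ s * \<theta> ^ m)"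
    and rows: "\<And>s. F s sums g s" and diag: "(\<lambda>n. \<Sum>i\<le>n. F i (n - i)) sums T"
  shows "g sums T"
proof -
  have geo: "((\<lambda>m. \<theta> ^ m) has_sum 1 / (1 - \<theta>)) UNIV"
    using th geometric_sums[of \<theta>] by (intro sums_nonneg_imp_has_sum) auto
  have "(\<lambda>(s, m). \<theta> ^ s * \<theta> ^ m) summable_on UNIV \<times> UNIV"
  proof (rule summable_on_SigmaI)
    show "((\<lambda>m. case (s, m) of (s, m) \<Rightarrow> \<theta> ^ s * \<theta> ^ m) has_sum \<theta> ^ s * (1 / (1 - \<theta>))) UNIV" for s
      using has_sum_cmult_right[OF geo, of "\<theta> ^ s"] by simp
    show "(\<lambda>s. \<theta> ^ s * (1 / (1 - \<theta>))) summable_on UNIV"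
      using geo by (intro summable_on_cmult_left) (auto simp: summable_on_def)
  qed (use th in auto)
  then have "(\<lambda>p. K * (case p of (s, m) \<Rightarrow> \<theta> ^ s * \<theta> ^ m)) summable_on UNIV \<times> UNIV"
    by (rule summable_on_cmult_right)
  then have "(\<lambda>p. norm (case p of (s, m) \<Rightarrow> F s m)) summable_on UNIV \<times> UNIV"
    by (rule Infinite_Sum.abs_summable_on_comparison_test') (use bound in auto)
  then have "(\<lambda>(s, m). F s m) summable_on UNIV \<times> UNIV"
    by (rule Infinite_Sum.abs_summable_summable)
  then obtain U where U: "((\<lambda>(s, m). F s m) has_sum U) (UNIV \<times> UNIV)"
    by (auto simp: summable_on_def)
  have "(g has_sum U) UNIV"
  proof (rule has_sum_SigmaD[OF U])
    fix s
    have "summable (\<lambda>m. norm (F s m))"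
    proof (rule summable_comparison_test'[where g = "\<lambda>m. K * \<theta> ^ s * \<theta> ^ m" and N = 0])
      show "summable (\<lambda>m. K * \<theta> ^ s * \<theta> ^ m)"
        using th by (intro summable_mult summable_geometric) simp
    qed (use bound in \<open>simp add: mult.assoc\<close>)
    then show "((\<lambda>m. case (s, m) of (s, m) \<Rightarrow> F s m) has_sum g s) UNIV"
      using norm_summable_imp_has_sum[OF _ rows] by simp
  qed
  then have "g sums U" by (rule has_sum_imp_sums)
  moreover have "U = T"
  proof -
    have "((\<lambda>(n, i). F i (n - i)) has_sum U) (SIGMA n:UNIV. {..n})"
      using U by (subst has_sum_reindex_bij_witness[where j = "\<lambda>(n, i). (i, n - i)" and i = "\<lambda>(s, m). (s + m, s)"
            and T = "UNIV \<times> UNIV" and h = "\<lambda>(s, m). F s m" and s' = U]) auto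
    then have "((\<lambda>n. \<Sum>i\<le>n. F i (n - i)) has_sum U) UNIV"
      by (rule has_sum_SigmaD) (use has_sum_finite in auto)
    then have "(\<lambda>n. \<Sum>i\<le>n. F i (n - i)) sums U" by (rule has_sum_imp_sums)
    then show ?thesis using diag by (rule sums_unique2)
  qed
  ultimately show ?thesis by simp
qed

text \<open>Rows of the double series \<open>F\<close> sum to multiples of \<open>G\<^sub>s\<^sub>,\<^sub>0\<close> at \<open>(x,z)\<close>, its antidiagonals to terms of \<open>G\<^sub>0\<^sub>,\<^sub>0\<close> at \<open>(x,y)\<close>.\<close>

lemma kernel_expansion:
  assumes q: "-1 < q" "q \<le> 1" and a: "\<bar>a\<bar> < 1" and b: "\<bar>b\<bar> < 1"
    and x: "x \<in> S q" and y: "y \<in> S q" and z: "z \<in> S q"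
  shows "(\<lambda>s. a ^ s / (qfact q s * qpoch (a\<^sup>2 * b\<^sup>2) q s) * P s x z (a * b) q * P s y z b q)
    sums (mehler x y a q / mehler x z (a * b) q)"
proof -
  have ab: "\<bar>a * b\<bar> < 1"
    using abs_mult_power_less_1[of a b 1] a b by simp
  have b2: "b\<^sup>2 < 1" using b by (simp add: abs_square_less_1)
  have ab2: "\<bar>a\<^sup>2 * b\<^sup>2\<bar> < 1"
    using sq_mult_sq_less_1[OF a b] by (simp add: abs_mult)
  define F where "F = (\<lambda>s m. a ^ (s + m) * b ^ m / (qfact q s * qfact q m)
      * P (s + m) x 0 0 q * P m z 0 0 q * P s y z b q)"
  obtain R c :: real where Rc: "R > 1" "0 < c" "c < 1" "R * R * \<bar>a\<bar> < c"
    using exists_growth_rate[OF a] .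
  have fp: "qfact q i > 0" "qpoch (b\<^sup>2) q i > 0" for i
    using qfact_pos[OF q] qpoch_pos[OF q, of "b\<^sup>2"] b2 by auto
  obtain C1 where C1: "C1 > 0"
      "\<And>x' n. x' \<in> S q \<Longrightarrow> \<bar>x'\<bar> \<le> \<bar>x\<bar> \<Longrightarrow> \<bar>P n x' 0 0 q\<bar> \<le> C1 * R ^ n * P_norm 0 q n"
    using P_growth[OF q _ Rc(1), of 0 "\<bar>x\<bar>" 0] by auto
  obtain C2 where C2: "C2 > 0"
      "\<And>x' n. x' \<in> S q \<Longrightarrow> \<bar>x'\<bar> \<le> \<bar>z\<bar> \<Longrightarrow> \<bar>P n x' 0 0 q\<bar> \<le> C2 * R ^ n * P_norm 0 q n"
    using P_growth[OF q _ Rc(1), of 0 "\<bar>z\<bar>" 0] by auto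
  obtain C3 where C3: "C3 > 0"
      "\<And>x' n. x' \<in> S q \<Longrightarrow> \<bar>x'\<bar> \<le> \<bar>y\<bar> \<Longrightarrow> \<bar>P n x' z b q\<bar> \<le> C3 * R ^ n * P_norm b q n"
    using P_growth[OF q b Rc(1), of "\<bar>y\<bar>" z] by auto
  note C = C1(1) C2(1) C3(1)
  have g1: "\<bar>P n x 0 0 q\<bar> \<le> C1 * R ^ n * sqrt (qfact q n)" for n
    using C1(2)[OF x order_refl] by (simp only: P_norm_zero)
  have g2: "\<bar>P n z 0 0 q\<bar> \<le> C2 * R ^ n * sqrt (qfact q n)" for n
    using C2(2)[OF z order_refl] by (simp only: P_norm_zero)
  have g3: "\<bar>P n y z b q\<bar> \<le> C3 * R ^ n * P_norm b q n" for n
    by (rule C3(2)[OF y order_refl])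
  define \<theta> where "\<theta> = R * R * \<bar>a\<bar>"
  have th: "0 \<le> \<theta>" "\<theta> < 1" using Rc by (auto simp: \<theta>_def)
  have bound: "\<bar>F s m\<bar> \<le> C1 * C2 * C3 * (\<theta> ^ s * \<theta> ^ m)" for s m
  proof -
    have w: "sqrt (qfact q (s + m)) * sqrt (qfact q m) * P_norm b q s * \<bar>b\<bar> ^ m \<le> qfact q s * qfact q m"
    proof -
      have bb: "(\<bar>b\<bar> ^ m)\<^sup>2 = (b\<^sup>2) ^ m"
      proof -
        have "(\<bar>b\<bar> ^ m)\<^sup>2 = (\<bar>b\<bar>\<^sup>2) ^ m"
          by (simp only: power_mult[symmetric] mult.commute[of m 2])
        then show ?thesis by (simp only: power2_abs)
      qed
      have "(sqrt (qfact q (s + m)) * sqrt (qfact q m) * P_norm b q s * \<bar>b\<bar> ^ m)\<^sup>2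
          = (qfact q (m + s) * qpoch (b\<^sup>2) q s * (b\<^sup>2) ^ m) * (qfact q s * qfact q m)"
        using fp[of s] fp[of m] fp[of "s+m"]
        unfolding power_mult_distrib bb by (simp add: P_norm_def mult_ac add_ac)
      also have "\<dots> \<le> (qfact q m * qfact q s) * (qfact q s * qfact q m)"
        using fp[of s] fp[of m] b2 by (intro mult_right_mono qbinomial_weight_le_1 q) auto
      also have "\<dots> = (qfact q s * qfact q m)\<^sup>2" by (simp add: power2_eq_square mult_ac)
      finally show ?thesis by (rule power2_le_imp_le) (use fp[of s] fp[of m] in simp)
    qed
    have "\<bar>F s m\<bar> = \<bar>a\<bar> ^ (s + m) * \<bar>b\<bar> ^ m / (qfact q s * qfact q m)
        * (\<bar>P (s + m) x 0 0 q\<bar> * \<bar>P m z 0 0 q\<bar> * \<bar>P s y z b q\<bar>)"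
      using fp[of s] fp[of m] by (simp add: F_def abs_mult abs_divide power_abs mult_ac)
    also have "\<dots> \<le> \<bar>a\<bar> ^ (s + m) * \<bar>b\<bar> ^ m / (qfact q s * qfact q m)
        * ((C1 * R ^ (s + m) * sqrt (qfact q (s + m))) * (C2 * R ^ m * sqrt (qfact q m)) * (C3 * R ^ s * P_norm b q s))"
      using fp[of s] fp[of m] fp[of "s + m"] C Rc by (intro mult_left_mono mult_mono g1 g2 g3) auto
    also have "\<dots> = (C1 * C2 * C3 * (\<bar>a\<bar> ^ (s + m) * R ^ (s + m) * R ^ m * R ^ s)) *
        ((sqrt (qfact q (s + m)) * sqrt (qfact q m) * P_norm b q s * \<bar>b\<bar> ^ m) / (qfact q s * qfact q m))"
      by (simp add: mult_ac)
    also have "\<dots> \<le> (C1 * C2 * C3 * (\<bar>a\<bar> ^ (s + m) * R ^ (s + m) * R ^ m * R ^ s)) * 1"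
      using w fp[of s] fp[of m] C Rc by (intro mult_left_mono) auto
    also have "\<dots> = C1 * C2 * C3 * (\<theta> ^ s * \<theta> ^ m)"
      by (simp add: \<theta>_def power_add power_mult_distrib mult_ac)
    finally show ?thesis .
  qed
  have "(\<lambda>s. a ^ s / qfact q s * P s y z b q * mehler_sum q x z (a * b) s 0) sums mehler_sum q x y a 0 0"
  proof (rule sums_antidiagonals[OF th bound])
    fix s
    have "(\<lambda>m. a ^ s / qfact q s * P s y z b q * mehler_term q x z (a * b) s 0 m)
        sums (a ^ s / qfact q s * P s y z b q * mehler_sum q x z (a * b) s 0)"
      unfolding mehler_sum_def by (intro sums_mult summable_sums summable_mehler_term q ab x z)
    also have "(\<lambda>m. a ^ s / qfact q s * P s y z b q * mehler_term q x z (a * b) s 0 m) = F s"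
      by (simp add: fun_eq_iff F_def mehler_term_def power_add power_mult_distrib add.commute mult_ac)
    finally show "F s sums (a ^ s / qfact q s * P s y z b q * mehler_sum q x z (a * b) s 0)" .
  next
    have "(\<Sum>i\<le>n. F i (n - i)) = mehler_term q x y a 0 0 n" for n
    proof -
      have "(\<Sum>i\<le>n. F i (n - i)) = (\<Sum>i\<le>n. a ^ n * P n x 0 0 q *
          (P i y z b q / qfact q i * (b ^ (n - i) * P (n - i) z 0 0 q / qfact q (n - i))))"
        by (intro sum.cong) (auto simp: F_def mult_ac)
      also have "\<dots> = a ^ n * P n x 0 0 q * (P n y 0 0 q / qfact q n)"
        unfolding sum_distrib_left[symmetric] P_connection[OF q] ..
      finally show ?thesis by (simp add: mehler_term_def)
    qed
    then show "(\<lambda>n. \<Sum>i\<le>n. F i (n - i)) sums mehler_sum q x y a 0 0"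
      unfolding mehler_sum_def using summable_mehler_term(2)[OF q a x y] by (simp add: summable_sums)
  qed
  also have "mehler_sum q x y a 0 0 = mehler x y a q" by (rule mehler_sum_eq_mehler[OF q a x y])
  finally have 1: "(\<lambda>s. a ^ s / qfact q s * P s y z b q * mehler_sum q x z (a * b) s 0) sums mehler x y a q" .
  have mp: "mehler x z (a * b) q > 0" by (rule mehler_pos[OF q ab x z])
  have "a ^ s / qfact q s * P s y z b q * mehler_sum q x z (a * b) s 0 / mehler x z (a * b) q =
      a ^ s / (qfact q s * qpoch (a\<^sup>2 * b\<^sup>2) q s) * P s x z (a * b) q * P s y z b q" for s
  proof -
    have "qpoch (a\<^sup>2 * b\<^sup>2) q s > 0" by (rule qpoch_pos[OF q ab2])
    then have "mehler_sum q x z (a * b) s 0 = P s x z (a * b) q * mehler x z (a * b) q / qpoch (a\<^sup>2 * b\<^sup>2) q s"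
      using mehler_sum_eq_P[OF q ab x z, of s] unfolding mehler_sum_eq_mehler[OF q ab x z]
      by (simp add: field_simps power_mult_distrib)
    then show ?thesis using mp by simp
  qed
  then show ?thesis using sums_divide[OF 1, of "mehler x z (a * b) q"] by simp
qed

section \<open>Orthogonality of the continuous q-Hermite polynomials\<close>

text \<open>Chebyshev polynomials of the second kind in the variable \<open>s x / 2\<close>; for \<open>s\<^sup>2 = 1 - q\<close> that variable maps
\<open>S q\<close> onto \<open>[-1,1]\<close>.\<close>

fun cheb_poly :: "real \<Rightarrow> nat \<Rightarrow> real poly" where
  "cheb_poly s 0 = 1"
| "cheb_poly s (Suc 0) = [:0, s:]"
| "cheb_poly s (Suc (Suc n)) = [:0, s:] * cheb_poly s (Suc n) - cheb_poly s n"

text \<open>These are \<open>s\<^sup>n H\<^sub>n\<close> for \<open>s\<^sup>2 = 1 - q\<close>, see \<open>poly_herm_poly\<close>. In this scaling they obey the Chebyshev recurrence up to the factor \<open>1 - q\<^sup>n\<close>.\<close>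

fun herm_poly :: "real \<Rightarrow> real \<Rightarrow> nat \<Rightarrow> real poly" where
  "herm_poly s q 0 = 1"
| "herm_poly s q (Suc 0) = [:0, s:]"
| "herm_poly s q (Suc (Suc n)) = [:0, s:] * herm_poly s q (Suc n) - smult (1 - q ^ Suc n) (herm_poly s q n)"

lemma herm_poly_Suc:
  "herm_poly s q (Suc n) = [:0, s:] * herm_poly s q n - smult (1 - q ^ n) (herm_poly s q (n - 1))"
  by (cases n) auto

lemma cheb_poly_shift:
  "[:0, s:] * cheb_poly s m = cheb_poly s (Suc m) + (if m = 0 then 0 else cheb_poly s (m - 1))"
  by (cases m) auto

lemma poly_herm_poly:
  assumes "s * s = 1 - q"
  shows "poly (herm_poly s q n) x = s ^ n * P n x 0 0 q"
proof (induction n rule: less_induct)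
  case (less n)
  consider "n = 0" | "n = Suc 0" | k where "n = Suc (Suc k)"
    by (cases n; cases "n - 1") auto
  then show ?case
  proof cases
    case (3 k)
    have eq: "1 - q ^ Suc k = s * s * qnum q (Suc k)"
      unfolding assms by (rule one_minus_q_times_qnum[symmetric])
    have "poly (herm_poly s q n) x =
        s * x * poly (herm_poly s q (Suc k)) x - (1 - q ^ Suc k) * poly (herm_poly s q k) x"
      by (simp add: 3)
    also have "\<dots> = s ^ n * P n x 0 0 q"
      unfolding eq using less[of k] less[of "Suc k"] by (simp add: 3 algebra_simps)
    finally show ?thesis .
  qed auto
qed

text \<open>Let \<open>U\<close> stand for \<open>cheb_poly\<close> and \<open>h\<close> for \<open>herm_poly\<close>. A functional on polynomials with the stated Chebyshev moments annihilates \<open>h\<^sub>n\<close> for \<open>n > 0\<close>. The induction needs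
all mixed moments of \<open>U\<^sub>m h\<^sub>n\<close>, for which there is the closed form
\<open>(q)\<^sub>n\<^sub>+\<^sub>k/(q)\<^sub>k L(U\<^sub>2\<^sub>k)\<close> at \<open>m = n + 2k\<close>. The recurrences of \<open>U\<close> and \<open>h\<close> together
relate the moments at level \<open>n + 1\<close> to those at levels \<open>n\<close> and \<open>n - 1\<close>.\<close>

lemma cheb_herm_moments:
  fixes L :: "real poly \<Rightarrow> real" and s q :: real
  assumes q: "-1 < q" "q < 1"
    and add: "\<And>p r. L (p + r) = L p + L r" and smult: "\<And>c p. L (smult c p) = c * L p"
    and odd: "\<And>k. L (cheb_poly s (2 * k + 1)) = 0"
    and even: "\<And>k. L (cheb_poly s (2 * (k + 1))) = - (q ^ (k + 1)) * L (cheb_poly s (2 * k))"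
  shows "(\<forall>m<n. L (cheb_poly s m * herm_poly s q n) = 0) \<and>
    (\<forall>m. Parity.odd (m + n) \<longrightarrow> L (cheb_poly s m * herm_poly s q n) = 0) \<and>
    (\<forall>k. L (cheb_poly s (n + 2 * k) * herm_poly s q n) * qpoch q q k = qpoch q q (n + k) * L (cheb_poly s (2 * k)))"
proof (induction n rule: less_induct)
  case (less n)
  define a where "a = (\<lambda>m n. L (cheb_poly s m * herm_poly s q n))"
  define w where "w = (\<lambda>k. L (cheb_poly s (2 * k)))"
  have diff: "L (p - r) = L p - L r" for p r
    using add[of p "smult (-1) r"] smult[of "-1" r] by simp
  have a0: "a m 0 = L (cheb_poly s m)" for m by (simp add: a_def)
  have rec: "a m (Suc n) = a (Suc m) n + (if m = 0 then 0 else a (m - 1) n) - (1 - q ^ n) * a m (n - 1)" for m n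
  proof -
    have "cheb_poly s m * herm_poly s q (Suc n) =
        ([:0, s:] * cheb_poly s m) * herm_poly s q n - smult (1 - q ^ n) (cheb_poly s m * herm_poly s q (n - 1))"
      unfolding herm_poly_Suc by (simp add: right_diff_distrib mult_ac)
    also have "\<dots> = cheb_poly s (Suc m) * herm_poly s q n
         + (if m = 0 then 0 else cheb_poly s (m - 1) * herm_poly s q n)
         - smult (1 - q ^ n) (cheb_poly s m * herm_poly s q (n - 1))"
      unfolding cheb_poly_shift by (simp add: distrib_right)
    finally show ?thesis
      using smult[of 0 0] by (simp add: a_def diff add smult)
  qed
  show ?case
  proof (cases n)
    case 0
    have "L (cheb_poly s m) = 0" if "Parity.odd m" for m
      using odd[of "m div 2"] that by simp
    then show ?thesis by (simp add: 0)
  next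
    case (Suc N)
    have IH: "a m k = 0" if "m < k" "k < n" for m k using less[of k] that by (auto simp: a_def)
    have IHo: "a m k = 0" if "Parity.odd (m + k)" "k < n" for m k using less[of k] that by (auto simp: a_def)
    have IHe: "a (k + 2 * j) k * qpoch q q j = qpoch q q (k + j) * w j" if "k < n" for k j
      using less[of k] that by (auto simp: a_def w_def)
    have diag: "a k k = qpoch q q k * w 0" if "k < n" for k using IHe[OF that, of 0] by simp
    have o: "a m n = 0" if "Parity.odd (m + n)" for m
    proof -
      have "a (Suc m) N = 0" using that Suc by (intro IHo) auto
      moreover have "m = 0 \<or> a (m - 1) N = 0" using that Suc by (cases m) (auto intro!: IHo)
      moreover have "(1 - q ^ N) * a m (N - 1) = 0"
        using that Suc by (cases N) (auto intro!: IHo)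
      ultimately show ?thesis unfolding Suc rec by auto
    qed
    have z: "a m n = 0" if "m < n" for m
    proof (cases "Parity.odd (m + n)")
      case False
      then obtain d where d: "N = Suc d" using \<open>m < n\<close> Suc by (cases N) auto
      from False that Suc have "m \<noteq> N" by auto
      then have m: "m \<le> d" using that Suc d by simp
      show ?thesis
      proof (cases "m = d")
        case True
        have "a (d - 1) N = 0 \<or> d = 0" using IH[of "d - 1" N] Suc d by auto
        moreover have "qpoch q q N = qpoch q q d * (1 - q ^ N)" by (simp add: d qpoch_Suc)
        ultimately show ?thesis
          unfolding Suc rec using diag[of N] diag[of d] Suc d True by auto
      next
        case f: False
        have "a (Suc m) N = 0" "a (m - 1) N = 0" "a m (N - 1) = 0"
          using f m d Suc by (auto intro!: IH)
        then show ?thesis unfolding Suc rec by simp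
      qed
    qed (use o in auto)
    have e: "a (n + 2 * k) n * qpoch q q k = qpoch q q (n + k) * w k" for k
    proof -
      define y where "y = q ^ (k + 1)"
      have y1: "1 - y > 0"
        using one_minus_mult_power_pos[of q q k] q by (simp add: y_def)
      define D E where "D = qpoch q q k" and "E = qpoch q q (N + k)"
      have D': "qpoch q q (k + 1) = D * (1 - y)" by (simp add: D_def qpoch_Suc y_def)
      have E': "qpoch q q (Suc (N + k)) = E * (1 - q ^ N * y)" by (simp add: E_def qpoch_Suc y_def power_add mult_ac)
      have w': "w (k + 1) = - y * w k" using even[of k] by (simp add: w_def y_def)
      have 1: "a (N + 2 * (k + 1)) N * (D * (1 - y)) = E * (1 - q ^ N * y) * (- y * w k)"
        using IHe[of N "k + 1"] Suc unfolding D' w' by (simp add: E')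
      have 2: "a (N + 2 * k) N * D = E * w k" using IHe[of N k] Suc by (simp add: D_def E_def)
      have 3: "(1 - q ^ N) * a (Suc (N + 2 * k)) (N - 1) * (D * (1 - y)) = (1 - q ^ N) * E * (- y * w k)"
      proof (cases N)
        case (Suc d)
        have eq: "Suc (N + 2 * k) = d + 2 * (k + 1)" "d + (k + 1) = N + k" using Suc by auto
        have "a (d + 2 * (k + 1)) d * (D * (1 - y)) = E * (- y * w k)"
          using IHe[of d "k + 1"] \<open>n = Suc N\<close> Suc unfolding D' w' eq E_def by simp
        then show ?thesis unfolding eq(1) by (simp add: Suc mult.assoc)
      qed simp
      have "a (n + 2 * k) n * D * (1 - y) = a (N + 2 * (k + 1)) N * (D * (1 - y))
          + a (N + 2 * k) N * D * (1 - y) - (1 - q ^ N) * a (Suc (N + 2 * k)) (N - 1) * (D * (1 - y))"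
        unfolding Suc rec[of "Suc N + 2 * k" N] by (simp add: algebra_simps)
      also have "\<dots> = E * (1 - q ^ N * y) * w k * (1 - y)"
        unfolding 1 2 3 by (simp add: algebra_simps)
      finally have "a (n + 2 * k) n * D = E * (1 - q ^ N * y) * w k" using y1 by simp
      then show ?thesis by (simp add: D_def E' Suc)
    qed
    show ?thesis using o z e by (simp add: a_def w_def)
  qed
qed

text \<open>Once \<open>L(h\<^sub>m) = 0\<close> for \<open>m > 0\<close>, moving a factor \<open>s x\<close> from one polynomial to the other gives the general case.\<close>

lemma herm_orthogonal_of_cheb:
  fixes L :: "real poly \<Rightarrow> real" and s q :: real
  assumes q: "-1 < q" "q < 1"
    and add: "\<And>p r. L (p + r) = L p + L r" and smult: "\<And>c p. L (smult c p) = c * L p"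
    and odd: "\<And>k. L (cheb_poly s (2 * k + 1)) = 0"
    and even: "\<And>k. L (cheb_poly s (2 * (k + 1))) = - (q ^ (k + 1)) * L (cheb_poly s (2 * k))"
  shows "L (herm_poly s q n * herm_poly s q m) = (if n = m then qpoch q q n * L 1 else 0)"
proof (induction n arbitrary: m rule: less_induct)
  case (less n)
  define B where "B = (\<lambda>n m. L (herm_poly s q n * herm_poly s q m))"
  have diff: "L (p - r) = L p - L r" for p r
    using add[of p "smult (-1) r"] smult[of "-1" r] by simp
  have B_Suc: "B n (Suc m) = L ([:0, s:] * (herm_poly s q n * herm_poly s q m)) - (1 - q ^ m) * B n (m - 1)" for n m
    unfolding herm_poly_Suc[of s q m] B_def
    by (simp add: right_diff_distrib diff smult mult_ac)
  have B_comm: "B n m = B m n" for n m by (simp add: B_def mult.commute)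
  have rec: "B (Suc n) m = B n (Suc m) + (1 - q ^ m) * B n (m - 1) - (1 - q ^ n) * B (n - 1) m" for n m
    using B_Suc[of n m] B_Suc[of m n] by (simp add: B_comm[of m] mult_ac)
  show ?case
  proof (cases n)
    case 0
    have "L (herm_poly s q m) = 0" if "m > 0"
      using cheb_herm_moments[of q L s m] assms that by (auto dest: spec[of _ 0])
    then show ?thesis by (auto simp: 0)
  next
    case (Suc N)
    have IH: "B k m = (if k = m then qpoch q q k * L 1 else 0)" if "k < n" for k m
      using less[OF that] by (simp add: B_def)
    have "B n m = (if n = m then qpoch q q n * L 1 else 0)"
      unfolding Suc rec using IH[of N] IH[of "N - 1"] Suc
      by (cases N; cases m) (auto simp: qpoch_Suc)
    then show ?thesis by (simp add: B_def)
  qed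
qed

lemma cheb_poly_cos:
  assumes "s \<noteq> 0"
  shows "poly (cheb_poly s n) (2 * cos \<theta> / s) * sin \<theta> = sin (real (Suc n) * \<theta>)"
proof (induction n rule: less_induct)
  case (less n)
  consider "n = 0" | "n = Suc 0" | k where "n = Suc (Suc k)"
    by (cases n; cases "n - 1") auto
  then show ?case
  proof cases
    case 2
    then show ?thesis using assms by (simp add: sin_double)
  next
    case (3 k)
    have "poly (cheb_poly s n) (2 * cos \<theta> / s) * sin \<theta> =
        2 * cos \<theta> * (poly (cheb_poly s (Suc k)) (2 * cos \<theta> / s) * sin \<theta>) - poly (cheb_poly s k) (2 * cos \<theta> / s) * sin \<theta>"
      using assms by (simp add: 3 left_diff_distrib)
    also have "\<dots> = 2 * cos \<theta> * sin (real (Suc (Suc k)) * \<theta>) - sin (real (Suc k) * \<theta>)"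
      using less[of k] less[of "Suc k"] by (simp add: 3)
    also have "\<dots> = sin (real (Suc (Suc k)) * \<theta> + \<theta>)"
    proof -
      have "sin (real (Suc k) * \<theta>) = sin (real (Suc (Suc k)) * \<theta> - \<theta>)"
        by (simp add: algebra_simps)
      then show ?thesis by (simp only: sin_add sin_diff) simp
    qed
    also have "real (Suc (Suc k)) * \<theta> + \<theta> = real (Suc n) * \<theta>" by (simp add: 3 algebra_simps)
    finally show ?thesis .
  qed simp
qed

text \<open>With \<open>s x = 2 cos \<theta>\<close> the integrand is \<open>2 sin ((m+1) \<theta>)\<close>, and an antiderivative in \<open>x\<close> is a combination of
\<open>sin (m \<theta>)\<close> and \<open>sin ((m+2) \<theta>)\<close>, which vanishes at both end points.\<close>

lemma cheb_weight_integral: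
  assumes s: "s > 0" and m: "m > 0"
  shows "((\<lambda>x. poly (cheb_poly s m) x * sqrt (4 - s\<^sup>2 * x\<^sup>2)) has_integral 0) {-2 / s..2 / s}"
proof -
  define \<Phi> where "\<Phi> = (\<lambda>t. - (2 / s) * (sin (real m * t) / real m - sin (real (m + 2) * t) / real (m + 2)))"
  define f where "f = (\<lambda>x. \<Phi> (arccos (s * x / 2)))"
  have rng: "-1 \<le> s * x / 2 \<and> s * x / 2 \<le> 1" if "x \<in> {-2 / s..2 / s}" for x
    using that s by (auto simp: field_simps)
  have "((\<lambda>x. poly (cheb_poly s m) x * sqrt (4 - s\<^sup>2 * x\<^sup>2)) has_integral (f (2 / s) - f (- 2 / s))) {-2 / s..2 / s}"
  proof (rule fundamental_theorem_of_calculus_interior)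
    show "- 2 / s \<le> 2 / s" using s by (simp add: field_simps)
    show "continuous_on {- 2 / s..2 / s} f"
      unfolding f_def \<Phi>_def using rng m by (intro continuous_intros) auto
    fix x assume x: "x \<in> {- 2 / s<..<2 / s}"
    define t where "t = arccos (s * x / 2)"
    have r: "-1 < s * x / 2" "s * x / 2 < 1" using x s by (auto simp: field_simps)
    have t: "0 < t" "t < pi" using arccos_lt_bounded[OF r] by (auto simp: t_def)
    have ct: "cos t = s * x / 2" using r by (simp add: t_def)
    have st: "sin t > 0" using t by (rule sin_gt_zero)
    have x_eq: "x = 2 * cos t / s" using s by (simp add: ct)
    have "sqrt (4 - s\<^sup>2 * x\<^sup>2) = sqrt ((2 * sin t)\<^sup>2)"
      using s unfolding x_eq by (simp add: power_mult_distrib power_divide sin_squared_eq)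
    then have sq: "sqrt (4 - s\<^sup>2 * x\<^sup>2) = 2 * sin t" using st by (simp add: real_sqrt_mult)
    have sin_t: "sin t = sqrt (1 - (s * x / 2)\<^sup>2)" using r by (simp add: t_def sin_arccos)
    have dt: "((\<lambda>x. arccos (s * x / 2)) has_real_derivative - (s / 2) / sin t) (at x)"
    proof -
      have "((\<lambda>x. s * x / 2) has_real_derivative s / 2) (at x)"
        by (auto intro!: derivative_eq_intros)
      from DERIV_chain2[OF DERIV_arccos[OF r] this]
      have "((\<lambda>x. arccos (s * x / 2)) has_real_derivative inverse (- sin t) * (s / 2)) (at x)"
        unfolding sin_t .
      also have "inverse (- sin t) * (s / 2) = - (s / 2) / sin t"
        using st by (simp add: field_simps)
      finally show ?thesis .
    qed
    have cancel: "- (2 / s) * X * (- (s / 2) / Y) = X / Y" for X Y :: real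
      using s by (cases "Y = 0") (auto simp: field_simps)
    have d\<Phi>: "(\<Phi> has_real_derivative - (2 / s) * (cos (real m * t) - cos (real (m + 2) * t))) (at t)"
    proof -
      have d: "((\<lambda>t. sin (c * t) / c) has_real_derivative cos (c * t)) (at t)" if "c \<noteq> 0" for c
        using that by (auto intro!: derivative_eq_intros)
      have "real m \<noteq> 0" "real (m + 2) \<noteq> 0" using m by auto
      from DERIV_cmult[OF DERIV_diff[OF d[OF this(1)] d[OF this(2)]], of "- (2 / s)"]
      show ?thesis unfolding \<Phi>_def .
    qed
    have d\<Phi>': "(\<Phi> has_real_derivative - (2 / s) * (cos (real m * t) - cos (real (m + 2) * t))) (at (arccos (s * x / 2)))"
      using d\<Phi> unfolding t_def[symmetric] .
    have "(f has_real_derivative - (2 / s) * (cos (real m * t) - cos (real (m + 2) * t)) * (- (s / 2) / sin t)) (at x)"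
      unfolding f_def by (rule DERIV_chain2[where f = \<Phi> and g = "\<lambda>x. arccos (s * x / 2)", OF d\<Phi>' dt])
    also have "- (2 / s) * (cos (real m * t) - cos (real (m + 2) * t)) * (- (s / 2) / sin t)
        = (cos (real m * t) - cos (real (m + 2) * t)) / sin t"
      by (rule cancel)
    also have "cos (real m * t) - cos (real (m + 2) * t) = 2 * sin (real (Suc m) * t) * sin t"
    proof -
      have "cos (real m * t) = cos (real (Suc m) * t - t)" "cos (real (m + 2) * t) = cos (real (Suc m) * t + t)"
        by (simp_all add: algebra_simps)
      then show ?thesis by (simp only: cos_add cos_diff)
    qed
    also have "\<dots> / sin t = poly (cheb_poly s m) x * (2 * sin t)"
      using cheb_poly_cos[of s m t] s st unfolding x_eq[symmetric] by simp
    finally show "(f has_vector_derivative poly (cheb_poly s m) x * sqrt (4 - s\<^sup>2 * x\<^sup>2)) (at x)"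
      unfolding sq by (simp add: has_real_derivative_iff_has_vector_derivative)
  qed
  moreover have "f (2 / s) = 0" using s by (simp add: f_def \<Phi>_def)
  moreover have "f (- 2 / s) = 0"
  proof -
    have "f (- 2 / s) = \<Phi> pi" using s by (simp add: f_def)
    also have "\<Phi> pi = 0" unfolding \<Phi>_def sin_npi by simp
    finally show ?thesis .
  qed
  ultimately show ?thesis by simp
qed

lemma S_less_1: "q < 1 \<Longrightarrow> S q = {- 2 / sqrt (1 - q)..2 / sqrt (1 - q)}"
  by (simp add: S_def)

lemma compact_S: "q < 1 \<Longrightarrow> compact (S q)"
  by (simp add: S_less_1)

lemma integrable_on_S:
  fixes f :: "real \<Rightarrow> real"
  shows "q < 1 \<Longrightarrow> continuous_on (S q) f \<Longrightarrow> f integrable_on S q"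
  by (simp add: S_less_1 integrable_continuous_real)

lemma integral_S_tendsto:
  fixes f :: "nat \<Rightarrow> real \<Rightarrow> real"
  assumes q: "q < 1" and lim: "uniform_limit (S q) f g sequentially"
    and cont: "\<And>n. continuous_on (S q) (f n)"
  shows "(\<lambda>n. integral (S q) (f n)) \<longlonglongrightarrow> integral (S q) g"
proof -
  obtain I J where IJ: "\<And>n. (f n has_integral I n) (S q)" "(g has_integral J) (S q)" "I \<longlonglongrightarrow> J"
    using uniform_limit_integral[where a = "- 2 / sqrt (1 - q)" and b = "2 / sqrt (1 - q)"
        and f = f and g = g and F = sequentially]
      lim cont unfolding S_less_1[OF q] by auto
  then show ?thesis using integral_unique[OF IJ(1)] integral_unique[OF IJ(2)] by simp
qed

definition weight_int :: "real \<Rightarrow> (real \<Rightarrow> real) \<Rightarrow> real poly \<Rightarrow> real" where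
  "weight_int q w p = integral (S q) (\<lambda>x. poly p x * w x)"

lemma weight_int_add:
  assumes "q < 1" "continuous_on (S q) w"
  shows "weight_int q w (p + r) = weight_int q w p + weight_int q w r"
  unfolding weight_int_def poly_add distrib_right
  by (intro integral_add integrable_on_S assms continuous_intros)

lemma weight_int_smult: "weight_int q w (smult c p) = c * weight_int q w p"
  by (simp add: weight_int_def mult.assoc)

definition weight_factor :: "real \<Rightarrow> nat \<Rightarrow> real \<Rightarrow> real" where
  "weight_factor q k x = (1 + q ^ Suc k)\<^sup>2 - (1 - q) * x\<^sup>2 * q ^ Suc k"

text \<open>The density \<open>f\<^sub>N\<close> without its constant and with the infinite product truncated; for \<open>N = 0\<close> it is the
weight of the Chebyshev polynomials.\<close>

definition fin_weight :: "real \<Rightarrow> nat \<Rightarrow> real \<Rightarrow> real" where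
  "fin_weight q N x = sqrt (4 - (1 - q) * x\<^sup>2) * (\<Prod>k<N. weight_factor q k x)"

lemma continuous_fin_weight: "continuous_on A (fin_weight q N)"
  unfolding fin_weight_def weight_factor_def by (intro continuous_intros)

text \<open>One more factor of the weight is a quadratic polynomial in \<open>s x\<close>, and \<open>(s x)\<^sup>2 U\<^sub>m\<close> is a combination of
\<open>U\<^sub>m\<^sub>+\<^sub>2\<close>, \<open>U\<^sub>m\<close> and \<open>U\<^sub>m\<^sub>-\<^sub>2\<close>.\<close>

lemma cheb_fin_weight_step:
  assumes q: "q < 1"
  defines "J \<equiv> \<lambda>N m. weight_int q (fin_weight q N) (cheb_poly (sqrt (1 - q)) m)"
  shows "J (Suc N) m = (1 + q ^ Suc N)\<^sup>2 * J N m - q ^ Suc N *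
    (J N (m + 2) + (if m = 0 then J N 0 else if m = 1 then 2 * J N 1 else 2 * J N m + J N (m - 2)))"
proof -
  define s where "s = sqrt (1 - q)"
  have s2: "s\<^sup>2 = 1 - q" using q by (simp add: s_def)
  define W where "W = fin_weight q N"
  have W: "continuous_on (S q) W" unfolding W_def by (rule continuous_fin_weight)
  note add = weight_int_add[OF q W]
  let ?V = "cheb_poly s"
  have shift: "[:0, s:] * ([:0, s:] * ?V m) = ?V (m + 2) +
      (if m = 0 then ?V 0 else if m = 1 then smult 2 (?V 1) else smult 2 (?V m) + ?V (m - 2))"
  proof -
    consider "m = 0" | "m = 1" | k where "m = k + 2"
      by (cases m; cases "m - 1") auto
    then show ?thesis
    proof cases
      case (3 k)
      have m2: "smult 2 p = p + p" for p :: "real poly"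
      proof -
        have "smult (1 + 1) p = p + p" by (simp only: smult_add_left smult_1_left)
        then show ?thesis by (simp only: one_add_one)
      qed
      have "[:0, s:] * ?V m = ?V (Suc m) + ?V (Suc k)" using cheb_poly_shift[of s m] 3 by simp
      then have "[:0, s:] * ([:0, s:] * ?V m) = [:0, s:] * ?V (Suc m) + [:0, s:] * ?V (Suc k)"
        by (simp only: distrib_left)
      also have "\<dots> = (?V (Suc (Suc m)) + ?V m) + (?V (Suc (Suc k)) + ?V k)"
        using cheb_poly_shift[of s "Suc m"] cheb_poly_shift[of s "Suc k"] by simp
      finally show ?thesis using 3 by (simp add: m2 del: cheb_poly.simps)
    qed (simp_all add: poly_eq_iff algebra_simps)
  qed
  have "J (Suc N) m = integral (S q) (\<lambda>x. (1 + q ^ Suc N)\<^sup>2 * (poly (?V m) x * W x)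
      - q ^ Suc N * (poly ([:0, s:] * ([:0, s:] * ?V m)) x * W x))"
    unfolding J_def weight_int_def s_def[symmetric]
  proof (intro integral_cong)
    fix x
    have "fin_weight q (Suc N) x = W x * weight_factor q N x"
      by (simp add: fin_weight_def W_def)
    moreover have "weight_factor q N x = (1 + q ^ Suc N)\<^sup>2 - q ^ Suc N * (s\<^sup>2 * x\<^sup>2)"
      by (simp add: weight_factor_def s2)
    ultimately show "poly (?V m) x * fin_weight q (Suc N) x = (1 + q ^ Suc N)\<^sup>2 * (poly (?V m) x * W x)
      - q ^ Suc N * (poly ([:0, s:] * ([:0, s:] * ?V m)) x * W x)"
      by (simp add: right_diff_distrib power2_eq_square mult_ac)
  qed
  also have "\<dots> = (1 + q ^ Suc N)\<^sup>2 * weight_int q W (?V m)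
      - q ^ Suc N * weight_int q W ([:0, s:] * ([:0, s:] * ?V m))"
    unfolding weight_int_def
    by (subst integral_diff) (auto intro!: integrable_on_S q continuous_intros W)
  finally show ?thesis
    unfolding shift J_def s_def[symmetric] W_def[symmetric]
    by (simp add: add weight_int_smult del: cheb_poly.simps)
qed

lemma cheb_fin_weight_0:
  assumes q: "q < 1" and m: "m > 0"
  shows "weight_int q (fin_weight q 0) (cheb_poly (sqrt (1 - q)) m) = 0"
proof -
  have "sqrt (1 - q) > 0" using q by simp
  from cheb_weight_integral[OF this m] show ?thesis
    using q by (simp add: weight_int_def fin_weight_def S_less_1 integral_unique)
qed

lemma cheb_fin_weight_odd:
  assumes q: "q < 1"
  shows "weight_int q (fin_weight q N) (cheb_poly (sqrt (1 - q)) (2 * k + 1)) = 0"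
proof (induction N arbitrary: k)
  case 0
  then show ?case using cheb_fin_weight_0[OF q] by simp
next
  case (Suc N)
  have "weight_int q (fin_weight q N) (cheb_poly (sqrt (1 - q)) m) = 0" if "odd m" for m
    using Suc[of "m div 2"] that by simp
  then show ?case unfolding cheb_fin_weight_step[OF q] by (auto simp del: cheb_poly.simps)
qed

text \<open>The moments are, up to a constant, the coefficients in the finite Jacobi triple product
\<open>\<Prod>\<^sub>1\<^sub>\<le>\<^sub>i\<^sub>\<le>\<^sub>N (1 - u q\<^sup>i) \<Prod>\<^sub>0\<^sub>\<le>\<^sub>i\<^sub>\<le>\<^sub>N (1 - q\<^sup>i/u)\<close>. Writing them with \<open>q\<^sup>N\<^sup>+\<^sup>1 - q\<^sup>i\<^sup>+\<^sup>1\<close> instead of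
\<open>q\<close>-binomials makes them vanish automatically for \<open>k > N\<close> and leaves \<open>q = 0\<close> unexceptional.\<close>

lemma cheb_fin_weight_even:
  assumes q: "-1 < q" "q < 1"
  defines "J \<equiv> \<lambda>N m. weight_int q (fin_weight q N) (cheb_poly (sqrt (1 - q)) m)"
  shows "J N (2 * k) * (qpoch q q N * qpoch q q (N + k + 1)) =
    qpoch q q (2 * N + 1) * (\<Prod>i<k. q ^ (N + 1) - q ^ (i + 1)) * J 0 0"
proof (induction N arbitrary: k)
  case 0
  show ?case
  proof (cases k)
    case (Suc j)
    have "J 0 (2 * k) = 0" unfolding J_def using Suc q by (intro cheb_fin_weight_0) auto
    moreover have "(\<Prod>i<k. q ^ (0 + 1) - q ^ (i + 1)) = 0" unfolding Suc by (subst prod.lessThan_Suc_shift) simp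
    ultimately show ?thesis by simp
  qed simp
next
  case (Suc N)
  define Q where "Q = q ^ Suc N"
  define A where "A = qpoch q q N"
  define C where "C = qpoch q q (2 * N + 1) * J 0 0"
  have step: "J (Suc N) m = (1 + Q)\<^sup>2 * J N m - Q *
    (J N (m + 2) + (if m = 0 then J N 0 else if m = 1 then 2 * J N 1 else 2 * J N m + J N (m - 2)))" for m
    unfolding J_def Q_def by (rule cheb_fin_weight_step[OF q(2)])
  have A': "qpoch q q (Suc N) = A * (1 - Q)" by (simp add: A_def Q_def qpoch_Suc)
  have C': "qpoch q q (2 * Suc N + 1) * J 0 0 = C * ((1 - Q * Q) * (1 - q * (Q * Q)))"
    by (simp add: C_def Q_def qpoch_Suc mult_ac flip: power_add mult_2)
  show ?case
  proof (cases k)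
    case 0
    define p where "p = qpoch q q (N + 1)"
    have p': "qpoch q q (N + 1 + 1) = p * (1 - Q * q)" by (simp add: p_def qpoch_Suc Q_def mult_ac)
    have i0: "J N 0 * (A * p) = C"
      using Suc[of 0] by (simp add: A_def p_def C_def)
    have i1: "J N 2 * (A * (p * (1 - Q * q))) = C * (Q - q)"
      using Suc[of 1] unfolding p' by (simp add: A_def C_def Q_def mult_ac)
    have st: "J (Suc N) 0 = (1 + Q)\<^sup>2 * J N 0 - Q * (J N 2 + J N 0)"
      using step[of 0] by (simp add: eval_nat_numeral)
    have "J (Suc N) 0 * (A * (1 - Q) * (p * (1 - Q * q))) =
        (1 - Q) * ((1 + Q + Q\<^sup>2) * (1 - Q * q) * (J N 0 * (A * p)) - Q * (J N 2 * (A * (p * (1 - Q * q)))))"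
      unfolding st by algebra
    also have "\<dots> = C * ((1 - Q * Q) * (1 - q * (Q * Q)))"
      unfolding i0 i1 by algebra
    finally have "J (Suc N) 0 * (qpoch q q (Suc N) * qpoch q q (Suc N + 1)) = qpoch q q (2 * Suc N + 1) * J 0 0"
      unfolding A' C' using p' by simp
    then show ?thesis unfolding 0 by simp
  next
    case (Suc j)
    define p where "p = qpoch q q (N + j + 1)"
    define y where "y = q ^ (j + 1)"
    define X where "X = (\<Prod>i<j. Q - q ^ (i + 1))"
    have p1: "qpoch q q (N + (j + 1) + 1) = p * (1 - Q * y)"
      by (simp add: p_def qpoch_Suc Q_def y_def power_add mult_ac)
    have p2: "qpoch q q (N + (j + 2) + 1) = p * (1 - Q * y) * (1 - Q * y * q)"
    proof -
      have eq: "N + (j + 2) + 1 = Suc (N + (j + 1) + 1)" by simp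
      have "q * q ^ (N + (j + 1) + 1) = Q * y * q" by (simp add: Q_def y_def power_add mult_ac)
      then show ?thesis unfolding eq qpoch_Suc[of _ _ "N + (j + 1) + 1"] p1 by (simp only:)
    qed
    have IH: "J N (2 * k) * (A * qpoch q q (N + k + 1)) = C * (\<Prod>i<k. Q - q ^ (i + 1))" for k
      using Suc.IH[of k] by (simp add: A_def C_def Q_def mult_ac)
    have i0: "J N (2 * j) * (A * p) = C * X"
      using IH[of j] by (simp add: p_def X_def)
    have i1: "J N (2 * j + 2) * (A * (p * (1 - Q * y))) = C * (X * (Q - y))"
      using IH[of "j + 1"] unfolding p1 by (simp add: X_def y_def)
    have e4: "2 * (j + 2) = 2 * j + 4" by simp
    have i2: "J N (2 * j + 4) * (A * (p * (1 - Q * y) * (1 - Q * y * q))) = C * (X * (Q - y) * (Q - y * q))"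
      using IH[of "j + 2"] unfolding p2 e4 by (simp add: X_def y_def mult_ac add.commute)
    have prod': "(\<Prod>i<Suc j. Q * q - q ^ (i + 1)) = y * (Q - 1) * X"
    proof -
      have "(\<Prod>i<Suc j. Q * q - q ^ (i + 1)) = (\<Prod>i<Suc j. q * (Q - q ^ i))"
        by (intro prod.cong) (auto simp: algebra_simps)
      also have "\<dots> = q ^ Suc j * (\<Prod>i<Suc j. Q - q ^ i)" by (simp only: prod.distrib prod_constant card_lessThan)
      also have "(\<Prod>i<Suc j. Q - q ^ i) = (Q - 1) * X"
        unfolding X_def by (subst prod.lessThan_Suc_shift) simp
      finally show ?thesis by (simp add: y_def)
    qed
    have st: "J (Suc N) (2 * j + 2) = (1 + Q\<^sup>2) * J N (2 * j + 2) - Q * (J N (2 * j + 4) + J N (2 * j))"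
    proof -
      have e5: "2 * j + 2 + 2 = 2 * j + 4" by simp
      show ?thesis unfolding step[of "2 * j + 2"] e5 by (simp add: algebra_simps power2_eq_square)
    qed
    have "J (Suc N) (2 * j + 2) * (A * (1 - Q) * (p * (1 - Q * y) * (1 - Q * y * q))) =
       (1 - Q) * ((1 + Q\<^sup>2) * (1 - Q * y * q) * (J N (2 * j + 2) * (A * (p * (1 - Q * y))))
       - Q * (J N (2 * j + 4) * (A * (p * (1 - Q * y) * (1 - Q * y * q))))
       - Q * (1 - Q * y) * (1 - Q * y * q) * (J N (2 * j) * (A * p)))"
      unfolding st by algebra
    also have "\<dots> = C * ((1 - Q * Q) * (1 - q * (Q * Q))) * (y * (Q - 1) * X)"
      unfolding i0 i1 i2 by algebra
    finally have "J (Suc N) (2 * k) * (qpoch q q (Suc N) * qpoch q q (N + (j + 2) + 1)) =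
        qpoch q q (2 * Suc N + 1) * J 0 0 * (\<Prod>i<k. Q * q - q ^ (i + 1))"
      unfolding A' C' p2 Suc prod' by simp
    then show ?thesis by (simp add: Suc Q_def mult_ac)
  qed
qed

lemma weight_factor_bounds:
  assumes q: "-1 < q" "q < 1" and x: "x \<in> S q"
  shows "weight_factor q k x > 0" and "\<bar>weight_factor q k x - 1\<bar> \<le> 7 * \<bar>q\<bar> ^ k"
proof -
  define u where "u = q ^ Suc k"
  define c where "c = (1 - q) * x\<^sup>2"
  have "c = (sqrt (1 - q) * x)\<^sup>2" using q by (simp add: c_def power_mult_distrib)
  also have "\<dots> \<le> 2\<^sup>2"
    using abs_le_of_mem_S[of q x] q x by (intro power2_le_iff_abs_le[THEN iffD2]) auto
  finally have c: "0 \<le> c" "c \<le> 4" using q by (auto simp: c_def)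
  have u1: "\<bar>u\<bar> < 1"
    using q unfolding u_def power_abs by (intro power_less_one_iff[THEN iffD2]) auto
  have eq: "weight_factor q k x = (1 + u)\<^sup>2 - c * u"
    by (simp add: weight_factor_def u_def c_def)
  show "weight_factor q k x > 0"
  proof (cases "u \<ge> 0")
    case True
    have "c * u \<le> 4 * u" using c True by (intro mult_right_mono) auto
    moreover have "(1 - u)\<^sup>2 > 0" using u1 by simp
    ultimately show ?thesis unfolding eq by (simp add: power2_eq_square algebra_simps)
  next
    case False
    then have "c * u \<le> 0" using c by (simp add: mult_le_0_iff)
    moreover have "(1 + u)\<^sup>2 > 0" using u1 by simp
    ultimately show ?thesis unfolding eq by linarith
  qed
  have "weight_factor q k x - 1 = u * (2 + u - c)"
    unfolding eq by (simp add: power2_eq_square algebra_simps)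
  also have "\<bar>\<dots>\<bar> \<le> \<bar>u\<bar> * 7"
    unfolding abs_mult using u1 c by (intro mult_left_mono) auto
  also have "\<bar>u\<bar> \<le> \<bar>q\<bar> ^ k"
    unfolding u_def power_abs using q by (intro power_decreasing) auto
  finally show "\<bar>weight_factor q k x - 1\<bar> \<le> 7 * \<bar>q\<bar> ^ k" by simp
qed

definition inf_weight :: "real \<Rightarrow> real \<Rightarrow> real" where
  "inf_weight q x = sqrt (4 - (1 - q) * x\<^sup>2) * (\<Prod>k. weight_factor q k x)"

lemma fin_weight_uniform_limit:
  assumes q: "-1 < q" "q < 1"
  shows "uniform_limit (S q) (fin_weight q) (inf_weight q) sequentially"
proof -
  have q1: "\<bar>q\<bar> < 1" using q by auto
  have cont: "continuous_on A (weight_factor q k)" for A k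
    unfolding weight_factor_def by (intro continuous_intros)
  have "uniformly_convergent_on (S q) (\<lambda>N x. \<Sum>k<N. norm (weight_factor q k x - 1))"
  proof (rule Weierstrass_m_test')
    show "norm (norm (weight_factor q k x - 1)) \<le> 7 * \<bar>q\<bar> ^ k" if "x \<in> S q" for k x
      using weight_factor_bounds(2)[OF q that, of k] by simp
    show "summable (\<lambda>k. 7 * \<bar>q\<bar> ^ k)"
      using q1 by (intro summable_mult summable_geometric) simp
  qed
  then have "uniformly_convergent_on (S q) (\<lambda>N x. \<Prod>k<N. weight_factor q k x)"
    by (rule uniformly_convergent_on_prod'[OF cont compact_S[OF q(2)]])
  then have u: "uniform_limit (S q) (\<lambda>N x. \<Prod>k<N. weight_factor q k x)
      (\<lambda>x. lim (\<lambda>N. \<Prod>k<N. weight_factor q k x)) sequentially"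
    by (simp only: uniformly_convergent_uniform_limit_iff)
  have l: "lim (\<lambda>N. \<Prod>k<N. weight_factor q k x) = (\<Prod>k. weight_factor q k x)" if x: "x \<in> S q" for x
  proof (rule limI, rule convergent_prod_tendsto_lessThan, rule convergent_prod_of_geometric[OF q1])
    show "\<bar>weight_factor q k x - 1\<bar> \<le> 7 * \<bar>q\<bar> ^ k" for k by (rule weight_factor_bounds(2)[OF q x])
    show "weight_factor q k x \<noteq> 0" for k using weight_factor_bounds(1)[OF q x, of k] by simp
  qed
  have "continuous_on (S q) (\<lambda>x. lim (\<lambda>N. \<Prod>k<N. weight_factor q k x))"
    by (rule uniform_limit_theorem[OF _ u]) (intro always_eventually allI continuous_intros cont, simp)
  then have b: "bounded ((\<lambda>x. lim (\<lambda>N. \<Prod>k<N. weight_factor q k x)) ` S q)"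
    by (intro compact_imp_bounded compact_continuous_image compact_S q)
  have "continuous_on (S q) (\<lambda>x. sqrt (4 - (1 - q) * x\<^sup>2))" by (intro continuous_intros)
  then have b': "bounded ((\<lambda>x. sqrt (4 - (1 - q) * x\<^sup>2)) ` S q)"
    by (intro compact_imp_bounded compact_continuous_image compact_S q)
  have "uniform_limit (S q) (\<lambda>N x. sqrt (4 - (1 - q) * x\<^sup>2) * (\<Prod>k<N. weight_factor q k x))
      (\<lambda>x. sqrt (4 - (1 - q) * x\<^sup>2) * lim (\<lambda>N. \<Prod>k<N. weight_factor q k x)) sequentially"
    by (rule uniform_lim_mult[OF uniform_limit_const u b' b])
  then show ?thesis
    unfolding fin_weight_def inf_weight_def
    by (rule uniform_limit_cong'[THEN iffD1, rotated 2]) (auto simp: l)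
qed

lemma continuous_inf_weight:
  assumes q: "-1 < q" "q < 1"
  shows "continuous_on (S q) (inf_weight q)"
  by (rule uniform_limit_theorem[OF _ fin_weight_uniform_limit[OF q]])
    (intro always_eventually allI continuous_fin_weight, simp)

lemma weight_int_tendsto:
  assumes q: "-1 < q" "q < 1"
  shows "(\<lambda>N. weight_int q (fin_weight q N) p) \<longlonglongrightarrow> weight_int q (inf_weight q) p"
  unfolding weight_int_def
proof (rule integral_S_tendsto[OF q(2)])
  have b: "bounded ((poly p) ` S q)"
    by (intro compact_imp_bounded compact_continuous_image compact_S q continuous_intros)
  have b': "bounded (inf_weight q ` S q)"
    by (intro compact_imp_bounded compact_continuous_image compact_S q continuous_inf_weight)
  show "uniform_limit (S q) (\<lambda>N x. poly p x * fin_weight q N x) (\<lambda>x. poly p x * inf_weight q x) sequentially"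
    by (rule uniform_lim_mult[OF uniform_limit_const fin_weight_uniform_limit[OF q] b b'])
  show "continuous_on (S q) (\<lambda>x. poly p x * fin_weight q n x)" for n
    by (intro continuous_intros continuous_fin_weight)
qed

text \<open>The limit of the quotient of two consecutive moments in \<open>cheb_fin_weight_even\<close>; there \<open>(q)\<^sub>N\<^sub>+\<^sub>k\<^sub>+\<^sub>2/(q)\<^sub>N\<^sub>+\<^sub>k\<^sub>+\<^sub>1\<close>
tends to 1 and \<open>q\<^sup>N\<^sup>+\<^sup>1\<close> to 0.\<close>

lemma cheb_inf_weight:
  assumes q: "-1 < q" "q < 1"
  defines "L \<equiv> \<lambda>m. weight_int q (inf_weight q) (cheb_poly (sqrt (1 - q)) m)"
  shows "L (2 * k + 1) = 0" and "L (2 * (k + 1)) = - (q ^ (k + 1)) * L (2 * k)"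
proof -
  define J where "J = (\<lambda>N m. weight_int q (fin_weight q N) (cheb_poly (sqrt (1 - q)) m))"
  have lim: "(\<lambda>N. J N m) \<longlonglongrightarrow> L m" for m unfolding J_def L_def by (rule weight_int_tendsto[OF q])
  have "J N (2 * k + 1) = 0" for N unfolding J_def by (rule cheb_fin_weight_odd[OF q(2)])
  then show "L (2 * k + 1) = 0" using lim[of "2 * k + 1"] by (simp add: LIMSEQ_const_iff)
  have rel: "J N (2 * (k + 1)) * (1 - q ^ (N + k + 2)) = (q ^ (N + 1) - q ^ (k + 1)) * J N (2 * k)" for N
  proof -
    define A where "A = qpoch q q N * qpoch q q (N + k + 1)"
    have "\<bar>q\<bar> < 1" using q by auto
    from qpoch_pos[OF q(1) less_imp_le[OF q(2)] this] have "qpoch q q n \<noteq> 0" for n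
      by (metis less_irrefl)
    then have A: "A \<noteq> 0" by (simp add: A_def)
    define X where "X = (\<Prod>i<k. q ^ (N + 1) - q ^ (i + 1))"
    define C where "C = qpoch q q (2 * N + 1) * J 0 0"
    have "qpoch q q (N + (k + 1) + 1) = qpoch q q (N + k + 1) * (1 - q ^ (N + k + 2))"
      by (simp add: qpoch_Suc mult_ac)
    then have "J N (2 * (k + 1)) * (A * (1 - q ^ (N + k + 2))) = C * X * (q ^ (N + 1) - q ^ (k + 1))"
      using cheb_fin_weight_even[OF q, of N "k + 1"] by (simp add: J_def A_def C_def X_def mult_ac)
    moreover have "J N (2 * k) * A = C * X"
      using cheb_fin_weight_even[OF q, of N k] by (simp add: J_def A_def C_def X_def mult_ac)
    ultimately have "(J N (2 * (k + 1)) * (1 - q ^ (N + k + 2))) * A = ((q ^ (N + 1) - q ^ (k + 1)) * J N (2 * k)) * A"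
      by (simp add: mult_ac)
    then show ?thesis using A by (simp only: mult_cancel_right) simp
  qed
  have pw: "(\<lambda>N. q ^ (N + j)) \<longlonglongrightarrow> 0" for j
    using q by (intro LIMSEQ_ignore_initial_segment LIMSEQ_power_zero) auto
  have "(\<lambda>N. J N (2 * (k + 1)) * (1 - q ^ (N + (k + 2)))) \<longlonglongrightarrow> L (2 * (k + 1)) * (1 - 0)"
    by (intro tendsto_mult tendsto_diff tendsto_const lim pw)
  moreover have "(\<lambda>N. (q ^ (N + 1) - q ^ (k + 1)) * J N (2 * k)) \<longlonglongrightarrow> (0 - q ^ (k + 1)) * L (2 * k)"
    by (intro tendsto_mult tendsto_diff tendsto_const lim pw)
  ultimately have "L (2 * (k + 1)) * (1 - 0) = (0 - q ^ (k + 1)) * L (2 * k)"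
    using rel by (intro LIMSEQ_unique[of "\<lambda>N. J N (2 * (k + 1)) * (1 - q ^ (N + (k + 2)))"]) (simp_all add: add.assoc)
  then show "L (2 * (k + 1)) = - (q ^ (k + 1)) * L (2 * k)" by simp
qed

lemma f_N_eq: "f_N x q = qpoch_inf q q * sqrt (1 - q) / (2 * pi) * inf_weight q x"
  by (simp add: f_N_def inf_weight_def weight_factor_def)

lemma continuous_f_N: "-1 < q \<Longrightarrow> q < 1 \<Longrightarrow> continuous_on (S q) (\<lambda>x. f_N x q)"
  unfolding f_N_eq by (intro continuous_intros continuous_inf_weight)

lemma herm_orthogonal_f_N:
  assumes q: "-1 < q" "q < 1"
  shows "integral (S q) (\<lambda>x. P n x 0 0 q * P m x 0 0 q * f_N x q) =
    (if n = m then qfact q n * integral (S q) (\<lambda>x. f_N x q) else 0)"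
proof -
  define s where "s = sqrt (1 - q)"
  define \<kappa> where "\<kappa> = qpoch_inf q q * sqrt (1 - q) / (2 * pi)"
  define L where "L = weight_int q (inf_weight q)"
  have s: "s > 0" "s * s = 1 - q" using q by (auto simp: s_def)
  have o: "L (herm_poly s q n * herm_poly s q m) = (if n = m then qpoch q q n * L 1 else 0)"
  proof (rule herm_orthogonal_of_cheb[OF q])
    show "L (p + r) = L p + L r" for p r
      unfolding L_def by (rule weight_int_add[OF q(2) continuous_inf_weight[OF q]])
    show "L (smult c p) = c * L p" for c p unfolding L_def by (rule weight_int_smult)
    show "L (cheb_poly s (2 * k + 1)) = 0" for k
      unfolding L_def s_def by (rule cheb_inf_weight[OF q])
    show "L (cheb_poly s (2 * (k + 1))) = - (q ^ (k + 1)) * L (cheb_poly s (2 * k))" for k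
      unfolding L_def s_def by (rule cheb_inf_weight[OF q])
  qed
  have fact: "qpoch q q n = (s * s) ^ n * qfact q n" for n
  proof (induction n)
    case (Suc n)
    have "1 - q * q ^ n = s * s * qnum q (Suc n)"
      unfolding s(2) one_minus_q_times_qnum by simp
    then show ?case unfolding qpoch_Suc qfact_Suc Suc.IH by (simp add: mult_ac)
  qed simp
  have N: "integral (S q) (\<lambda>x. f_N x q) = \<kappa> * L 1"
    unfolding f_N_eq \<kappa>_def[symmetric] by (simp add: L_def weight_int_def)
  have "(s ^ n * s ^ m) * integral (S q) (\<lambda>x. P n x 0 0 q * P m x 0 0 q * f_N x q)
      = integral (S q) (\<lambda>x. \<kappa> * (poly (herm_poly s q n * herm_poly s q m) x * inf_weight q x))"
    unfolding integral_mult_right[symmetric] poly_mult poly_herm_poly[OF s(2)] f_N_eq \<kappa>_def[symmetric]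
    by (simp add: mult_ac)
  also have "\<dots> = \<kappa> * L (herm_poly s q n * herm_poly s q m)"
    by (simp add: L_def weight_int_def)
  also have "\<dots> = (s ^ n * s ^ m) * (if n = m then qfact q n * integral (S q) (\<lambda>x. f_N x q) else 0)"
    unfolding o N fact by (simp add: power_mult_distrib mult_ac)
  finally show ?thesis using s(1) by simp
qed

lemma integral_f_N_pos:
  assumes q: "-1 < q" "q < 1"
  shows "integral (S q) (\<lambda>x. f_N x q) > 0"
proof -
  have q1: "\<bar>q\<bar> < 1" using q by auto
  have "qpoch_inf q q > 0" by (rule qpoch_inf_pos[OF q q1])
  then have \<kappa>: "qpoch_inf q q * sqrt (1 - q) / (2 * pi) > 0" using q by simp
  have prod: "(\<Prod>k. weight_factor q k x) > 0" if x: "x \<in> S q" for x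
  proof (rule prodinf_pos, rule convergent_prod_of_geometric[OF q1])
    show "\<bar>weight_factor q k x - 1\<bar> \<le> 7 * \<bar>q\<bar> ^ k" for k by (rule weight_factor_bounds(2)[OF q x])
    show w: "weight_factor q k x > 0" for k by (rule weight_factor_bounds(1)[OF q x])
    show "weight_factor q k x \<noteq> 0" for k using w[of k] by simp
  qed
  have nonneg: "f_N x q \<ge> 0" if x: "x \<in> S q" for x
  proof -
    have "(sqrt (1 - q) * x)\<^sup>2 \<le> 2\<^sup>2"
      using abs_le_of_mem_S[of q x] q x by (intro power2_le_iff_abs_le[THEN iffD2]) auto
    then have "sqrt (4 - (1 - q) * x\<^sup>2) \<ge> 0" using q by (simp add: power_mult_distrib)
    then show ?thesis
      unfolding f_N_eq inf_weight_def using \<kappa> prod[OF x] by (intro mult_nonneg_nonneg) auto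
  qed
  have z: "0 \<in> S q" using q by (simp add: S_less_1)
  have "inf_weight q 0 > 0" using prod[OF z] by (simp add: inf_weight_def)
  then have pos: "f_N 0 q > 0" unfolding f_N_eq using \<kappa> by (rule mult_pos_pos[rotated])
  have int: "(\<lambda>x. f_N x q) integrable_on S q"
    by (rule integrable_on_S[OF q(2) continuous_f_N[OF q]])
  have "integral (S q) (\<lambda>x. f_N x q) \<ge> 0"
    using int nonneg by (rule integral_nonneg)
  moreover have "integral (S q) (\<lambda>x. f_N x q) \<noteq> 0"
  proof
    assume "integral (S q) (\<lambda>x. f_N x q) = 0"
    with int have i0: "((\<lambda>x. f_N x q) has_integral 0) (S q)"
      by (simp add: has_integral_integral)
    define r where "r = 2 / sqrt (1 - q)"
    have r: "r > 0" using q by (simp add: r_def)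
    have S: "S q = cbox (- r) r" by (simp add: S_less_1[OF q(2)] r_def)
    have "f_N 0 q = 0"
    proof (rule has_integral_0_cbox_imp_0[where f = "\<lambda>x. f_N x q"])
      show "continuous_on (cbox (- r) r) (\<lambda>x. f_N x q)"
        using continuous_f_N[OF q] unfolding S .
      show "((\<lambda>x. f_N x q) has_integral 0) (cbox (- r) r)" using i0 unfolding S .
      show "0 \<le> f_N x q" if "x \<in> box (- r) r" for x
        using that nonneg[of x] box_subset_cbox unfolding S by blast
    qed (use r in auto)
    then show False using pos by simp
  qed
  ultimately show ?thesis by simp
qed

section \<open>Moments of the Askey--Wilson density for q below 1\<close>

text \<open>The geometric majorant makes the convergence uniform on the compact set \<open>S q\<close>.\<close>

lemma integral_series:
  fixes \<phi> :: "nat \<Rightarrow> real \<Rightarrow> real"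
  assumes q: "q < 1" and w: "continuous_on (S q) w"
    and cont: "\<And>m. continuous_on (S q) (\<phi> m)"
    and bound: "\<And>m y. y \<in> S q \<Longrightarrow> \<bar>\<phi> m y\<bar> \<le> K * \<theta> ^ m" and th: "0 \<le> \<theta>" "\<theta> < 1"
    and sums: "\<And>y. y \<in> S q \<Longrightarrow> (\<lambda>m. \<phi> m y) sums \<Phi> y"
  shows "continuous_on (S q) \<Phi>"
    and "(\<lambda>m. integral (S q) (\<lambda>y. \<phi> m y * w y)) sums integral (S q) (\<lambda>y. \<Phi> y * w y)"
proof -
  have "uniform_limit (S q) (\<lambda>n y. \<Sum>m<n. \<phi> m y) (\<lambda>y. \<Sum>m. \<phi> m y) sequentially"
  proof (rule Weierstrass_m_test)
    show "norm (\<phi> m y) \<le> K * \<theta> ^ m" if "y \<in> S q" for m y using bound[OF that] by simp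
    show "summable (\<lambda>m. K * \<theta> ^ m)" using th by (intro summable_mult summable_geometric) simp
  qed
  then have u: "uniform_limit (S q) (\<lambda>n y. \<Sum>m<n. \<phi> m y) \<Phi> sequentially"
    by (rule uniform_limit_cong'[THEN iffD1, rotated 2]) (use sums in \<open>auto simp: sums_iff\<close>)
  show c: "continuous_on (S q) \<Phi>"
    by (rule uniform_limit_theorem[OF _ u]) (intro always_eventually allI continuous_intros cont, simp)
  have b: "bounded (\<Phi> ` S q)" "bounded (w ` S q)"
    by (intro compact_imp_bounded compact_continuous_image compact_S q c w)+
  have u': "uniform_limit (S q) (\<lambda>n y. (\<Sum>m<n. \<phi> m y) * w y) (\<lambda>y. \<Phi> y * w y) sequentially"
    by (rule uniform_lim_mult[OF u uniform_limit_const b])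
  have "(\<lambda>n. integral (S q) (\<lambda>y. (\<Sum>m<n. \<phi> m y) * w y)) \<longlonglongrightarrow> integral (S q) (\<lambda>y. \<Phi> y * w y)"
    by (rule integral_S_tendsto[OF q u']) (intro continuous_intros cont w)
  moreover have "integral (S q) (\<lambda>y. (\<Sum>m<n. \<phi> m y) * w y) = (\<Sum>m<n. integral (S q) (\<lambda>y. \<phi> m y * w y))" for n
    unfolding sum_distrib_right
    by (rule integral_sum) (auto intro!: integrable_on_S q continuous_intros cont w)
  ultimately show "(\<lambda>m. integral (S q) (\<lambda>y. \<phi> m y * w y)) sums integral (S q) (\<lambda>y. \<Phi> y * w y)"
    by (simp add: sums_def)
qed

lemma continuous_P: "continuous_on A (\<lambda>x. P n x y b q)"
proof (induction n rule: less_induct)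
  case (less n)
  consider "n = 0" | "n = Suc 0" | k where "n = Suc (Suc k)"
    by (cases n; cases "n - 1") auto
  then show ?case
  proof cases
    case (3 k)
    have "continuous_on A (\<lambda>x. P k x y b q)" "continuous_on A (\<lambda>x. P (Suc k) x y b q)"
      using less 3 by auto
    then show ?thesis unfolding 3 P.simps by (intro continuous_intros)
  qed (auto intro!: continuous_intros)
qed

lemma S_bounded: "q < 1 \<Longrightarrow> \<exists>M\<ge>0. \<forall>x\<in>S q. \<bar>x\<bar> \<le> M"
  using compact_imp_bounded[OF compact_S, of q] unfolding bounded_iff
  by (metis abs_ge_zero dual_order.trans order_refl real_norm_def linorder_linear)

lemma mehler_term_uniform_bound:
  assumes q: "-1 < q" "q < 1" and t: "\<bar>t\<bar> < 1"
  shows "\<exists>\<theta> K. 0 \<le> \<theta> \<and> \<theta> < 1 \<and> (\<forall>x\<in>S q. \<forall>z\<in>S q. \<forall>m. \<bar>mehler_term q x z t s r m\<bar> \<le> K * \<theta> ^ m)"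
proof -
  obtain M where M: "M \<ge> 0" "\<forall>x\<in>S q. \<bar>x\<bar> \<le> M" using S_bounded[OF q(2)] by blast
  obtain \<theta> K where "0 \<le> \<theta>" "\<theta> < 1" "\<forall>x z m. x \<in> S q \<longrightarrow> z \<in> S q \<longrightarrow> \<bar>x\<bar> \<le> M \<longrightarrow> \<bar>z\<bar> \<le> M \<longrightarrow>
           \<bar>mehler_term q x z t s r m\<bar> \<le> K * \<theta> ^ m"
    using mehler_term_bound[OF q(1) less_imp_le[OF q(2)] t M(1), of s r] by blast
  then show ?thesis using M(2) by (intro exI[of _ \<theta>] exI[of _ K]) auto
qed

lemma mehler_term_sums:
  assumes "-1 < q" "q < 1" "\<bar>t\<bar> < 1" "x \<in> S q" "z \<in> S q"
  shows "mehler_term q x z t s r sums mehler_sum q x z t s r"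
  unfolding mehler_sum_def using assms by (intro summable_sums summable_mehler_term) auto

lemma integral_mehler_sum_times:
  assumes q: "-1 < q" "q < 1" and t: "\<bar>t\<bar> < 1" and z: "z \<in> S q"
    and g: "continuous_on (S q) g"
  shows "continuous_on (S q) (\<lambda>y. mehler_sum q y z t n 0)"
    and "(\<lambda>m. t ^ m / qfact q m * P m z 0 0 q * integral (S q) (\<lambda>y. P (m + n) y 0 0 q * g y))
      sums integral (S q) (\<lambda>y. mehler_sum q y z t n 0 * g y)"
proof -
  obtain \<theta> K where K: "0 \<le> \<theta>" "\<theta> < 1"
    "\<And>x z m. x \<in> S q \<Longrightarrow> z \<in> S q \<Longrightarrow> \<bar>mehler_term q x z t n 0 m\<bar> \<le> K * \<theta> ^ m"
    using mehler_term_uniform_bound[OF q t, of n 0] by blast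
  note * = integral_series[where \<phi> = "\<lambda>m y. mehler_term q y z t n 0 m" and \<Phi> = "\<lambda>y. mehler_sum q y z t n 0"
      and w = g and K = K and \<theta> = \<theta>, OF q(2) g _ _ K(1,2)]
  have c: "continuous_on (S q) (\<lambda>y. mehler_term q y z t n 0 m)" for m
    unfolding mehler_term_def by (intro continuous_intros continuous_P)
  show "continuous_on (S q) (\<lambda>y. mehler_sum q y z t n 0)"
    by (rule *(1)[OF c K(3)[OF _ z] mehler_term_sums[OF q t _ z]])
  have "(\<lambda>m. integral (S q) (\<lambda>y. mehler_term q y z t n 0 m * g y)) sums integral (S q) (\<lambda>y. mehler_sum q y z t n 0 * g y)"
    by (rule *(2)[OF c K(3)[OF _ z] mehler_term_sums[OF q t _ z]])
  moreover have "integral (S q) (\<lambda>y. mehler_term q y z t n 0 m * g y)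
      = t ^ m / qfact q m * P m z 0 0 q * integral (S q) (\<lambda>y. P (m + n) y 0 0 q * g y)" for m
    unfolding integral_mult_right[symmetric] by (simp add: mehler_term_def mult_ac)
  ultimately show "(\<lambda>m. t ^ m / qfact q m * P m z 0 0 q * integral (S q) (\<lambda>y. P (m + n) y 0 0 q * g y))
      sums integral (S q) (\<lambda>y. mehler_sum q y z t n 0 * g y)" by simp
qed

text \<open>Only the term \<open>H\<^sub>j\<close> of the q-Hermite series survives.\<close>

lemma integral_mehler_herm:
  assumes q: "-1 < q" "q < 1" and a: "\<bar>a\<bar> < 1" and x: "x \<in> S q"
  shows "integral (S q) (\<lambda>y. mehler_sum q y x a 0 0 * (P j y 0 0 q * f_N y q)) =
    a ^ j * P j x 0 0 q * integral (S q) (\<lambda>y. f_N y q)"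
proof -
  define M where "M = integral (S q) (\<lambda>y. f_N y q)"
  have c: "continuous_on (S q) (\<lambda>y. P j y 0 0 q * f_N y q)"
    by (intro continuous_intros continuous_P continuous_f_N q)
  have f: "qfact q m \<noteq> 0" for m using qfact_pos[of q m] q by simp
  have "a ^ m / qfact q m * P m x 0 0 q * integral (S q) (\<lambda>y. P (m + 0) y 0 0 q * (P j y 0 0 q * f_N y q))
      = (if m = j then a ^ j * P j x 0 0 q * M else 0)" for m
    using herm_orthogonal_f_N[OF q, of m j] f[of m] f[of j] by (simp add: M_def mult.assoc)
  then have "(\<lambda>m. if m = j then a ^ j * P j x 0 0 q * M else 0) sums
      integral (S q) (\<lambda>y. mehler_sum q y x a 0 0 * (P j y 0 0 q * f_N y q))"
    using integral_mehler_sum_times(2)[OF q a x c, of 0] by simp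
  moreover have "(\<lambda>m. if m = j then a ^ j * P j x 0 0 q * M else 0) sums (a ^ j * P j x 0 0 q * M)"
    by (rule sums_single)
  ultimately show ?thesis unfolding M_def by (rule sums_unique2)
qed

lemma integral_mehler_sum_mehler:
  assumes q: "-1 < q" "q < 1" and a: "\<bar>a\<bar> < 1" and b: "\<bar>b\<bar> < 1" and x: "x \<in> S q" and z: "z \<in> S q"
  shows "integral (S q) (\<lambda>y. mehler_sum q y z b n 0 * (mehler_sum q y x a 0 0 * f_N y q)) =
    a ^ n * mehler_sum q x z (a * b) n 0 * integral (S q) (\<lambda>y. f_N y q)"
proof -
  define M where "M = integral (S q) (\<lambda>y. f_N y q)"
  have ab: "\<bar>a * b\<bar> < 1" using abs_mult_power_less_1[of a b 1] a b by simp
  have c: "continuous_on (S q) (\<lambda>y. mehler_sum q y x a 0 0 * f_N y q)"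
    by (intro continuous_intros integral_mehler_sum_times(1)[OF q a x continuous_on_const] continuous_f_N q)
  have i: "integral (S q) (\<lambda>y. P j y 0 0 q * (mehler_sum q y x a 0 0 * f_N y q)) = a ^ j * P j x 0 0 q * M" for j
    using integral_mehler_herm[OF q a x, of j] by (simp add: M_def mult_ac)
  have "b ^ m / qfact q m * P m z 0 0 q * integral (S q) (\<lambda>y. P (m + n) y 0 0 q * (mehler_sum q y x a 0 0 * f_N y q))
      = a ^ n * M * mehler_term q x z (a * b) n 0 m" for m
    unfolding i by (simp add: mehler_term_def power_add power_mult_distrib mult_ac)
  then have "(\<lambda>m. a ^ n * M * mehler_term q x z (a * b) n 0 m) sums
      integral (S q) (\<lambda>y. mehler_sum q y z b n 0 * (mehler_sum q y x a 0 0 * f_N y q))"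
    using integral_mehler_sum_times(2)[OF q b z c, of n] by simp
  moreover have "(\<lambda>m. a ^ n * M * mehler_term q x z (a * b) n 0 m) sums (a ^ n * M * mehler_sum q x z (a * b) n 0)"
    by (intro sums_mult mehler_term_sums[OF q ab x z])
  ultimately show ?thesis unfolding M_def using sums_unique2 by (fastforce simp: mult_ac)
qed

lemma f_AW_eq_mehler:
  assumes q: "-1 < q" "q < 1"
  shows "f_AW y x a z b q = f_N y q * mehler y z b q * mehler x y a q / mehler x z (a * b) q"
  using q by (simp add: f_AW_def f_CN_def mehler_def mult_ac)

text \<open>The moments of the \<open>P\<^sub>n\<close> under the Askey--Wilson density, relative to the total mass \<open>T\<close>, which is the case
\<open>n = 0\<close>. Keeping \<open>T\<close> as a parameter avoids evaluating \<open>\<integral> f\<^sub>N\<close>.\<close>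

definition AW_moments :: "real \<Rightarrow> real \<Rightarrow> real \<Rightarrow> real \<Rightarrow> real \<Rightarrow> real \<Rightarrow> bool" where
  "AW_moments q a b x z T \<longleftrightarrow> (\<forall>n.
     set_integrable lborel (S q) (\<lambda>y. P n y z b q * f_AW y x a z b q) \<and>
     (LINT y:S q|lborel. P n y z b q * f_AW y x a z b q) =
       a ^ n * qpoch (b\<^sup>2) q n / qpoch (a\<^sup>2 * b\<^sup>2) q n * P n x z (a * b) q * T)"

lemma AW_moments_less_1:
  assumes q: "-1 < q" "q < 1" and a: "\<bar>a\<bar> < 1" and b: "\<bar>b\<bar> < 1" and x: "x \<in> S q" and z: "z \<in> S q"
  shows "AW_moments q a b x z (integral (S q) (\<lambda>y. f_N y q))"
  unfolding AW_moments_def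
proof
  fix n
  define M where "M = integral (S q) (\<lambda>y. f_N y q)"
  have q': "q \<le> 1" using q by simp
  have ab: "\<bar>a * b\<bar> < 1" using abs_mult_power_less_1[of a b 1] a b by simp
  have ab2: "\<bar>a\<^sup>2 * b\<^sup>2\<bar> < 1"
    using sq_mult_sq_less_1[OF a b] by (simp add: abs_mult)
  define m where "m = mehler x z (a * b) q"
  have m: "m > 0" unfolding m_def by (rule mehler_pos[OF q(1) q' ab x z])
  have eq: "P n y z b q * f_AW y x a z b q =
      qpoch (b\<^sup>2) q n / m * (mehler_sum q y z b n 0 * (mehler_sum q y x a 0 0 * f_N y q))" if y: "y \<in> S q" for y
  proof -
    have "P n y z b q * mehler y z b q = qpoch (b\<^sup>2) q n * mehler_sum q y z b n 0"
      using mehler_sum_eq_P[OF q(1) q' b y z, of n] mehler_sum_eq_mehler[OF q(1) q' b y z] by simp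
    moreover have "mehler x y a q = mehler_sum q y x a 0 0"
      using mehler_sum_eq_mehler[OF q(1) q' a y x] by (simp add: mehler_commute)
    moreover have "P n y z b q * f_AW y x a z b q = (P n y z b q * mehler y z b q) * mehler x y a q * f_N y q / m"
      unfolding f_AW_eq_mehler[OF q] m_def by (simp add: mult_ac)
    ultimately show ?thesis by (simp add: mult_ac)
  qed
  have c: "continuous_on (S q) (\<lambda>y. P n y z b q * f_AW y x a z b q)"
  proof -
    have "continuous_on (S q) (\<lambda>y. qpoch (b\<^sup>2) q n / m * (mehler_sum q y z b n 0 * (mehler_sum q y x a 0 0 * f_N y q)))"
      by (intro continuous_intros integral_mehler_sum_times(1)[OF q a x continuous_on_const]
          integral_mehler_sum_times(1)[OF q b z continuous_on_const] continuous_f_N q)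
    then show ?thesis by (rule continuous_on_cong[THEN iffD1, rotated 2]) (simp_all add: eq)
  qed
  have si: "set_integrable lborel (S q) (\<lambda>y. P n y z b q * f_AW y x a z b q)"
    using c unfolding S_less_1[OF q(2)] by (rule borel_integrable_atLeastAtMost')
  have "(LINT y:S q|lborel. P n y z b q * f_AW y x a z b q) = integral (S q) (\<lambda>y. P n y z b q * f_AW y x a z b q)"
    by (rule set_borel_integral_eq_integral(2)[OF si])
  also have "\<dots> = integral (S q) (\<lambda>y. qpoch (b\<^sup>2) q n / m * (mehler_sum q y z b n 0 * (mehler_sum q y x a 0 0 * f_N y q)))"
    by (intro integral_cong eq)
  also have "\<dots> = qpoch (b\<^sup>2) q n / m * (a ^ n * mehler_sum q x z (a * b) n 0 * M)"
    unfolding integral_mult_right integral_mehler_sum_mehler[OF q a b x z] M_def ..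
  also have "mehler_sum q x z (a * b) n 0 = P n x z (a * b) q * m / qpoch (a\<^sup>2 * b\<^sup>2) q n"
    using mehler_sum_eq_P[OF q(1) q' ab x z, of n] qpoch_pos[OF q(1) q' ab2, of n]
    unfolding mehler_sum_eq_mehler[OF q(1) q' ab x z] m_def
    by (simp add: power_mult_distrib nonzero_eq_divide_eq mult.commute)
  also have "qpoch (b\<^sup>2) q n / m * (a ^ n * (P n x z (a * b) q * m / qpoch (a\<^sup>2 * b\<^sup>2) q n) * M)
      = a ^ n * qpoch (b\<^sup>2) q n / qpoch (a\<^sup>2 * b\<^sup>2) q n * P n x z (a * b) q * M"
    using m by simp
  finally show "set_integrable lborel (S q) (\<lambda>y. P n y z b q * f_AW y x a z b q) \<and>
     (LINT y:S q|lborel. P n y z b q * f_AW y x a z b q) =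
       a ^ n * qpoch (b\<^sup>2) q n / qpoch (a\<^sup>2 * b\<^sup>2) q n * P n x z (a * b) q * integral (S q) (\<lambda>y. f_N y q)"
    using si unfolding M_def by blast
qed

section \<open>Moments of the Askey--Wilson density for q equal to 1\<close>

lemma qpoch_1: "qpoch c 1 n = (1 - c) ^ n"
  by (simp add: qpoch_def)

definition gauss_int :: "real \<Rightarrow> real \<Rightarrow> real poly \<Rightarrow> real" where
  "gauss_int \<mu> \<sigma> p = (LINT y|lborel. normal_density \<mu> \<sigma> y * poly p (y - \<mu>))"

lemma integrable_gauss_poly:
  assumes "\<sigma> > 0"
  shows "integrable lborel (\<lambda>y. normal_density \<mu> \<sigma> y * poly p (y - \<mu>))"
proof -
  have "integrable lborel (\<lambda>y. \<Sum>i\<le>degree p. coeff p i * (normal_density \<mu> \<sigma> y * (y - \<mu>) ^ i))"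
    by (intro Bochner_Integration.integrable_sum integrable_mult_right integrable_normal_moment assms)
  then show ?thesis by (simp add: poly_altdef sum_distrib_left mult_ac)
qed

lemma gauss_int_add: "\<sigma> > 0 \<Longrightarrow> gauss_int \<mu> \<sigma> (p + r) = gauss_int \<mu> \<sigma> p + gauss_int \<mu> \<sigma> r"
  unfolding gauss_int_def poly_add distrib_left
  by (intro Bochner_Integration.integral_add integrable_gauss_poly)

lemma gauss_int_smult: "gauss_int \<mu> \<sigma> (smult c p) = c * gauss_int \<mu> \<sigma> p"
  unfolding gauss_int_def Bochner_Integration.integral_mult_right_zero[symmetric] by (simp add: mult_ac)

lemma gauss_int_monom_Suc:
  assumes \<sigma>: "\<sigma> > 0"
  shows "gauss_int \<mu> \<sigma> (monom 1 (Suc k)) = \<sigma>\<^sup>2 * gauss_int \<mu> \<sigma> (pderiv (monom 1 k))"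
proof -
  have m: "gauss_int \<mu> \<sigma> (monom c k) = c * (LINT y|lborel. normal_density \<mu> \<sigma> y * (y - \<mu>) ^ k)" for c k
    unfolding gauss_int_def Bochner_Integration.integral_mult_right_zero[symmetric]
    by (simp add: poly_monom mult_ac)
  show ?thesis
  proof (cases "even k")
    case True
    then obtain j where j: "k = 2 * j" by (rule evenE)
    have 1: "gauss_int \<mu> \<sigma> (monom 1 (Suc k)) = 0"
      unfolding m using integral_normal_moment_odd[OF \<sigma>, of \<mu> j] by (simp add: j)
    have 2: "gauss_int \<mu> \<sigma> (pderiv (monom 1 k)) = 0"
    proof (cases j)
      case (Suc i)
      have "k - 1 = 2 * i + 1" by (simp add: j Suc)
      then show ?thesis
        unfolding pderiv_monom m using integral_normal_moment_odd[OF \<sigma>, of \<mu> i] by simp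
    qed (simp add: j pderiv_monom gauss_int_def)
    show ?thesis unfolding 1 2 by simp
  next
    case False
    then obtain j where j: "k = 2 * j + 1" by (rule oddE)
    define D where "D = (2 / \<sigma>\<^sup>2) ^ j * fact j"
    have D: "D > 0" using \<sigma> by (simp add: D_def)
    have 1: "gauss_int \<mu> \<sigma> (monom 1 (Suc k)) = fact (2 * (j + 1)) / ((2 / \<sigma>\<^sup>2) ^ (j + 1) * fact (j + 1))"
      unfolding m using integral_normal_moment_even[OF \<sigma>, of \<mu> "j + 1"] by (simp add: j)
    have 2: "gauss_int \<mu> \<sigma> (pderiv (monom 1 k)) = real k * (fact (2 * j) / D)"
      unfolding pderiv_monom m using integral_normal_moment_even[OF \<sigma>, of \<mu> j] by (simp add: j D_def)
    have 3: "(2 / \<sigma>\<^sup>2) ^ (j + 1) * fact (j + 1) = 2 / \<sigma>\<^sup>2 * real (j + 1) * D"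
      by (simp add: D_def algebra_simps)
    have 4: "fact (2 * (j + 1)) = 2 * real (j + 1) * (real k * fact (2 * j))"
      by (simp add: j algebra_simps)
    have "real (j + 1) > 0" by simp
    then show ?thesis unfolding 1 2 3 4 using D \<sigma> by (simp add: field_simps del: of_nat_add of_nat_Suc)
  qed
qed

text \<open>Stein's identity \<open>E[(Y - \<mu>) p(Y - \<mu>)] = \<sigma>\<^sup>2 E[p'(Y - \<mu>)]\<close>, reduced to the known moments of the normal distribution.
The induction on \<open>p\<close> carries along a factor \<open>X\<^sup>k\<close>, because \<open>p\<close> is built up from its lowest coefficient.\<close>

lemma gauss_int_stein:
  assumes \<sigma>: "\<sigma> > 0"
  shows "gauss_int \<mu> \<sigma> ([:0, 1:] * p) = \<sigma>\<^sup>2 * gauss_int \<mu> \<sigma> (pderiv p)"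
proof -
  have "gauss_int \<mu> \<sigma> (monom 1 (Suc k) * p) = \<sigma>\<^sup>2 * gauss_int \<mu> \<sigma> (pderiv (monom 1 k * p))" for k
  proof (induction p arbitrary: k)
    case 0
    show ?case using gauss_int_smult[of \<mu> \<sigma> 0 0] by simp
  next
    case (pCons c p)
    have e: "monom 1 k * pCons c p = smult c (monom 1 k) + monom 1 (Suc k) * p" for k
    proof -
      have "pCons c p = [:c:] + [:0, 1:] * p" by simp
      then have "monom 1 k * pCons c p = smult c (monom 1 k) + (monom 1 k * [:0, 1:]) * p"
        by (simp add: distrib_left mult_ac)
      also have "monom 1 k * [:0, 1:] = (monom 1 (Suc k) :: real poly)"
        by (simp add: monom_Suc)
      finally show ?thesis .
    qed
    show ?case
      unfolding e pderiv_add pderiv_smult gauss_int_add[OF \<sigma>] gauss_int_smult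
        gauss_int_monom_Suc[OF \<sigma>] pCons.IH by (simp add: algebra_simps)
  qed
  from this[of 0] show ?thesis by (simp add: monom_Suc)
qed

text \<open>\<open>P\<^sub>n(y|z,b,1)\<close> as a polynomial in \<open>y - \<mu>\<close>, with \<open>c = \<mu> - b z\<close>.\<close>

fun shifted_P_poly :: "real \<Rightarrow> real \<Rightarrow> nat \<Rightarrow> real poly" where
  "shifted_P_poly c b 0 = 1"
| "shifted_P_poly c b (Suc 0) = [:c, 1:]"
| "shifted_P_poly c b (Suc (Suc n)) = [:c, 1:] * shifted_P_poly c b (Suc n)
     - smult ((1 - b\<^sup>2) * real (Suc n)) (shifted_P_poly c b n)"

lemma poly_shifted_P_poly: "poly (shifted_P_poly (\<mu> - b * z) b n) (y - \<mu>) = P n y z b 1"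
proof (induction n rule: less_induct)
  case (less n)
  consider "n = 0" | "n = Suc 0" | k where "n = Suc (Suc k)"
    by (cases n; cases "n - 1") auto
  then show ?case
    by cases (use less in \<open>auto simp: algebra_simps\<close>)
qed

text \<open>For \<open>q = 1\<close> the polynomials form an Appell sequence; this closes the recurrence that Stein's identity gives.\<close>

lemma pderiv_shifted_P_poly:
  "pderiv (shifted_P_poly c b n) = smult (real n) (shifted_P_poly c b (n - 1))"
proof (induction n rule: less_induct)
  case (less n)
  consider "n = 0" | "n = Suc 0" | k where "n = Suc (Suc k)"
    by (cases n; cases "n - 1") auto
  then show ?case
  proof cases
    case (3 k)
    define p where "p = shifted_P_poly c b"
    have 1: "pderiv (p (Suc k)) = smult (real (Suc k)) (p k)" "pderiv (p k) = smult (real k) (p (k - 1))"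
      using less[of "Suc k"] less[of k] 3 by (auto simp: p_def)
    have r: "p (Suc k) = [:c, 1:] * p k - smult ((1 - b\<^sup>2) * real k) (p (k - 1))"
      by (cases k) (auto simp: p_def)
    have "pderiv (p n) = p (Suc k) + [:c, 1:] * pderiv (p (Suc k)) - smult ((1 - b\<^sup>2) * real (Suc k)) (pderiv (p k))"
      unfolding 3 p_def shifted_P_poly.simps pderiv_diff pderiv_mult pderiv_smult
      by (simp add: pderiv_pCons add.commute)
    also have "\<dots> = p (Suc k) + smult (real (Suc k)) ([:c, 1:] * p k - smult ((1 - b\<^sup>2) * real k) (p (k - 1)))"
      unfolding 1 by (simp add: smult_diff_right mult_ac)
    also have "\<dots> = smult (1 + real (Suc k)) (p (Suc k))"
      unfolding r[symmetric] smult_add_left by simp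
    finally show ?thesis by (simp add: 3 p_def)
  qed (simp_all add: pderiv_pCons)
qed

text \<open>Completing the square in \<open>y\<close>: the density is the conditional law of the middle variable of a Gaussian Markov chain
given its two neighbours.\<close>

lemma f_AW_1_normal:
  assumes a: "\<bar>a\<bar> < 1" and b: "\<bar>b\<bar> < 1"
  defines "A \<equiv> 1 - a\<^sup>2" and "B \<equiv> 1 - b\<^sup>2" and "C \<equiv> 1 - a\<^sup>2 * b\<^sup>2"
  shows "f_AW y x a z b 1 = normal_density ((a * B * x + b * A * z) / C) (sqrt (A * B / C)) y"
proof -
  have pos: "A > 0" "B > 0"
    using a b by (auto simp: A_def B_def abs_square_less_1)
  have C: "C > 0" using sq_mult_sq_less_1[OF a b] by (simp add: C_def)
  define \<mu> where "\<mu> = (a * B * x + b * A * z) / C"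
  have key: "(x - a * y)\<^sup>2 * (B * C) + (y - b * z)\<^sup>2 * (A * C) - (x - a * b * z)\<^sup>2 * (A * B)
      = (C * y - (a * B * x + b * A * z))\<^sup>2"
    unfolding A_def B_def C_def by algebra
  have "(y - \<mu>)\<^sup>2 * (C * C) = ((y - \<mu>) * C)\<^sup>2"
    by (simp add: power2_eq_square mult_ac)
  also have "(y - \<mu>) * C = C * y - (a * B * x + b * A * z)"
  proof -
    have e: "\<mu> * C = a * B * x + b * A * z" using C by (simp add: \<mu>_def)
    show ?thesis unfolding left_diff_distrib e by simp
  qed
  finally have key2: "(y - \<mu>)\<^sup>2 * (C * C) = (C * y - (a * B * x + b * A * z))\<^sup>2" .
  have expo: "- (x - a * y)\<^sup>2 / (2 * A) + - (y - b * z)\<^sup>2 / (2 * B) - (- (x - a * b * z)\<^sup>2 / (2 * C))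
      = - (y - \<mu>)\<^sup>2 / (2 * (A * B / C))"
  proof -
    have "- (x - a * y)\<^sup>2 / (2 * A) + - (y - b * z)\<^sup>2 / (2 * B) - (- (x - a * b * z)\<^sup>2 / (2 * C))
      = - ((x - a * y)\<^sup>2 * (B * C) + (y - b * z)\<^sup>2 * (A * C) - (x - a * b * z)\<^sup>2 * (A * B)) / (2 * A * B * C)"
      using pos C by (simp add: add_divide_distrib diff_divide_distrib)
    also have "\<dots> = - ((y - \<mu>)\<^sup>2 * (C * C)) / (2 * A * B * C)"
      unfolding key key2 ..
    also have "\<dots> = - (y - \<mu>)\<^sup>2 / (2 * (A * B / C))"
      using pos C by simp
    finally show ?thesis .
  qed
  have const: "1 / sqrt (2 * pi * A) * (1 / sqrt (2 * pi * B)) / (1 / sqrt (2 * pi * C)) = 1 / sqrt (2 * pi * (A * B / C))"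
  proof -
    have "2 * pi * A * (2 * pi * B) / (2 * pi * C) = 2 * pi * (A * B / C)" by simp
    then have "sqrt (2 * pi * A) * sqrt (2 * pi * B) / sqrt (2 * pi * C) = sqrt (2 * pi * (A * B / C))"
      by (simp only: real_sqrt_mult[symmetric] real_sqrt_divide[symmetric])
    then show ?thesis by (simp only: divide_divide_eq_right[symmetric] times_divide_times_eq) (simp add: divide_simps)
  qed
  have regroup: "(k1 * e1) * (k2 * e2) / (k3 * e3) = (k1 * k2 / k3) * (e1 * e2 / e3)"
    for k1 k2 k3 e1 e2 e3 :: real by simp
  have ab: "1 - (a * b)\<^sup>2 = C" by (simp add: C_def power_mult_distrib)
  have sq: "(sqrt (A * B / C))\<^sup>2 = A * B / C" using pos C by simp
  have "f_AW y x a z b 1 = (1 / sqrt (2 * pi * A) * exp (- (x - a * y)\<^sup>2 / (2 * A)))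
      * (1 / sqrt (2 * pi * B) * exp (- (y - b * z)\<^sup>2 / (2 * B)))
      / (1 / sqrt (2 * pi * C) * exp (- (x - a * b * z)\<^sup>2 / (2 * C)))"
    unfolding f_AW_def f_CN_def ab A_def[symmetric] B_def[symmetric] by simp
  also have "\<dots> = (1 / sqrt (2 * pi * A) * (1 / sqrt (2 * pi * B)) / (1 / sqrt (2 * pi * C)))
      * (exp (- (x - a * y)\<^sup>2 / (2 * A)) * exp (- (y - b * z)\<^sup>2 / (2 * B)) / exp (- (x - a * b * z)\<^sup>2 / (2 * C)))"
    by (rule regroup)
  also have "\<dots> = 1 / sqrt (2 * pi * (A * B / C)) * exp (- (y - \<mu>)\<^sup>2 / (2 * (A * B / C)))"
    unfolding const exp_add[symmetric] exp_diff[symmetric] expo ..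
  finally show ?thesis
    unfolding normal_density_def sq \<mu>_def .
qed

text \<open>Stein's identity and the Appell property give the moments \<open>e\<^sub>n\<close> of \<open>P\<^sub>n\<close> a three-term recurrence; with the drift
\<open>\<mu> - b z = \<kappa> (x - a b z)\<close> and \<open>1 - b\<^sup>2 - \<sigma>\<^sup>2 = \<kappa>\<^sup>2 (1 - a\<^sup>2 b\<^sup>2)\<close> it is the recurrence of \<open>\<kappa>\<^sup>n P\<^sub>n(x|z,ab,1)\<close>.\<close>

lemma AW_moments_1:
  assumes a: "\<bar>a\<bar> < 1" and b: "\<bar>b\<bar> < 1"
  shows "AW_moments 1 a b x z 1"
  unfolding AW_moments_def
proof
  fix n
  define A B C where "A = 1 - a\<^sup>2" and "B = 1 - b\<^sup>2" and "C = 1 - a\<^sup>2 * b\<^sup>2"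
  have pos: "A > 0" "B > 0"
    using a b by (auto simp: A_def B_def abs_square_less_1)
  have C: "C > 0" using sq_mult_sq_less_1[OF a b] by (simp add: C_def)
  define \<mu> \<sigma> where "\<mu> = (a * B * x + b * A * z) / C" and "\<sigma> = sqrt (A * B / C)"
  have \<sigma>: "\<sigma> > 0" using pos C by (simp add: \<sigma>_def)
  have \<sigma>2: "\<sigma>\<^sup>2 = A * B / C" using pos C by (simp add: \<sigma>_def)
  have f: "f_AW y x a z b 1 = normal_density \<mu> \<sigma> y" for y
    unfolding \<mu>_def \<sigma>_def A_def B_def C_def by (rule f_AW_1_normal[OF a b])
  define p where "p = shifted_P_poly (\<mu> - b * z) b"
  define e where "e = (\<lambda>n. gauss_int \<mu> \<sigma> (p n))"
  define \<kappa> where "\<kappa> = a * B / C"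
  have drift: "\<mu> - b * z = \<kappa> * (x - a * b * z)"
  proof -
    have "(\<mu> - b * z) * C = a * B * (x - a * b * z)"
      using C by (simp add: \<mu>_def left_diff_distrib) (simp add: A_def B_def C_def algebra_simps power2_eq_square)
    then show ?thesis using C by (simp add: \<kappa>_def field_simps)
  qed
  have var: "B - \<sigma>\<^sup>2 = \<kappa>\<^sup>2 * C"
  proof -
    have "(B - \<sigma>\<^sup>2) * C = B * (C - A)" using C by (simp add: \<sigma>2 algebra_simps)
    also have "C - A = a\<^sup>2 * B" by (simp add: A_def B_def C_def algebra_simps)
    finally have "(B - \<sigma>\<^sup>2) * C = a\<^sup>2 * B\<^sup>2" by (simp add: power2_eq_square mult_ac)
    then show ?thesis using C by (simp add: \<kappa>_def field_simps power2_eq_square)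
  qed
  have diff: "gauss_int \<mu> \<sigma> (p - r) = gauss_int \<mu> \<sigma> p - gauss_int \<mu> \<sigma> r" for p r
    using gauss_int_add[OF \<sigma>, of \<mu> p "smult (-1) r"] gauss_int_smult[of \<mu> \<sigma> "-1" r] by simp
  have lin: "gauss_int \<mu> \<sigma> ([:c, 1:] * r) = c * gauss_int \<mu> \<sigma> r + \<sigma>\<^sup>2 * gauss_int \<mu> \<sigma> (pderiv r)" for c r
  proof -
    have "[:c, 1:] * r = smult c r + [:0, 1:] * r" by simp
    then show ?thesis by (simp only: gauss_int_add[OF \<sigma>] gauss_int_smult gauss_int_stein[OF \<sigma>])
  qed
  have e0: "e 0 = 1" using integral_normal_density[OF \<sigma>, of \<mu>] by (simp add: e_def p_def gauss_int_def)
  have e1: "e (Suc 0) = \<kappa> * (x - a * b * z)"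
    using lin[of "\<mu> - b * z" 1] e0 gauss_int_smult[of \<mu> \<sigma> 0 0] drift by (simp add: e_def p_def)
  have e_rec: "e (Suc (Suc k)) = \<kappa> * (x - a * b * z) * e (Suc k) - \<kappa>\<^sup>2 * C * real (Suc k) * e k" for k
  proof -
    have "e (Suc (Suc k)) = (\<mu> - b * z) * e (Suc k) + \<sigma>\<^sup>2 * (real (Suc k) * e k) - B * real (Suc k) * e k"
      unfolding e_def p_def shifted_P_poly.simps(3) diff lin gauss_int_smult pderiv_shifted_P_poly B_def by simp
    then show ?thesis unfolding drift var[symmetric] by (simp add: algebra_simps)
  qed
  have "e n = \<kappa> ^ n * P n x z (a * b) 1" for n
  proof (induction n rule: less_induct)
    case (less n)
    consider "n = 0" | "n = Suc 0" | k where "n = Suc (Suc k)"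
      by (cases n; cases "n - 1") auto
    then show ?case
    proof cases
      case (3 k)
      have Cab: "1 - (a * b)\<^sup>2 = C" by (simp add: C_def power_mult_distrib)
      have P: "P (Suc (Suc k)) x z (a * b) 1 = (x - a * b * z) * P (Suc k) x z (a * b) 1 - C * real (Suc k) * P k x z (a * b) 1"
        using Cab by simp
      show ?thesis
        unfolding 3 e_rec P using less[of k] less[of "Suc k"] 3
        by (simp add: power2_eq_square algebra_simps)
    qed (simp_all add: e0 e1)
  qed
  moreover have "e n = (LINT y|lborel. P n y z b 1 * f_AW y x a z b 1)"
    unfolding e_def gauss_int_def p_def poly_shifted_P_poly f by (simp add: mult.commute)
  moreover have "\<kappa> ^ n = a ^ n * qpoch (b\<^sup>2) 1 n / qpoch (a\<^sup>2 * b\<^sup>2) 1 n"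
    unfolding qpoch_1 by (simp add: \<kappa>_def B_def C_def power_mult_distrib power_divide)
  moreover have "integrable lborel (\<lambda>y. P n y z b 1 * f_AW y x a z b 1)"
    using integrable_gauss_poly[OF \<sigma>, of \<mu> "p n"] unfolding p_def poly_shifted_P_poly f
    by (simp add: mult.commute)
  ultimately show "set_integrable lborel (S 1) (\<lambda>y. P n y z b 1 * f_AW y x a z b 1) \<and>
     (LINT y:S 1|lborel. P n y z b 1 * f_AW y x a z b 1) =
       a ^ n * qpoch (b\<^sup>2) 1 n / qpoch (a\<^sup>2 * b\<^sup>2) 1 n * P n x z (a * b) 1 * 1"
    by (simp add: S_def set_integrable_def set_lebesgue_integral_def)
qed

section \<open>The density, its moments and the Askey--Wilson polynomials\<close>

text \<open>For \<open>q = 1\<close> the factor \<open>\<phi>\<close>, the standard normal density, plays the role of the cancelled \<open>f\<^sub>N\<close>.\<close>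

lemma f_AW_eq_f_CN_mehler:
  assumes q: "-1 < q" "q \<le> 1" and a: "\<bar>a\<bar> < 1" and b: "\<bar>b\<bar> < 1"
  shows "f_AW y x a z b q = f_CN y z b q * (mehler x y a q / mehler x z (a * b) q)"
proof (cases "q = 1")
  case False
  then show ?thesis using q by (simp add: f_AW_def mehler_def mult_ac)
next
  case True
  define \<phi> where "\<phi> = exp (- x\<^sup>2 / 2) / sqrt (2 * pi)"
  have \<phi>: "\<phi> \<noteq> 0" by (simp add: \<phi>_def)
  have ab: "\<bar>a * b\<bar> < 1" using abs_mult_power_less_1[of a b 1] a b by simp
  have fac: "f_CN x y t 1 = \<phi> * mehler x y t 1" if t: "\<bar>t\<bar> < 1" for t y
  proof -
    have t2: "1 - t\<^sup>2 > 0" using t by (simp add: abs_square_less_1)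
    have "- (x - t * y)\<^sup>2 / (2 * (1 - t\<^sup>2)) = - x\<^sup>2 / 2 + (2 * t * x * y - t\<^sup>2 * (x\<^sup>2 + y\<^sup>2)) / (2 * (1 - t\<^sup>2))"
      using t2 by (simp add: divide_simps) (simp add: algebra_simps power2_eq_square)
    then have e: "exp (- (x - t * y)\<^sup>2 / (2 * (1 - t\<^sup>2))) =
        exp (- x\<^sup>2 / 2) * exp ((2 * t * x * y - t\<^sup>2 * (x\<^sup>2 + y\<^sup>2)) / (2 * (1 - t\<^sup>2)))"
      by (simp only: exp_add)
    have "f_CN x y t 1 = 1 / sqrt (2 * pi * (1 - t\<^sup>2)) * exp (- (x - t * y)\<^sup>2 / (2 * (1 - t\<^sup>2)))"
      unfolding f_CN_def by simp
    then show ?thesis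
      unfolding e mehler_def \<phi>_def real_sqrt_mult by simp
  qed
  show ?thesis using \<phi> unfolding True f_AW_def by (simp add: fac[OF a] fac[OF ab])
qed

lemma AW_moments_exists:
  assumes q: "-1 < q" "q \<le> 1" and a: "\<bar>a\<bar> < 1" and b: "\<bar>b\<bar> < 1" and x: "x \<in> S q" and z: "z \<in> S q"
  shows "\<exists>T>0. AW_moments q a b x z T"
proof (cases "q = 1")
  case True
  then show ?thesis using AW_moments_1[OF a b] by (intro exI[of _ 1]) simp
next
  case False
  with q have q1: "q < 1" by simp
  show ?thesis using AW_moments_less_1[OF q(1) q1 a b x z] integral_f_N_pos[OF q(1) q1] by blast
qed

lemma P_monic_poly: "\<exists>p. degree p \<le> n \<and> coeff p n = 1 \<and> (\<forall>x. poly p x = P n x y b q)"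
proof (induction n rule: less_induct)
  case (less n)
  consider "n = 0" | "n = Suc 0" | k where "n = Suc (Suc k)"
    by (cases n; cases "n - 1") auto
  then show ?case
  proof cases
    case 1
    then show ?thesis by (intro exI[of _ 1]) simp
  next
    case 2
    then show ?thesis by (intro exI[of _ "[:- b * y, 1:]"]) simp
  next
    case (3 k)
    obtain p where p: "degree p \<le> k" "\<forall>x. poly p x = P k x y b q" using less[of k] 3 by auto
    obtain r where r: "degree r \<le> Suc k" "coeff r (Suc k) = 1" "\<forall>x. poly r x = P (Suc k) x y b q"
      using less[of "Suc k"] 3 by auto
    define d where "d = b * y * q ^ Suc k"
    define c where "c = (1 - b\<^sup>2 * q ^ k) * qnum q (Suc k)"
    define u where "u = [:- d, 1:] * r - smult c p"
    have "degree ([:- d, 1:] * r) \<le> Suc (Suc k)"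
      using degree_mult_le[of "[:- d, 1:]" r] r(1) by simp
    moreover have "degree (smult c p) \<le> Suc (Suc k)" using p(1) degree_smult_le[of c p] by linarith
    ultimately have "degree u \<le> Suc (Suc k)" unfolding u_def by (rule degree_diff_le)
    moreover have "coeff u (Suc (Suc k)) = 1"
      using p(1) r by (simp add: u_def coeff_eq_0)
    moreover have "\<forall>x. poly u x = P (Suc (Suc k)) x y b q"
      using p(2) r(3) by (simp add: u_def c_def d_def left_diff_distrib)
    ultimately show ?thesis unfolding 3 by blast
  qed
qed

lemma poly_expand_P:
  "degree p \<le> j \<Longrightarrow> \<exists>c. \<forall>x. poly p x = (\<Sum>n=0..j. c n * P n x y b q)"
proof (induction j arbitrary: p)
  case 0
  then obtain c where "p = [:c:]" by (metis degree_eq_zeroE le_zero_eq)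
  then show ?case by (intro exI[of _ "\<lambda>_. c"]) simp
next
  case (Suc j)
  obtain r where r: "degree r \<le> Suc j" "coeff r (Suc j) = 1" "\<forall>x. poly r x = P (Suc j) x y b q"
    using P_monic_poly by blast
  define u where "u = p - smult (coeff p (Suc j)) r"
  have "degree (smult (coeff p (Suc j)) r) \<le> Suc j" using r(1) degree_smult_le order_trans by blast
  with Suc.prems have "degree u \<le> Suc j" unfolding u_def by (rule degree_diff_le)
  moreover have "coeff u (Suc j) = 0" using r(2) by (simp add: u_def)
  ultimately have "degree u \<le> j"
    using eq_zero_or_degree_less[of u "Suc j"] by auto
  from Suc.IH[OF this] obtain c where c: "\<forall>x. poly u x = (\<Sum>n=0..j. c n * P n x y b q)" by blast
  have "poly p x = (\<Sum>n=0..Suc j. (c(Suc j := coeff p (Suc j))) n * P n x y b q)" for x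
  proof -
    have "poly p x = poly u x + coeff p (Suc j) * P (Suc j) x y b q" using r(3) by (simp add: u_def)
    also have "poly u x = (\<Sum>n=0..j. (c(Suc j := coeff p (Suc j))) n * P n x y b q)"
      unfolding c[rule_format] by (intro sum.cong) auto
    finally show ?thesis by (simp del: P.simps)
  qed
  then show ?case by blast
qed

text \<open>The expansion \<open>A\<^sub>j = \<Sum> c\<^sub>n P\<^sub>n\<close> integrates to \<open>T \<Sum> c\<^sub>n d\<^sub>n\<close>, where \<open>d\<^sub>n T\<close> is the moment of \<open>P\<^sub>n\<close>. This is 0 because \<open>A\<^sub>0\<close> is
a nonzero constant, so \<open>\<Sum> c\<^sub>n d\<^sub>n\<close> may be subtracted.\<close>

lemma AW_poly_expansion:
  assumes q: "-1 < q" "q \<le> 1" and a: "\<bar>a\<bar> < 1" and b: "\<bar>b\<bar> < 1" and x: "x \<in> S q" and z: "z \<in> S q"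
    and A: "Askey_Wilson_polys x a z b q A" and j: "j \<ge> 1"
  shows "\<exists>c. \<forall>y. poly (A j) y = (\<Sum>n=0..j. c n * (P n y z b q
      - a ^ n * qpoch (b\<^sup>2) q n / qpoch (a\<^sup>2 * b\<^sup>2) q n * P n x z (a * b) q))"
proof -
  define d where "d = (\<lambda>n. a ^ n * qpoch (b\<^sup>2) q n / qpoch (a\<^sup>2 * b\<^sup>2) q n * P n x z (a * b) q)"
  define f where "f = (\<lambda>y. f_AW y x a z b q)"
  obtain T where T: "T > 0" "AW_moments q a b x z T" using AW_moments_exists[OF q a b x z] by blast
  have int: "set_integrable lborel (S q) (\<lambda>y. P n y z b q * f y)"
    and mom: "(LINT y:S q|lborel. P n y z b q * f y) = d n * T" for n
    using T(2) unfolding AW_moments_def f_def d_def by auto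
  have deg: "degree (A i) = i" "A i \<noteq> 0" for i
    using A unfolding Askey_Wilson_polys_def orthogonal_poly_seq_def by auto
  obtain c where c: "\<forall>y. poly (A j) y = (\<Sum>n=0..j. c n * P n y z b q)"
    using poly_expand_P[of "A j" j z b q] deg(1)[of j] by auto
  obtain h where h: "A 0 = [:h:]" using deg(1)[of 0] by (metis degree_eq_zeroE)
  with deg(2)[of 0] have h0: "h \<noteq> 0" by auto
  have "(LINT y:S q|lborel. poly (A 0) y * poly (A j) y * f y) = 0"
    using A j unfolding Askey_Wilson_polys_def orthogonal_poly_seq_def f_def by auto
  also have "(\<lambda>y. poly (A 0) y * poly (A j) y * f y) = (\<lambda>y. \<Sum>n=0..j. (h * c n) * (P n y z b q * f y))"
    unfolding c[rule_format] h by (simp add: sum_distrib_left sum_distrib_right mult_ac)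
  also have "(LINT y:S q|lborel. (\<Sum>n=0..j. (h * c n) * (P n y z b q * f y)))
      = (\<Sum>n=0..j. LINT y:S q|lborel. (h * c n) * (P n y z b q * f y))"
    unfolding set_lebesgue_integral_def scaleR_sum_right
    using int unfolding set_integrable_def
    by (intro Bochner_Integration.integral_sum) (simp add: mult.left_commute)
  also have "\<dots> = (\<Sum>n=0..j. (h * c n) * (d n * T))"
    by (simp only: set_integral_mult_right mom)
  also have "\<dots> = h * T * (\<Sum>n=0..j. c n * d n)" by (simp add: sum_distrib_left mult_ac)
  finally have z0: "(\<Sum>n=0..j. c n * d n) = 0" using h0 T(1) by simp
  have "poly (A j) y = (\<Sum>n=0..j. c n * (P n y z b q - d n))" for y
    unfolding right_diff_distrib sum_subtractf z0 c[rule_format] by simp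
  then show ?thesis unfolding d_def by blast
qed

theorem mainTheorem4:
  shows "(\<forall>q \<rho>13 \<rho>23 x1 x2 :: real.
      -1 < q \<and> q \<le> 1 \<and> -1 < \<rho>13 \<and> \<rho>13 < 1 \<and> -1 < \<rho>23 \<and> \<rho>23 < 1 \<and> x1 \<in> S q \<and> x2 \<in> S q \<longrightarrow>
        (\<forall>x3\<in>S q.
           summable (\<lambda>s. \<rho>13 ^ s / (qfact q s * qpoch (\<rho>13\<^sup>2 * \<rho>23\<^sup>2) q s)
              * P s x1 x2 (\<rho>13 * \<rho>23) q * P s x3 x2 \<rho>23 q) \<and>
           f_AW x3 x1 \<rho>13 x2 \<rho>23 q = f_CN x3 x2 \<rho>23 q
             * (\<Sum>s. \<rho>13 ^ s / (qfact q s * qpoch (\<rho>13\<^sup>2 * \<rho>23\<^sup>2) q s)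
              * P s x1 x2 (\<rho>13 * \<rho>23) q * P s x3 x2 \<rho>23 q)) \<and>
        (\<forall>n\<ge>1.
           set_integrable lborel (S q) (\<lambda>x3. (P n x3 x2 \<rho>23 q
              - \<rho>13 ^ n * qpoch (\<rho>23\<^sup>2) q n / qpoch (\<rho>13\<^sup>2 * \<rho>23\<^sup>2) q n
                * P n x1 x2 (\<rho>13 * \<rho>23) q) * f_AW x3 x1 \<rho>13 x2 \<rho>23 q) \<and>
           (LINT x3:S q|lborel. (P n x3 x2 \<rho>23 q
              - \<rho>13 ^ n * qpoch (\<rho>23\<^sup>2) q n / qpoch (\<rho>13\<^sup>2 * \<rho>23\<^sup>2) q n
                * P n x1 x2 (\<rho>13 * \<rho>23) q) * f_AW x3 x1 \<rho>13 x2 \<rho>23 q) = 0))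
    \<and>
    (\<forall>A :: real \<Rightarrow> real \<Rightarrow> real \<Rightarrow> real \<Rightarrow> real \<Rightarrow> nat \<Rightarrow> real poly.
      \<exists>F :: nat \<Rightarrow> nat \<Rightarrow> real \<Rightarrow> real \<Rightarrow> real \<Rightarrow> real \<Rightarrow> real \<Rightarrow> real.
      \<forall>q \<rho>13 \<rho>23 x1 x2 :: real.
      -1 < q \<and> q \<le> 1 \<and> -1 < \<rho>13 \<and> \<rho>13 < 1 \<and> -1 < \<rho>23 \<and> \<rho>23 < 1 \<and> x1 \<in> S q \<and> x2 \<in> S q \<and>
      Askey_Wilson_polys x1 \<rho>13 x2 \<rho>23 q (A x1 \<rho>13 x2 \<rho>23 q) \<longrightarrow>
        (\<forall>j\<ge>1. \<forall>x3.
           poly (A x1 \<rho>13 x2 \<rho>23 q j) x3 =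
             (\<Sum>n=0..j. F j n x1 x2 \<rho>13 \<rho>23 q * (P n x3 x2 \<rho>23 q
                - \<rho>13 ^ n * qpoch (\<rho>23\<^sup>2) q n / qpoch (\<rho>13\<^sup>2 * \<rho>23\<^sup>2) q n
                  * P n x1 x2 (\<rho>13 * \<rho>23) q))))"
proof (rule conjI, goal_cases)
  case 1
  show ?case
  proof (intro allI impI, elim conjE, intro conjI ballI allI impI)
    fix q a b x z :: real
    assume q: "-1 < q" "q \<le> 1" and "-1 < a" "a < 1" "-1 < b" "b < 1" and x: "x \<in> S q" and z: "z \<in> S q"
    then have a: "\<bar>a\<bar> < 1" and b: "\<bar>b\<bar> < 1" by auto
    {
      fix y assume y: "y \<in> S q"
      note k = kernel_expansion[OF q a b x y z]
      show "summable (\<lambda>s. a ^ s / (qfact q s * qpoch (a\<^sup>2 * b\<^sup>2) q s) * P s x z (a * b) q * P s y z b q)"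
        using k by (rule sums_summable)
      show "f_AW y x a z b q = f_CN y z b q
          * (\<Sum>s. a ^ s / (qfact q s * qpoch (a\<^sup>2 * b\<^sup>2) q s) * P s x z (a * b) q * P s y z b q)"
        unfolding f_AW_eq_f_CN_mehler[OF q a b] sums_unique[OF k] ..
    }
    fix n :: nat
    define d where "d = a ^ n * qpoch (b\<^sup>2) q n / qpoch (a\<^sup>2 * b\<^sup>2) q n * P n x z (a * b) q"
    obtain T where T: "AW_moments q a b x z T" using AW_moments_exists[OF q a b x z] by blast
    have int: "set_integrable lborel (S q) (\<lambda>y. P n y z b q * f_AW y x a z b q)"
      and mom: "(LINT y:S q|lborel. P n y z b q * f_AW y x a z b q) = d * T"
      using T unfolding AW_moments_def d_def by auto
    have int0: "set_integrable lborel (S q) (\<lambda>y. f_AW y x a z b q)"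
      and mom0: "(LINT y:S q|lborel. f_AW y x a z b q) = T"
      using T[unfolded AW_moments_def, rule_format, of 0] by auto
    have int1: "set_integrable lborel (S q) (\<lambda>y. d * f_AW y x a z b q)"
      using int0 by (rule set_integrable_mult_right)
    show "set_integrable lborel (S q) (\<lambda>y. (P n y z b q
              - a ^ n * qpoch (b\<^sup>2) q n / qpoch (a\<^sup>2 * b\<^sup>2) q n * P n x z (a * b) q) * f_AW y x a z b q)"
      unfolding d_def[symmetric] left_diff_distrib by (rule set_integral_diff(1)[OF int int1])
    show "(LINT y:S q|lborel. (P n y z b q
              - a ^ n * qpoch (b\<^sup>2) q n / qpoch (a\<^sup>2 * b\<^sup>2) q n * P n x z (a * b) q) * f_AW y x a z b q) = 0"
      unfolding d_def[symmetric] left_diff_distrib set_integral_diff(2)[OF int int1]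
      by (simp add: mom mom0)
  qed
next
  case 2
  show ?case
  proof (intro allI, goal_cases)
    case (1 A)
    define good where "good = (\<lambda>j x z a b q c. \<forall>y. poly (A x a z b q j) y = (\<Sum>n=0..j. c n * (P n y z b q
        - a ^ n * qpoch (b\<^sup>2) q n / qpoch (a\<^sup>2 * b\<^sup>2) q n * P n x z (a * b) q)))"
    define F where "F = (\<lambda>j n x z a b q. (SOME c. good j x z a b q c) n)"
    have F: "good j x z a b q (\<lambda>n. F j n x z a b q)"
      if "-1 < q" "q \<le> 1" "-1 < a" "a < 1" "-1 < b" "b < 1" "x \<in> S q" "z \<in> S q"
        "Askey_Wilson_polys x a z b q (A x a z b q)" "j \<ge> 1" for j x z a b q
    proof -
      have "\<bar>a\<bar> < 1" "\<bar>b\<bar> < 1" using that by auto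
      then have "\<exists>c. good j x z a b q c"
        unfolding good_def by (intro AW_poly_expansion that)
      then have "good j x z a b q (SOME c. good j x z a b q c)" by (rule someI_ex)
      then show ?thesis by (simp add: F_def)
    qed
    show ?case
      by (rule exI[of _ F]) (use F in \<open>auto simp: good_def\<close>)
  qed
qed

end
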